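(* Let $(M,\mu,T)$ be the collision map of a planar Sinai billiard with finite horizon, and let $U$ be a neighborhood of $1$ in $\mathbb{C}$. There exists a constant $c(U)>0$ such that, for any rank $2$ lattice $\Lambda<\mathbb{Z}^2$, with $G=\mathbb{Z}^2/\Lambda$, the spectrum of $P_\Lambda$ acting on $\mathcal{B}_\Lambda$ admits at least $c(U)|G|$ Ruelle resonances (with multiplicities) in $U$. In particular, if $\Lambda$ is sparse enough (i.e. $|G|$ is large enough), then $P_\Lambda$ admits non-trivial Ruelle resonances (i.e. other than the simple resonance $1$) in $U$.
   Context: **Billiard.** A planar Sinai billiard with finite horizon is given by finitely many non-overlapping (pairwise disjoint) closed convex regions $(\Gamma_k)_{1\le k\le d}$ of the torus $\mathbb{T}^2=\mathbb{R}^2/\mathbb{Z}^2$, whose boundaries $\gamma_k$ are $\mathcal{C}^3$ with non-vanishing curvature, such that any line in the torus meets the interior of one of the $\Gamma_k$. The table is $Q=\mathbb{T}^2\setminus\bigcup_k\mathring{\Gamma}_k$; a point particle moves in $Q$ at unit speed with specular reflections. Let $M=\bigcup_k\gamma_k\times[-\pi/2,\pi/2]$ be the set of outward-facing unit vectors at the boundaries of the obstacles, with coordinates $(\ell,\theta)$ ($\ell$ arclength, $\theta$ angle to the normal). The collision map $T:M\to M$ is the first return map to $M$; it preserves the probability measure $\mu=\frac{\cos\theta}{2\sum_k|\gamma_k|}\,d\ell\,d\theta$. **Coverings.** Let $\widetilde Q\subset\mathbb{R}^2$ be the $\mathbb{Z}^2$-periodic table projecting to $Q$. Choosing one lift $\Gamma_{k,0}\subset\mathbb{R}^2$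 of each $\Gamma_k$, its obstacles are $\Gamma_{k,p}=\Gamma_{k,0}+p$, $p\in\mathbb{Z}^2$, its collision space is $M\times\mathbb{Z}^2$, and its collision map is $\widetilde T(x,p)=(T(x),p+F(x))$, which defines a bounded function $F:M\to\mathbb{Z}^2$. For a rank $2$ lattice $\Lambda<\mathbb{Z}^2$ put $G=\mathbb{Z}^2/\Lambda$ (a finite group). The table $Q_\Lambda$ is the quotient of $\widetilde Q$ by $\Lambda$ and has collision space $M_\Lambda=M\times G$, invariant probability measure $\mu_\Lambda=\frac1{|G|}\sum_{g\in G}\mu\times\delta_g$ and collision map $T_\Lambda(x,g)=(T(x),g+F(x)\ [\Lambda])$. **Transfer operators.** $P(h)=h\circ T^{-1}$ and $P_\Lambda(h)=h\circ T_\Lambda^{-1}$ (on distributions, $(Ph)(\varphi)=h(\varphi\circ T)$, where a function $h$ is identified with $\varphi\mapsto\int h\varphi\,d\mu$; similarly for $P_\Lambda$ with $\mu_\Lambda$). **Banach spaces.** $\mathcal{B}$ is the Demers–Zhang space of anisotropic distributions on $M$, defined as follows. Let $K_{\min},K_{\max}$ be the extremal curvatures of the obstacles and $\tau_{\min}>0$ the minimal travel time between collisions. For $k\ge k_0$ let $H_k=\{\pi/2-k^{-2}<\theta<\pi/2-(k+1)^{-2}\}$, let $H_{-k}$ be its image under $\theta\mapsto-\theta$, and let $H_0=\{|\theta|<\pi/2-k_0^{-2}\}$ (homogeneity strips). Let $\mathcal{W}^s$ be the set of $\mathcal{C}^2$ curves $W=\{(\ell,\theta_W(\ell)):\ell\in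 I_W\}$ contained in a single component of $M$ and a single homogeneity strip, of length at most a small constant, of curvature at most a fixed constant, and tangent to the stable cone $-K_{\max}-1/\tau_{\min}\le d\theta/d\ell\le-K_{\min}$ (orientation of $(\ell,\theta)$ chosen so that this cone field is invariant under $DT^{-1}$). Let $m_W$ be arclength on $W$, $|W|$ its length, $\mathcal{C}^r(W)$ the space of $r$-Hölder functions for arclength, and $G_W(\ell)=(\ell,\theta_W(\ell))$. Let $d(W_1,W_2)=|I_{W_1}\triangle I_{W_2}|+|\theta_{W_1}-\theta_{W_2}|_{\mathcal{C}^1(I_{W_1}\cap I_{W_2})}$ if $W_1,W_2$ lie in the same component and the same strip, and $+\infty$ otherwise; let $d_q(\psi_1,\psi_2)=|\psi_1\circ G_{W_1}-\psi_2\circ G_{W_2}|_{\mathcal{C}^q(I_{W_1}\cap I_{W_2})}$. Fix suitable small parameters $0<q<p\le1/3$, $0<\alpha\le1/3$, $0<\beta\le\min(\alpha,p-q)$, $\varepsilon_0>0$, $b>0$. For $h\in\mathcal{C}^1(M,\mathbb{C})$ set $$\|h\|_s=\sup_{W\in\mathcal{W}^s}\ \sup_{|W|^\alpha|\psi|_{\mathcal{C}^q(W)}\le1}\Big|\int_Wh\psi\,dm_W\Big|,$$ $$\|h\|_u=\sup_{\varepsilon\le\varepsilon_0}\ \sup_{d(W_1,W_2)\le\varepsilon}\ \sup_{|\psi_i|_{\mathcal{C}^p(W_i)}\le1,\ d_q(\psi_1,\psi_2)\le\varepsilon}\varepsilon^{-\beta}\Big|\int_{W_1}h\psi_1\,dm_{W_1}-\int_{W_2}h\psi_2\,dm_{W_2}\Big|,$$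 and $\|h\|_{\mathcal{B}}=\|h\|_s+b\|h\|_u$; $\mathcal{B}$ is the completion of $\mathcal{C}^1(M,\mathbb{C})$ for this norm. $\mathcal{B}_\Lambda$ is the same construction for $(M_\Lambda,\mu_\Lambda,T_\Lambda)$: it is the direct sum of $|G|$ copies of $\mathcal{B}$, with $\|h\|_{\mathcal{B}_\Lambda}=\max_{g\in G}\|h\mathbf{1}_{M\times\{g\}}\|_{\mathcal{B}}$. **Standing facts (Demers–Zhang).** The parameters are chosen so that $P_\Lambda$ acts continuously on $\mathcal{B}_\Lambda$ for every $\Lambda$, with spectrum contained in $\overline B(0,1)$ (closed unit disk of $\mathbb{C}$), and there is a constant $\rho_0<1$, depending only on the minimal travel time between obstacles and the minimal curvature of the obstacles (hence not on $\Lambda$), such that the essential spectral radius of $P_\Lambda$ on $\mathcal{B}_\Lambda$ is at most $\rho_0$. The value $1$ is a simple eigenvalue and the only one of modulus $1$. The twisted operators $h\mapsto P(e^{i\langle w,F\rangle}h)$ on $\mathcal{B}$ depend analytically on $w\in\mathbb{R}^2/(2\pi\mathbb{Z})^2$. **Ruelle resonances.** The Ruelle resonances of $P_\Lambda$ are its eigenvalues on $\mathcal{B}_\Lambda$ in the complement of $\overline B(0,\rho_0)$; they are isolated and of finite multiplicity. *)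

theory Defs
  imports "HOL-Analysis.Analysis" "HOL-Library.Function_Algebras"
begin

section \<open>Sinai billiards with finite horizon\<close>

text \<open>
  The plane \<open>\<real>\<^sup>2\<close> is identified with the type of complex numbers, and \<open>\<int>\<^sup>2\<close> with
  the type of pairs of integers.
\<close>

definition zvec :: "int \<times> int \<Rightarrow> complex" where
  "zvec p = Complex (of_int (fst p)) (of_int (snd p))"

text \<open>
  A table is given by one lift \<open>obst k\<close> to the plane of each obstacle (\<open>k < nobst\<close>), with an
  arclength parametrization \<open>bdry k\<close> of its boundary, periodic of period \<open>perim k\<close>.
\<close>

record billiard =
  nobst :: nat
  obst :: "nat \<Rightarrow> complex set"
  bdry :: "nat \<Rightarrow> real \<Rightarrow> complex"
  perim :: "nat \<Rightarrow> real"

definition Ck_curve :: "nat \<Rightarrow> (real \<Rightarrow> complex) \<Rightarrow> bool" where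
  "Ck_curve n f \<longleftrightarrow> (\<exists>D :: nat \<Rightarrow> real \<Rightarrow> complex. D 0 = f \<and>
     (\<forall>j<n. \<forall>t. (D j has_vector_derivative D (Suc j) t) (at t)) \<and>
     (\<forall>j\<le>n. continuous_on UNIV (D j)))"

definition tangent :: "billiard \<Rightarrow> nat \<Rightarrow> real \<Rightarrow> complex" where
  "tangent Bl k l = vector_derivative (bdry Bl k) (at l)"

text \<open>Signed curvature; the parametrization has unit speed.\<close>

definition curvature :: "billiard \<Rightarrow> nat \<Rightarrow> real \<Rightarrow> real" where
  "curvature Bl k l = Im (cnj (tangent Bl k l) * vector_derivative (tangent Bl k) (at l))"

definition lifted_obst :: "billiard \<Rightarrow> nat \<Rightarrow> int \<times> int \<Rightarrow> complex set" where
  "lifted_obst Bl k p = (\<lambda>z. z + zvec p) ` obst Bl k"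

text \<open>
  Positivity of the signed curvature says both that the curvature does not vanish and that the
  boundary of the convex set \<open>obst k\<close> is run through counterclockwise.
  Disjointness of all the lifts expresses that the obstacles are disjoint subsets of the torus,
  the projection being injective on each \<open>obst k\<close>.
\<close>

definition sinai_billiard :: "billiard \<Rightarrow> bool" where
  "sinai_billiard Bl \<longleftrightarrow>
     (\<forall>k<nobst Bl.
        compact (obst Bl k) \<and> convex (obst Bl k) \<and>
        perim Bl k > 0 \<and> Ck_curve 3 (bdry Bl k) \<and>
        (\<forall>l. bdry Bl k (l + perim Bl k) = bdry Bl k l) \<and>
        inj_on (bdry Bl k) {0..<perim Bl k} \<and>
        bdry Bl k ` {0..<perim Bl k} = frontier (obst Bl k) \<and>
        (\<forall>l. norm (tangent Bl k l) = 1) \<and>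
        (\<forall>l. curvature Bl k l > 0)) \<and>
     (\<forall>j k p p'. j < nobst Bl \<and> k < nobst Bl \<and> (j, p) \<noteq> (k, p') \<longrightarrow>
        lifted_obst Bl j p \<inter> lifted_obst Bl k p' = {}) \<and>
     (\<forall>z v. v \<noteq> 0 \<longrightarrow>
        (\<exists>t k p. k < nobst Bl \<and> z + of_real t * v \<in> interior (lifted_obst Bl k p)))"

definition K_min :: "billiard \<Rightarrow> real" where
  "K_min Bl = (INF (k, l) \<in> {..<nobst Bl} \<times> UNIV. curvature Bl k l)"

definition K_max :: "billiard \<Rightarrow> real" where
  "K_max Bl = (SUP (k, l) \<in> {..<nobst Bl} \<times> UNIV. curvature Bl k l)"


subsection \<open>Collision space and collision map\<close>

text \<open>
  A point of \<open>M\<close> is a pair \<open>(q, \<theta>)\<close> with \<open>q\<close> on the boundary of some \<open>obst k\<close>; its coordinates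
  are \<open>(l, \<theta>)\<close> with \<open>q = bdry k l\<close>, where \<open>l\<close> is real, taken modulo \<open>perim k\<close>.
\<close>

type_synonym phase = "complex \<times> real"

definition coll_space :: "billiard \<Rightarrow> phase set" where
  "coll_space Bl = (\<Union>k<nobst Bl. frontier (obst Bl k)) \<times> {-pi/2..pi/2}"

definition tangent_at :: "billiard \<Rightarrow> complex \<Rightarrow> complex" where
  "tangent_at Bl q = (THE v. \<exists>k<nobst Bl. \<exists>l. bdry Bl k l = q \<and> v = tangent Bl k l)"

definition normal_at :: "billiard \<Rightarrow> complex \<Rightarrow> complex" where
  "normal_at Bl q = - \<i> * tangent_at Bl q"

text \<open>
  The sign of \<open>\<theta>\<close> is such that \<open>\<theta> > 0\<close> when the velocity points in the direction of increasing
  arclength. With this convention diverging wave fronts have positive slope \<open>d\<theta>/dl\<close>, and the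
  cone of negative slopes used below is the one that is invariant under the derivative of the
  inverse of the collision map.
\<close>

definition velocity :: "billiard \<Rightarrow> phase \<Rightarrow> complex" where
  "velocity Bl x = of_real (cos (snd x)) * normal_at Bl (fst x)
                 + of_real (sin (snd x)) * tangent_at Bl (fst x)"

definition travel_time :: "billiard \<Rightarrow> phase \<Rightarrow> real" where
  "travel_time Bl x = Inf {t. t > 0 \<and>
     (\<exists>k<nobst Bl. \<exists>p. fst x + of_real t * velocity Bl x \<in> lifted_obst Bl k p)}"

definition tau_min :: "billiard \<Rightarrow> real" where
  "tau_min Bl = (INF x \<in> coll_space Bl. travel_time Bl x)"

definition hit_point :: "billiard \<Rightarrow> phase \<Rightarrow> complex" where
  "hit_point Bl x = fst x + of_real (travel_time Bl x) * velocity Bl x"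

definition cell_shift :: "billiard \<Rightarrow> phase \<Rightarrow> int \<times> int" where
  "cell_shift Bl x = (THE p. \<exists>k<nobst Bl. hit_point Bl x \<in> lifted_obst Bl k p)"

text \<open>
  Specular reflection preserves the tangential component of the velocity, which is the sine of
  the outgoing angle.
\<close>

definition coll_map :: "billiard \<Rightarrow> phase \<Rightarrow> phase" where
  "coll_map Bl x =
     (let q = hit_point Bl x - zvec (cell_shift Bl x)
      in (q, arcsin (velocity Bl x \<bullet> tangent_at Bl q)))"

definition coll_measure :: "billiard \<Rightarrow> phase measure" where
  "coll_measure Bl =
     distr
       (density (count_space {..<nobst Bl} \<Otimes>\<^sub>M (lborel :: (real \<times> real) measure))
          (\<lambda>(k, l, t). ennreal (indicator ({0..<perim Bl k} \<times> {-pi/2..pi/2}) (l, t)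
                                 * cos t / (2 * (\<Sum>j<nobst Bl. perim Bl j)))))
       borel (\<lambda>(k, l, t). (bdry Bl k l, t))"


subsection \<open>Finite covers\<close>

definition rank2_lattice :: "(int \<times> int) set \<Rightarrow> bool" where
  "rank2_lattice \<Lambda> \<longleftrightarrow>
     (\<exists>a b c d. a * d - b * c \<noteq> 0 \<and> \<Lambda> = {(m * a + n * c, m * b + n * d) | m n. True})"

type_synonym coset = "(int \<times> int) set"

definition quot :: "(int \<times> int) set \<Rightarrow> coset set" where
  "quot \<Lambda> = UNIV // {(p, p'). p' - p \<in> \<Lambda>}"

definition cover_map :: "billiard \<Rightarrow> phase \<times> coset \<Rightarrow> phase \<times> coset" where
  "cover_map Bl = (\<lambda>(x, g). (coll_map Bl x, (\<lambda>p. p + cell_shift Bl x) ` g))"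

definition cover_integral ::
    "billiard \<Rightarrow> (int \<times> int) set \<Rightarrow> (phase \<times> coset \<Rightarrow> complex) \<Rightarrow> complex" where
  "cover_integral Bl \<Lambda> f =
     (\<Sum>g\<in>quot \<Lambda>. LINT x:coll_space Bl|coll_measure Bl. f (x, g)) / of_nat (card (quot \<Lambda>))"

definition C1_coll :: "billiard \<Rightarrow> (phase \<Rightarrow> complex) set" where
  "C1_coll Bl = {h. \<forall>k<nobst Bl. \<exists>a b :: real \<times> real \<Rightarrow> complex.
     continuous_on (UNIV \<times> {-pi/2..pi/2}) a \<and> continuous_on (UNIV \<times> {-pi/2..pi/2}) b \<and>
     (\<forall>y \<in> UNIV \<times> {-pi/2..pi/2}.
        ((\<lambda>(l, t). h (bdry Bl k l, t)) has_derivative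
           (\<lambda>(u, v). of_real u * a y + of_real v * b y)) (at y within UNIV \<times> {-pi/2..pi/2}))}"

definition C1_cover ::
    "billiard \<Rightarrow> (int \<times> int) set \<Rightarrow> (phase \<times> coset \<Rightarrow> complex) set" where
  "C1_cover Bl \<Lambda> = {h. \<forall>g\<in>quot \<Lambda>. (\<lambda>x. h (x, g)) \<in> C1_coll Bl}"


section \<open>The anisotropic norm\<close>

record dz_params =
  dz_k0 :: nat
  dz_len :: real
  dz_curv :: real
  dz_alpha :: real
  dz_beta :: real
  dz_q :: real
  dz_p :: real
  dz_eps0 :: real
  dz_b :: real

definition valid_params :: "dz_params \<Rightarrow> bool" where
  "valid_params D \<longleftrightarrow> dz_k0 D \<ge> 1 \<and> dz_len D > 0 \<and> dz_curv D > 0 \<and>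
     0 < dz_q D \<and> dz_q D < dz_p D \<and> dz_p D \<le> 1/3 \<and>
     0 < dz_alpha D \<and> dz_alpha D \<le> 1/3 \<and>
     0 < dz_beta D \<and> dz_beta D \<le> min (dz_alpha D) (dz_p D - dz_q D) \<and>
     dz_eps0 D > 0 \<and> dz_b D > 0"

definition strip_indices :: "dz_params \<Rightarrow> int set" where
  "strip_indices D = {j. j = 0 \<or> \<bar>j\<bar> \<ge> int (dz_k0 D)}"

definition strip :: "dz_params \<Rightarrow> int \<Rightarrow> real set" where
  "strip D j =
     (if j = 0 then {t. \<bar>t\<bar> < pi/2 - 1 / (real (dz_k0 D))\<^sup>2}
      else {t. pi/2 - 1 / (of_int \<bar>j\<bar>)\<^sup>2 < of_int (sgn j) * t \<and>
               of_int (sgn j) * t < pi/2 - 1 / (of_int (\<bar>j\<bar> + 1))\<^sup>2})"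

text \<open>
  A curve is the graph of \<open>cv_angle\<close> over the interval \<open>[cv_lo, cv_hi]\<close> in the component
  \<open>cv_comp\<close>. The interval lives on the universal cover of the circle, so that curves may cross
  the origin of the arclength coordinate.
\<close>

record curve =
  cv_comp :: nat
  cv_lo :: real
  cv_hi :: real
  cv_angle :: "real \<Rightarrow> real"

definition cv_dom :: "curve \<Rightarrow> real set" where
  "cv_dom W = {cv_lo W..cv_hi W}"

definition cv_slope :: "curve \<Rightarrow> real \<Rightarrow> real" where
  "cv_slope W l = vector_derivative (cv_angle W) (at l within cv_dom W)"

definition cv_slope2 :: "curve \<Rightarrow> real \<Rightarrow> real" where
  "cv_slope2 W l = vector_derivative (cv_slope W) (at l within cv_dom W)"

definition cv_speed :: "curve \<Rightarrow> real \<Rightarrow> real" where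
  "cv_speed W l = sqrt (1 + (cv_slope W l)\<^sup>2)"

definition cv_arc :: "curve \<Rightarrow> real \<Rightarrow> real \<Rightarrow> real" where
  "cv_arc W s t = (LINT l:{min s t..max s t}|lborel. cv_speed W l)"

definition cv_length :: "curve \<Rightarrow> real" where
  "cv_length W = cv_arc W (cv_lo W) (cv_hi W)"

definition cv_graph :: "billiard \<Rightarrow> curve \<Rightarrow> real \<Rightarrow> phase" where
  "cv_graph Bl W l = (bdry Bl (cv_comp W) l, cv_angle W l)"

definition stable_curves :: "billiard \<Rightarrow> dz_params \<Rightarrow> curve set" where
  "stable_curves Bl D = {W.
     cv_comp W < nobst Bl \<and> cv_lo W < cv_hi W \<and>
     cv_angle W differentiable_on cv_dom W \<and>
     cv_slope W differentiable_on cv_dom W \<and>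
     continuous_on (cv_dom W) (cv_slope2 W) \<and>
     (\<exists>j\<in>strip_indices D. cv_angle W ` cv_dom W \<subseteq> strip D j) \<and>
     cv_length W \<le> dz_len D \<and>
     (\<forall>l\<in>cv_dom W. \<bar>cv_slope2 W l\<bar> / (cv_speed W l) ^ 3 \<le> dz_curv D) \<and>
     (\<forall>l\<in>cv_dom W. - K_max Bl - 1 / tau_min Bl \<le> cv_slope W l \<and> cv_slope W l \<le> - K_min Bl)}"

text \<open>A test function on a curve \<open>W\<close> is represented by its composition with \<open>cv_graph W\<close>.\<close>

definition curve_integral ::
    "billiard \<Rightarrow> curve \<Rightarrow> (phase \<Rightarrow> complex) \<Rightarrow> (real \<Rightarrow> complex) \<Rightarrow> complex" where
  "curve_integral Bl W h \<psi> =
     (LINT l:cv_dom W|lborel. h (cv_graph Bl W l) * \<psi> l * of_real (cv_speed W l))"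

definition holder_norm ::
    "real \<Rightarrow> (real \<Rightarrow> real \<Rightarrow> real) \<Rightarrow> real set \<Rightarrow> (real \<Rightarrow> complex) \<Rightarrow> ennreal" where
  "holder_norm r \<delta> S f =
     (SUP s\<in>S. ennreal (cmod (f s))) +
     (SUP (s, t)\<in>{(s, t). s \<in> S \<and> t \<in> S \<and> s \<noteq> t}. ennreal (cmod (f s - f t) / \<delta> s t powr r))"

definition curve_dist :: "dz_params \<Rightarrow> curve \<Rightarrow> curve \<Rightarrow> ennreal" where
  "curve_dist D W1 W2 =
     (if cv_comp W1 = cv_comp W2 \<and>
         (\<exists>j\<in>strip_indices D. cv_angle W1 ` cv_dom W1 \<subseteq> strip D j \<and>
                               cv_angle W2 ` cv_dom W2 \<subseteq> strip D j)
      then emeasure lborel ((cv_dom W1 - cv_dom W2) \<union> (cv_dom W2 - cv_dom W1)) +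
           (SUP l\<in>cv_dom W1 \<inter> cv_dom W2. ennreal \<bar>cv_angle W1 l - cv_angle W2 l\<bar>) +
           (SUP l\<in>cv_dom W1 \<inter> cv_dom W2. ennreal \<bar>cv_slope W1 l - cv_slope W2 l\<bar>)
      else top)"

definition norm_s :: "billiard \<Rightarrow> dz_params \<Rightarrow> (phase \<Rightarrow> complex) \<Rightarrow> ennreal" where
  "norm_s Bl D h =
     (SUP W\<in>stable_curves Bl D.
      SUP \<psi>\<in>{\<psi>. ennreal (cv_length W powr dz_alpha D)
                   * holder_norm (dz_q D) (cv_arc W) (cv_dom W) \<psi> \<le> 1}.
        ennreal (cmod (curve_integral Bl W h \<psi>)))"

definition norm_u :: "billiard \<Rightarrow> dz_params \<Rightarrow> (phase \<Rightarrow> complex) \<Rightarrow> ennreal" where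
  "norm_u Bl D h =
     (SUP \<epsilon>\<in>{0<..dz_eps0 D}.
      SUP (W1, W2)\<in>{(W1, W2). W1 \<in> stable_curves Bl D \<and> W2 \<in> stable_curves Bl D \<and>
                               curve_dist D W1 W2 \<le> ennreal \<epsilon>}.
      SUP (\<psi>1, \<psi>2)\<in>{(\<psi>1, \<psi>2).
            holder_norm (dz_p D) (cv_arc W1) (cv_dom W1) \<psi>1 \<le> 1 \<and>
            holder_norm (dz_p D) (cv_arc W2) (cv_dom W2) \<psi>2 \<le> 1 \<and>
            holder_norm (dz_q D) (\<lambda>s t. \<bar>s - t\<bar>) (cv_dom W1 \<inter> cv_dom W2)
              (\<lambda>l. \<psi>1 l - \<psi>2 l) \<le> ennreal \<epsilon>}.
        ennreal (\<epsilon> powr (- dz_beta D)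
                 * cmod (curve_integral Bl W1 h \<psi>1 - curve_integral Bl W2 h \<psi>2)))"

definition norm_B :: "billiard \<Rightarrow> dz_params \<Rightarrow> (phase \<Rightarrow> complex) \<Rightarrow> ennreal" where
  "norm_B Bl D h = norm_s Bl D h + ennreal (dz_b D) * norm_u Bl D h"


section \<open>Spectral theory of operators on complex normed spaces\<close>

text \<open>
  Operators act on a subspace \<open>X\<close> of a complex vector space with scalar multiplication \<open>sc\<close>,
  and \<open>N\<close> is the norm of \<open>X\<close>; values outside \<open>X\<close> are irrelevant.
\<close>

definition bounded_op ::
    "(complex \<Rightarrow> 'v::ab_group_add \<Rightarrow> 'v) \<Rightarrow> ('v \<Rightarrow> real) \<Rightarrow> 'v set \<Rightarrow> ('v \<Rightarrow> 'v) \<Rightarrow> bool" where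
  "bounded_op sc N X A \<longleftrightarrow>
     (\<forall>x\<in>X. A x \<in> X) \<and>
     (\<forall>x\<in>X. \<forall>y\<in>X. A (x + y) = A x + A y) \<and>
     (\<forall>c. \<forall>x\<in>X. A (sc c x) = sc c (A x)) \<and>
     (\<exists>C. \<forall>x\<in>X. N (A x) \<le> C * N x)"

definition spectrum_on ::
    "(complex \<Rightarrow> 'v::ab_group_add \<Rightarrow> 'v) \<Rightarrow> ('v \<Rightarrow> real) \<Rightarrow> 'v set \<Rightarrow> ('v \<Rightarrow> 'v) \<Rightarrow> complex set"
  where
  "spectrum_on sc N X A = {z. \<not> (\<exists>R. bounded_op sc N X R \<and>
     (\<forall>x\<in>X. R (A x - sc z x) = x \<and> A (R x) - sc z (R x) = x))}"

definition eigenvalues_on ::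
    "(complex \<Rightarrow> 'v::ab_group_add \<Rightarrow> 'v) \<Rightarrow> 'v set \<Rightarrow> ('v \<Rightarrow> 'v) \<Rightarrow> complex set" where
  "eigenvalues_on sc X A = {z. \<exists>x\<in>X. x \<noteq> 0 \<and> A x = sc z x}"

definition gen_eigenspace ::
    "(complex \<Rightarrow> 'v::ab_group_add \<Rightarrow> 'v) \<Rightarrow> 'v set \<Rightarrow> ('v \<Rightarrow> 'v) \<Rightarrow> complex \<Rightarrow> 'v set" where
  "gen_eigenspace sc X A z = {x\<in>X. \<exists>n. ((\<lambda>y. A y - sc z y) ^^ n) x = 0}"

text \<open>
  Algebraic multiplicity. The function \<open>dim\<close> vanishes on infinite-dimensional subspaces.
\<close>

definition alg_mult ::
    "(complex \<Rightarrow> 'v::ab_group_add \<Rightarrow> 'v) \<Rightarrow> 'v set \<Rightarrow> ('v \<Rightarrow> 'v) \<Rightarrow> complex \<Rightarrow> nat" where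
  "alg_mult sc X A z = vector_space.dim sc (gen_eigenspace sc X A z)"

text \<open>
  Isolated points of the spectrum whose Riesz projector has finite rank, expressed by the
  invariant splitting \<open>X = E \<oplus> R\<close> into the range and the kernel of this projector.
\<close>

definition discrete_spectrum_on ::
    "(complex \<Rightarrow> 'v::ab_group_add \<Rightarrow> 'v) \<Rightarrow> ('v \<Rightarrow> real) \<Rightarrow> 'v set \<Rightarrow> ('v \<Rightarrow> 'v) \<Rightarrow> complex set"
  where
  "discrete_spectrum_on sc N X A = {z \<in> spectrum_on sc N X A. \<exists>E R.
     module.subspace sc E \<and> module.subspace sc R \<and>
     E \<inter> R = {0} \<and> X = {e + r | e r. e \<in> E \<and> r \<in> R} \<and>
     (\<exists>S. finite S \<and> E = module.span sc S) \<and>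
     (\<forall>x\<in>E. A x \<in> E) \<and> (\<forall>x\<in>R. A x \<in> R) \<and>
     (\<exists>n. \<forall>x\<in>E. ((\<lambda>y. A y - sc z y) ^^ n) x = 0) \<and>
     z \<notin> spectrum_on sc N R A}"

definition ess_spectral_radius ::
    "(complex \<Rightarrow> 'v::ab_group_add \<Rightarrow> 'v) \<Rightarrow> ('v \<Rightarrow> real) \<Rightarrow> 'v set \<Rightarrow> ('v \<Rightarrow> 'v) \<Rightarrow> real" where
  "ess_spectral_radius sc N X A =
     Sup (insert 0 (cmod ` (spectrum_on sc N X A - discrete_spectrum_on sc N X A)))"

definition ruelle_resonances ::
    "real \<Rightarrow> (complex \<Rightarrow> 'v::ab_group_add \<Rightarrow> 'v) \<Rightarrow> 'v set \<Rightarrow> ('v \<Rightarrow> 'v) \<Rightarrow> complex set" where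
  "ruelle_resonances \<rho> sc X A = eigenvalues_on sc X A - cball 0 \<rho>"


section \<open>The anisotropic spaces and the transfer operators\<close>

definition complex_banach :: "(complex \<Rightarrow> 'b::banach \<Rightarrow> 'b) \<Rightarrow> bool" where
  "complex_banach sc \<longleftrightarrow> vector_space sc \<and>
     (\<forall>r x. sc (of_real r) x = r *\<^sub>R x) \<and> (\<forall>c x. norm (sc c x) = cmod c * norm x)"

text \<open>The Banach space \<open>'b\<close> is the completion, along \<open>emb\<close>, of the \<open>C\<^sup>1\<close> functions on \<open>M\<close>.\<close>

definition is_space_B ::
    "billiard \<Rightarrow> dz_params \<Rightarrow> (complex \<Rightarrow> 'b::banach \<Rightarrow> 'b) \<Rightarrow>
     ((phase \<Rightarrow> complex) \<Rightarrow> 'b) \<Rightarrow> bool" where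
  "is_space_B Bl D sc emb \<longleftrightarrow>
     complex_banach sc \<and>
     (\<forall>h\<in>C1_coll Bl. \<forall>h'\<in>C1_coll Bl. emb (\<lambda>x. h x + h' x) = emb h + emb h') \<and>
     (\<forall>c. \<forall>h\<in>C1_coll Bl. emb (\<lambda>x. c * h x) = sc c (emb h)) \<and>
     (\<forall>h\<in>C1_coll Bl. ennreal (norm (emb h)) = norm_B Bl D h) \<and>
     closure (emb ` C1_coll Bl) = UNIV"

text \<open>
  Functions such as \<open>h \<circ> T\<^sup>-\<^sup>1\<close> are in general not \<open>C\<^sup>1\<close>, but the formulas for the norm still make
  sense when the function is integrable along stable curves. Such a function defines the element
  \<open>u\<close> of the completion if \<open>u\<close> is the limit of \<open>C\<^sup>1\<close> functions converging to it for this norm.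
\<close>

definition defines_elt ::
    "billiard \<Rightarrow> dz_params \<Rightarrow> ((phase \<Rightarrow> complex) \<Rightarrow> 'b::banach) \<Rightarrow>
     (phase \<Rightarrow> complex) \<Rightarrow> 'b \<Rightarrow> bool" where
  "defines_elt Bl D emb f u \<longleftrightarrow>
     (\<forall>W\<in>stable_curves Bl D. set_integrable lborel (cv_dom W) (\<lambda>l. f (cv_graph Bl W l))) \<and>
     (\<exists>h. (\<forall>n. h n \<in> C1_coll Bl) \<and>
          (\<lambda>n. norm_B Bl D (\<lambda>x. h n x - f x)) \<longlonglongrightarrow> 0 \<and>
          (\<lambda>n. emb (h n)) \<longlonglongrightarrow> u)"

text \<open>\<open>\<B>\<^sub>\<Lambda>\<close> as the direct sum of copies of \<open>\<B>\<close> indexed by \<open>\<int>\<^sup>2/\<Lambda>\<close>.\<close>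

definition space_BL :: "(int \<times> int) set \<Rightarrow> (coset \<Rightarrow> 'b::banach) set" where
  "space_BL \<Lambda> = {u. \<forall>g. g \<notin> quot \<Lambda> \<longrightarrow> u g = 0}"

definition norm_BL :: "(int \<times> int) set \<Rightarrow> (coset \<Rightarrow> 'b::banach) \<Rightarrow> real" where
  "norm_BL \<Lambda> u = Max ((\<lambda>g. norm (u g)) ` quot \<Lambda>)"

definition scale_BL :: "(complex \<Rightarrow> 'b::banach \<Rightarrow> 'b) \<Rightarrow> complex \<Rightarrow> (coset \<Rightarrow> 'b) \<Rightarrow> (coset \<Rightarrow> 'b)"
  where "scale_BL sc c u = (\<lambda>g. sc c (u g))"

definition emb_BL ::
    "((phase \<Rightarrow> complex) \<Rightarrow> 'b::banach) \<Rightarrow> (int \<times> int) set \<Rightarrow>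
     (phase \<times> coset \<Rightarrow> complex) \<Rightarrow> (coset \<Rightarrow> 'b)" where
  "emb_BL emb \<Lambda> h = (\<lambda>g. if g \<in> quot \<Lambda> then emb (\<lambda>x. h (x, g)) else 0)"

text \<open>
  The value at \<open>\<phi>\<close> of the distribution given by an element of \<open>\<B>\<^sub>\<Lambda>\<close>: a function \<open>h\<close> takes the
  value \<open>\<integral> h \<phi> d\<mu>\<^sub>\<Lambda>\<close>, and this is extended by continuity.
\<close>

definition distr_value ::
    "billiard \<Rightarrow> ((phase \<Rightarrow> complex) \<Rightarrow> 'b::banach) \<Rightarrow> (int \<times> int) set \<Rightarrow>
     (coset \<Rightarrow> 'b) \<Rightarrow> (phase \<times> coset \<Rightarrow> complex) \<Rightarrow> complex \<Rightarrow> bool" where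
  "distr_value Bl emb \<Lambda> u \<phi> c \<longleftrightarrow>
     (\<forall>h. (\<forall>n. h n \<in> C1_cover Bl \<Lambda>) \<and>
          (\<lambda>n. norm_BL \<Lambda> (emb_BL emb \<Lambda> (h n) - u)) \<longlonglongrightarrow> 0 \<longrightarrow>
          (\<lambda>n. cover_integral Bl \<Lambda> (\<lambda>y. h n y * \<phi> y)) \<longlonglongrightarrow> c)"

definition is_transfer_op ::
    "billiard \<Rightarrow> dz_params \<Rightarrow> (complex \<Rightarrow> 'b::banach \<Rightarrow> 'b) \<Rightarrow>
     ((phase \<Rightarrow> complex) \<Rightarrow> 'b) \<Rightarrow> (int \<times> int) set \<Rightarrow>
     ((coset \<Rightarrow> 'b) \<Rightarrow> (coset \<Rightarrow> 'b)) \<Rightarrow> bool" where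
  "is_transfer_op Bl D sc emb \<Lambda> P \<longleftrightarrow>
     bounded_op (scale_BL sc) (norm_BL \<Lambda>) (space_BL \<Lambda>) P \<and>
     (\<forall>h\<in>C1_cover Bl \<Lambda>. \<forall>g\<in>quot \<Lambda>.
        defines_elt Bl D emb
          (\<lambda>x. h (inv_into (coll_space Bl \<times> quot \<Lambda>) (cover_map Bl) (x, g)))
          (P (emb_BL emb \<Lambda> h) g)) \<and>
     (\<forall>u\<in>space_BL \<Lambda>. \<forall>\<phi>\<in>C1_cover Bl \<Lambda>. \<exists>c.
        distr_value Bl emb \<Lambda> u (\<phi> \<circ> cover_map Bl) c \<and> distr_value Bl emb \<Lambda> (P u) \<phi> c)"

definition is_twisted_op ::
    "billiard \<Rightarrow> dz_params \<Rightarrow> (complex \<Rightarrow> 'b::banach \<Rightarrow> 'b) \<Rightarrow>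
     ((phase \<Rightarrow> complex) \<Rightarrow> 'b) \<Rightarrow> real \<times> real \<Rightarrow> ('b \<Rightarrow>\<^sub>L 'b) \<Rightarrow> bool" where
  "is_twisted_op Bl D sc emb w Q \<longleftrightarrow>
     (\<forall>c u. blinfun_apply Q (sc c u) = sc c (blinfun_apply Q u)) \<and>
     (\<forall>h\<in>C1_coll Bl.
        defines_elt Bl D emb
          ((\<lambda>x. cis (fst w * of_int (fst (cell_shift Bl x)) + snd w * of_int (snd (cell_shift Bl x)))
                 * h x) \<circ> inv_into (coll_space Bl) (coll_map Bl))
          (blinfun_apply Q (emb h)))"

definition real_analytic2 :: "(real \<times> real \<Rightarrow> 'a::banach) \<Rightarrow> bool" where
  "real_analytic2 f \<longleftrightarrow> (\<forall>w. \<exists>r>0. \<exists>A :: nat \<times> nat \<Rightarrow> 'a. \<forall>s t. \<bar>s\<bar> < r \<and> \<bar>t\<bar> < r \<longrightarrow>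
     ((\<lambda>(i, j). (s ^ i * t ^ j) *\<^sub>R A (i, j)) has_sum f (w + (s, t))) UNIV)"

text \<open>
  The facts due to Demers and Zhang. As \<open>\<rho>\<close> does not depend on the lattice,
  the bound on the essential spectral radius is uniform over all covers.
\<close>

definition demers_zhang ::
    "billiard \<Rightarrow> dz_params \<Rightarrow> (complex \<Rightarrow> 'b::banach \<Rightarrow> 'b) \<Rightarrow>
     ((phase \<Rightarrow> complex) \<Rightarrow> 'b) \<Rightarrow>
     ((int \<times> int) set \<Rightarrow> (coset \<Rightarrow> 'b) \<Rightarrow> (coset \<Rightarrow> 'b)) \<Rightarrow>
     (real \<times> real \<Rightarrow> 'b \<Rightarrow>\<^sub>L 'b) \<Rightarrow> real \<Rightarrow> bool" where
  "demers_zhang Bl D sc emb P Q \<rho> \<longleftrightarrow>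
     \<rho> < 1 \<and>
     (\<forall>\<Lambda>. rank2_lattice \<Lambda> \<longrightarrow>
        is_transfer_op Bl D sc emb \<Lambda> (P \<Lambda>) \<and>
        spectrum_on (scale_BL sc) (norm_BL \<Lambda>) (space_BL \<Lambda>) (P \<Lambda>) \<subseteq> cball 0 1 \<and>
        ess_spectral_radius (scale_BL sc) (norm_BL \<Lambda>) (space_BL \<Lambda>) (P \<Lambda>) \<le> \<rho> \<and>
        eigenvalues_on (scale_BL sc) (space_BL \<Lambda>) (P \<Lambda>) \<inter> sphere 0 1 = {1} \<and>
        alg_mult (scale_BL sc) (space_BL \<Lambda>) (P \<Lambda>) 1 = 1) \<and>
     (\<forall>w. is_twisted_op Bl D sc emb w (Q w)) \<and>
     real_analytic2 Q"

end

theory Submission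
  imports Defs
begin

text \<open>
  Write \<open>\<B>\<^sub>\<Lambda>\<close> as the space of \<open>\<B>\<close>-valued functions on the finite group \<open>G = \<int>\<^sup>2/\<Lambda>\<close>. For a vector \<open>v\<close> of
  the dual lattice, \<open>p \<mapsto> exp (- i \<langle>v, p\<rangle>)\<close> is a character of \<open>G\<close>, and since the cover map moves the
  coset by the cell shift \<open>F\<close>, the transfer operator \<open>P\<^sub>\<Lambda>\<close> sends the tensor of this character with
  \<open>u\<close> to its tensor with \<open>Q\<^sub>v u\<close>, where \<open>Q\<^sub>v\<close> is the twisted operator (\<open>transfer_op_char_tensor\<close>). So
  an eigenvector of a twisted operator gives one of \<open>P\<^sub>\<Lambda>\<close>, and eigenvectors attached to distinct
  characters are independent (\<open>characters_independent\<close>).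

  The untwisted operator \<open>Q\<^sub>0\<close> is the transfer operator of the trivial cover; its eigenvalue \<open>1\<close> is
  simple and isolated, because \<open>1\<close> exceeds the essential spectral radius. As \<open>Q\<close> is continuous, every
  \<open>Q\<^sub>v\<close> with \<open>v\<close> in some fixed neighbourhood of \<open>0\<close> has an eigenvalue close to \<open>1\<close>, in particular in
  \<open>U\<close> and of modulus larger than \<open>\<rho>\<close> (\<open>twisted_eigenvalues_near_1\<close>). Only the existence of this
  eigenvalue matters, so instead of Riesz projectors a contraction argument is used
  (\<open>eigenvalue_perturbation\<close>).

  The dual group of \<open>G\<close> has at least \<open>|G|\<close> elements, so by the pigeonhole principle a proportion of
  it, bounded below independently of \<open>\<Lambda>\<close>, lies in this neighbourhood (\<open>many_small_characters\<close>). The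
  resonances found have finite multiplicity, again by the bound on the essential spectral radius, and
  their multiplicities add up to at least the number of these characters. When this number exceeds
  \<open>1\<close>, the simple resonance \<open>1\<close> cannot account for all of them.

  Two points need care in the identification of \<open>P\<^sub>\<Lambda>\<close> with the twisted operators. Both are
  characterized on \<open>C\<^sup>1\<close> functions through the inverses of the collision maps, chosen independently
  for \<open>M\<close> and \<open>M\<^sub>\<Lambda>\<close>; they correspond to each other only because the collision map is a bijection of
  the whole collision space, grazing collisions included. This follows from the reversibility of the
  flow (\<open>coll_map_reversible\<close>), which rests on strict convexity of the obstacles and on the finite
  horizon. Moreover an element of \<open>\<B>\<close> has to be determined by the function that defines it, which is
  the triangle inequality for the anisotropic norm of functions integrable along stable curves
  (\<open>defines_elt_unimodular\<close>).
\<close>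

section \<open>Convexity of the obstacles\<close>

lemma orthonormal_expansion:
  fixes a T :: complex
  assumes "norm T = 1"
  shows "a = (a \<bullet> T) *\<^sub>R T + (a \<bullet> (- \<i> * T)) *\<^sub>R (- \<i> * T)"
proof -
  have T: "(Re T)\<^sup>2 + (Im T)\<^sup>2 = 1"
    using assms by (simp add: cmod_def)
  show ?thesis
  proof (rule complex_eqI)
    show "Re a = Re ((a \<bullet> T) *\<^sub>R T + (a \<bullet> (- \<i> * T)) *\<^sub>R (- \<i> * T))"
      by (simp add: inner_complex_def) (use T in algebra)
    show "Im a = Im ((a \<bullet> T) *\<^sub>R T + (a \<bullet> (- \<i> * T)) *\<^sub>R (- \<i> * T))"
      by (simp add: inner_complex_def) (use T in algebra)
  qed
qed

text \<open>
  The outer unit normal, as the boundary is run through counterclockwise.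
\<close>

definition onormal :: "billiard \<Rightarrow> nat \<Rightarrow> real \<Rightarrow> complex" where
  "onormal Bl k l = - \<i> * tangent Bl k l"

context
  fixes Bl :: billiard
  assumes sinai: "sinai_billiard Bl"
begin

lemma
  assumes "k < nobst Bl"
  shows obst_compact: "compact (obst Bl k)" and obst_convex: "convex (obst Bl k)"
    and perim_pos: "perim Bl k > 0" and bdry_C3: "Ck_curve 3 (bdry Bl k)"
    and bdry_periodic: "bdry Bl k (l + perim Bl k) = bdry Bl k l"
    and bdry_inj: "inj_on (bdry Bl k) {0..<perim Bl k}"
    and bdry_image: "bdry Bl k ` {0..<perim Bl k} = frontier (obst Bl k)"
    and tangent_unit: "norm (tangent Bl k l) = 1"
    and curvature_pos: "curvature Bl k l > 0"
  using sinai assms unfolding sinai_billiard_def by auto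

lemma obst_disjoint:
  assumes "j < nobst Bl" "k < nobst Bl" "z \<in> lifted_obst Bl j p" "z \<in> lifted_obst Bl k p'"
  shows "j = k \<and> p = p'"
  using sinai assms unfolding sinai_billiard_def by blast

lemma finite_horizon:
  assumes "v \<noteq> 0"
  shows "\<exists>t k p. k < nobst Bl \<and> z + of_real t * v \<in> interior (lifted_obst Bl k p)"
  using sinai assms unfolding sinai_billiard_def by blast

lemma bdry_periodic_int:
  assumes "k < nobst Bl"
  shows "bdry Bl k (l + of_int n * perim Bl k) = bdry Bl k l"
proof (induction n rule: int_induct[where k = 0])
  case base
  then show ?case by simp
next
  case (step1 i)
  then show ?case
    using bdry_periodic[OF assms, of "l + of_int i * perim Bl k"] by (simp add: algebra_simps)
next
  case (step2 i)
  then show ?case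
    using bdry_periodic[OF assms, of "l + of_int (i - 1) * perim Bl k"] by (simp add: algebra_simps)
qed

lemma bdry_reduce:
  assumes "k < nobst Bl"
  obtains n :: int where "l + of_int n * perim Bl k \<in> {c..<c + perim Bl k}"
    "bdry Bl k (l + of_int n * perim Bl k) = bdry Bl k l"
proof -
  define P where "P = perim Bl k"
  have P: "P > 0" using perim_pos[OF assms] by (simp add: P_def)
  define n where "n = - \<lfloor>(l - c) / P\<rfloor>"
  have "of_int \<lfloor>(l - c) / P\<rfloor> * P \<le> l - c" "l - c < (of_int \<lfloor>(l - c) / P\<rfloor> + 1) * P"
    using floor_divide_lower[OF P] floor_divide_upper[OF P] by auto
  then have "l + of_int n * P \<in> {c..<c + P}"
    by (auto simp: n_def algebra_simps)
  then show ?thesis using that bdry_periodic_int[OF assms] by (simp add: P_def)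
qed

lemma bdry_in_frontier:
  assumes "k < nobst Bl"
  shows "bdry Bl k l \<in> frontier (obst Bl k)"
proof -
  obtain n :: int where "l + of_int n * perim Bl k \<in> {0..<0 + perim Bl k}"
    "bdry Bl k (l + of_int n * perim Bl k) = bdry Bl k l"
    using bdry_reduce[OF assms] by metis
  then show ?thesis using bdry_image[OF assms] by (metis add_0 image_eqI)
qed

lemma bdry_in_obst:
  assumes "k < nobst Bl"
  shows "bdry Bl k l \<in> obst Bl k"
  using bdry_in_frontier[OF assms] obst_compact[OF assms] compact_imp_closed frontier_subset_eq by blast

lemma frontier_obst_bdry:
  assumes "k < nobst Bl" "q \<in> frontier (obst Bl k)"
  obtains l where "q = bdry Bl k l"
  using assms bdry_image[of k] by (metis imageE)

lemma bdry_inj_window: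
  assumes "k < nobst Bl"
  shows "inj_on (bdry Bl k) {c..<c + perim Bl k}"
proof (rule inj_onI)
  fix x y assume xy: "x \<in> {c..<c + perim Bl k}" "y \<in> {c..<c + perim Bl k}" "bdry Bl k x = bdry Bl k y"
  define P where "P = perim Bl k"
  have P: "P > 0" using perim_pos[OF assms] by (simp add: P_def)
  obtain m :: int where m: "x + of_int m * P \<in> {0..<0 + P}"
      "bdry Bl k (x + of_int m * P) = bdry Bl k x"
    unfolding P_def using bdry_reduce[OF assms] by metis
  obtain n :: int where n: "y + of_int n * P \<in> {0..<0 + P}"
      "bdry Bl k (y + of_int n * P) = bdry Bl k y"
    unfolding P_def using bdry_reduce[OF assms] by metis
  have eq: "x + of_int m * P = y + of_int n * P"
    using inj_onD[OF bdry_inj[OF assms]] m n xy(3) by (simp add: P_def)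
  then have "x - y = of_int (n - m) * P" by (simp add: algebra_simps)
  moreover have "\<bar>x - y\<bar> < P" using xy(1,2) by (auto simp: P_def)
  ultimately have "\<bar>of_int (n - m) :: real\<bar> * P < 1 * P"
    using P by (simp add: abs_mult)
  then have "\<bar>of_int (n - m) :: real\<bar> < 1" using P mult_less_cancel_right_pos by blast
  then have "n = m" by linarith
  then show "x = y" using eq by simp
qed

lemma onormal_unit: "k < nobst Bl \<Longrightarrow> norm (onormal Bl k l) = 1"
  by (simp add: onormal_def norm_mult tangent_unit)

lemma onormal_tangent: "onormal Bl k l \<bullet> tangent Bl k l = 0"
  by (simp add: onormal_def inner_complex_def)

lemma bdry_derivatives:
  assumes "k < nobst Bl"
  obtains D2 where "\<And>l. (bdry Bl k has_vector_derivative tangent Bl k l) (at l)"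
    "\<And>l. (tangent Bl k has_vector_derivative D2 l) (at l)"
    "\<And>l. D2 l \<bullet> onormal Bl k l < 0"
proof -
  obtain D where D0: "D 0 = bdry Bl k"
    and D: "\<And>j t. j < 3 \<Longrightarrow> (D j has_vector_derivative D (Suc j) t) (at t)"
    using bdry_C3[OF assms] unfolding Ck_curve_def by auto
  have T: "D 1 = tangent Bl k"
  proof (rule ext)
    show "D 1 t = tangent Bl k t" for t
      using vector_derivative_at[OF D[of 0 t]] by (simp add: tangent_def D0)
  qed
  have 1: "(bdry Bl k has_vector_derivative tangent Bl k l) (at l)" for l
    using D[of 0 l] D0 T by simp
  have 2: "(tangent Bl k has_vector_derivative D 2 l) (at l)" for l
    using D[of 1 l] T by (simp add: numeral_2_eq_2)
  have "D 2 l \<bullet> onormal Bl k l = - curvature Bl k l" for l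
    unfolding curvature_def onormal_def vector_derivative_at[OF 2]
    by (simp add: inner_complex_def algebra_simps)
  then show ?thesis using that[OF 1 2] curvature_pos[OF assms] by simp
qed

text \<open>
  Along the boundary, the linear form \<open>a\<close> is maximal at \<open>l\<close>, so \<open>a\<close> is orthogonal to the tangent
  there; positivity of the curvature excludes the inner normal by the second derivative test.
\<close>

lemma supporting_vector:
  assumes k: "k < nobst Bl" and a: "a \<noteq> 0"
    and le: "\<And>z. z \<in> obst Bl k \<Longrightarrow> a \<bullet> z \<le> a \<bullet> bdry Bl k l"
  obtains c where "c > 0" "a = c *\<^sub>R onormal Bl k l"
proof -
  obtain D2 where d1: "\<And>l. (bdry Bl k has_vector_derivative tangent Bl k l) (at l)"
    and d2: "\<And>l. (tangent Bl k has_vector_derivative D2 l) (at l)"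
    and neg: "\<And>l. D2 l \<bullet> onormal Bl k l < 0"
    using bdry_derivatives[OF k] by blast
  define \<phi> where "\<phi> t = a \<bullet> bdry Bl k t" for t
  define \<phi>' where "\<phi>' t = a \<bullet> tangent Bl k t" for t
  have der1: "(\<phi> has_real_derivative \<phi>' t) (at t)" for t
    unfolding \<phi>_def \<phi>'_def has_real_derivative_iff_has_vector_derivative
    by (rule bounded_linear.has_vector_derivative[OF bounded_linear_inner_right d1])
  have der2: "(\<phi>' has_real_derivative a \<bullet> D2 t) (at t)" for t
    unfolding \<phi>'_def has_real_derivative_iff_has_vector_derivative
    by (rule bounded_linear.has_vector_derivative[OF bounded_linear_inner_right d2])
  have max: "\<phi> t \<le> \<phi> l" for t
    unfolding \<phi>_def by (rule le[OF bdry_in_obst[OF k]])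
  have zero: "\<phi>' l = 0"
    using DERIV_local_max[OF der1, of 1 l] max by simp
  define c where "c = a \<bullet> onormal Bl k l"
  have ac: "a = c *\<^sub>R onormal Bl k l"
    using orthonormal_expansion[OF tangent_unit[OF k], of a l] zero
    by (simp add: c_def onormal_def \<phi>'_def)
  have "c > 0"
  proof (rule ccontr)
    assume "\<not> c > 0"
    moreover have "c \<noteq> 0" using a ac by auto
    ultimately have "c < 0" by simp
    have "a \<bullet> D2 l = c * (D2 l \<bullet> onormal Bl k l)" by (subst ac) (simp add: inner_commute)
    then have "a \<bullet> D2 l > 0"
      using neg[of l] \<open>c < 0\<close> by (simp add: mult_neg_neg)
    then obtain d where d: "d > 0" "\<And>h. 0 < h \<Longrightarrow> h < d \<Longrightarrow> \<phi>' l < \<phi>' (l + h)"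
      using DERIV_pos_inc_right[OF der2[of l]] by auto
    have "\<phi> l < \<phi> (l + d / 2)"
    proof (rule DERIV_pos_imp_increasing_open[where f = \<phi>])
      show "l < l + d / 2" using d by simp
      show "\<exists>y. DERIV \<phi> x :> y \<and> 0 < y" if "l < x" "x < l + d / 2" for x
        using der1[of x] d(2)[of "x - l"] zero that by (intro exI[of _ "\<phi>' x"]) auto
      show "continuous_on {l..l + d / 2} \<phi>"
        using der1 DERIV_isCont by (intro continuous_at_imp_continuous_on) blast
    qed
    then show False using max[of "l + d / 2"] by simp
  qed
  then show ?thesis using ac that by blast
qed

text \<open>
  A supporting line at a boundary point exists by convexity, and its direction is forced by
  \<open>supporting_vector\<close>.
\<close>

lemma obst_in_halfplane:
  assumes k: "k < nobst Bl" and z: "z \<in> obst Bl k"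
  shows "(z - bdry Bl k l) \<bullet> onormal Bl k l \<le> 0"
proof -
  let ?q = "bdry Bl k l"
  have fr: "?q \<in> obst Bl k" "?q \<notin> interior (obst Bl k)"
    using bdry_in_obst[OF k] bdry_in_frontier[OF k] by (auto simp: frontier_def)
  obtain a where a: "a \<noteq> 0" "\<And>y. y \<in> obst Bl k \<Longrightarrow> a \<bullet> y \<le> a \<bullet> ?q"
  \<comment> \<open>A convex set without interior lies in a line, which then serves as supporting line.\<close>
  proof (cases "interior (obst Bl k) = {}")
    case True
    then obtain a b where "a \<noteq> 0" "obst Bl k \<subseteq> {x. a \<bullet> x = b}"
      using empty_interior_subset_hyperplane[OF obst_convex[OF k]] by blast
    then have "a \<bullet> y = b" if "y \<in> obst Bl k" for y using that by blast
    then show ?thesis using that[of a] \<open>a \<noteq> 0\<close> fr(1) by simp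
  next
    case False
    have ri: "rel_interior (obst Bl k) = interior (obst Bl k)"
      by (rule rel_interior_nonempty_interior[OF False])
    obtain a where a: "a \<noteq> 0" "\<And>y. y \<in> closure (obst Bl k) \<Longrightarrow> a \<bullet> ?q \<le> a \<bullet> y"
      using supporting_hyperplane_relative_frontier[OF obst_convex[OF k], of ?q] fr ri
      by (metis closure_subset subsetD)
    show ?thesis using that[of "- a"] a closure_subset by (auto simp: subset_iff)
  qed
  obtain c where c: "c > 0" "a = c *\<^sub>R onormal Bl k l"
    using supporting_vector[OF k a] by blast
  have "a \<bullet> (z - ?q) \<le> 0" using a(2)[OF z] by (simp add: inner_diff_right)
  then show ?thesis using c by (simp add: inner_commute mult_le_0_iff)
qed

lemma onormal_unique:
  assumes "k < nobst Bl" "bdry Bl k l = bdry Bl k l'"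
  shows "onormal Bl k l = onormal Bl k l'"
proof -
  have "onormal Bl k l \<noteq> 0" using onormal_unit[OF assms(1), of l] by auto
  moreover have "onormal Bl k l \<bullet> z \<le> onormal Bl k l \<bullet> bdry Bl k l'" if "z \<in> obst Bl k" for z
    using obst_in_halfplane[OF assms(1) that, of l] assms(2)
    by (simp add: inner_commute inner_diff_right)
  ultimately obtain c where c: "c > 0" "onormal Bl k l = c *\<^sub>R onormal Bl k l'"
    using supporting_vector[OF assms(1)] by blast
  then show ?thesis
    using onormal_unit[OF assms(1)] by (metis abs_of_pos mult.right_neutral norm_scaleR scaleR_one)
qed

text \<open>
  The definite description is meaningful: disjointness determines the obstacle, and the uniqueness of
  the supporting direction makes the tangent independent of the parameter.
\<close>

lemma tangent_at_bdry:
  assumes "k < nobst Bl"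
  shows "tangent_at Bl (bdry Bl k l) = tangent Bl k l"
  unfolding tangent_at_def
proof (rule the_equality)
  show "\<exists>k'<nobst Bl. \<exists>l'. bdry Bl k' l' = bdry Bl k l \<and> tangent Bl k l = tangent Bl k' l'"
    using assms by blast
next
  fix v assume "\<exists>k'<nobst Bl. \<exists>l'. bdry Bl k' l' = bdry Bl k l \<and> v = tangent Bl k' l'"
  then obtain k' l' where *: "k' < nobst Bl" "bdry Bl k' l' = bdry Bl k l" "v = tangent Bl k' l'"
    by blast
  have "bdry Bl k l \<in> lifted_obst Bl k (0, 0)" "bdry Bl k l \<in> lifted_obst Bl k' (0, 0)"
    using bdry_in_obst[OF assms, of l] bdry_in_obst[OF *(1), of l'] *(2)
    by (auto simp: lifted_obst_def zvec_def complex_eq_iff image_iff)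
  then have "k' = k" using obst_disjoint * assms by blast
  then show "v = tangent Bl k l"
    using onormal_unique[of k l' l] * assms by (simp add: onormal_def)
qed

lemma normal_at_bdry:
  assumes "k < nobst Bl"
  shows "normal_at Bl (bdry Bl k l) = onormal Bl k l"
  by (simp add: normal_at_def onormal_def tangent_at_bdry[OF assms])

text \<open>
  If the ray missed the obstacle, a line separating the two would support the obstacle at the base
  point; it would thus be the tangent line, with the ray on its outer side.
\<close>

lemma entering_ray:
  assumes k: "k < nobst Bl" and d: "d \<bullet> onormal Bl k l < 0"
  obtains s where "s > 0" "bdry Bl k l + s *\<^sub>R d \<in> obst Bl k"
proof -
  let ?q = "bdry Bl k l"
  have False if no: "\<And>s. s > 0 \<Longrightarrow> ?q + s *\<^sub>R d \<notin> obst Bl k"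
  proof -
    define S where "S = (\<lambda>s. ?q + s *\<^sub>R d) ` {0<..}"
    have "convex S"
    proof -
      have "S = (\<lambda>x. ?q + x) ` ((\<lambda>s. s *\<^sub>R d) ` {0<..})" by (auto simp: S_def)
      moreover have "convex ((\<lambda>s. s *\<^sub>R d) ` {0<..})"
        by (intro convex_linear_image) (auto intro!: linearI simp: scaleR_left_distrib)
      ultimately show ?thesis by (metis convex_translation)
    qed
    moreover have "S \<noteq> {}" "obst Bl k \<noteq> {}" "S \<inter> obst Bl k = {}"
      using bdry_in_obst[OF k] no by (auto simp: S_def)
    ultimately obtain a b where a: "a \<noteq> 0" and S: "\<forall>x\<in>S. a \<bullet> x \<le> b" and K: "\<forall>x\<in>obst Bl k. a \<bullet> x \<ge> b"
      using separating_hyperplane_sets[OF _ obst_convex[OF k]] by metis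
    have lim: "a \<bullet> ?q + s * (a \<bullet> d) \<le> b" if "s > 0" for s
      using S that by (auto simp: S_def inner_add_right)
    have "((\<lambda>s. a \<bullet> ?q + s * (a \<bullet> d)) \<longlongrightarrow> a \<bullet> ?q + 0 * (a \<bullet> d)) (at_right 0)"
      by (intro tendsto_intros)
    then have "a \<bullet> ?q + 0 * (a \<bullet> d) \<le> b"
      by (rule tendsto_upperbound) (auto simp: eventually_at_right_less lim intro: eventually_mono[OF eventually_at_right_less])
    then have qb: "a \<bullet> ?q = b" using K bdry_in_obst[OF k, of l] by force
    obtain c where c: "c > 0" "- a = c *\<^sub>R onormal Bl k l"
      using supporting_vector[OF k, of "- a" l] a K qb by auto
    have "a \<bullet> d \<le> 0" using lim[of 1] qb by simp
    then have "(- a) \<bullet> d \<ge> 0" by simp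
    then have "onormal Bl k l \<bullet> d \<ge> 0" unfolding c(2) using c(1) by (simp add: zero_le_mult_iff)
    then show False using d by (simp add: inner_commute)
  qed
  then show ?thesis using that by blast
qed

text \<open>
  Strict convexity. The boundary leaves the supporting line at \<open>l\<close> at once, since the curvature
  is nonzero; so a segment of the obstacle on this line, which would consist of boundary points
  accumulating at \<open>bdry Bl k l\<close>, cannot exist.
\<close>

lemma supporting_line_meets_once:
  assumes k: "k < nobst Bl" and z: "z \<in> obst Bl k" and flat: "(z - bdry Bl k l) \<bullet> onormal Bl k l = 0"
  shows "z = bdry Bl k l"
proof (rule ccontr)
  define q where "q = bdry Bl k l"
  define n where "n = onormal Bl k l"
  define P where "P = perim Bl k"
  have P: "P > 0" using perim_pos[OF k] by (simp add: P_def)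
  assume "z \<noteq> bdry Bl k l"
  then have zq: "norm (z - q) > 0" by (simp add: q_def)
  have n1: "n \<bullet> n = 1" using onormal_unit[OF k, of l] by (simp add: n_def dot_square_norm)
  obtain D2 where d1: "\<And>l. (bdry Bl k has_vector_derivative tangent Bl k l) (at l)"
    and d2: "\<And>l. (tangent Bl k has_vector_derivative D2 l) (at l)"
    and neg: "\<And>l. D2 l \<bullet> onormal Bl k l < 0"
    using bdry_derivatives[OF k] by blast
  \<comment> \<open>The height of the boundary over the supporting line has a strict local maximum at \<open>l\<close>.\<close>
  define \<phi> where "\<phi> t = n \<bullet> bdry Bl k t" for t
  define \<phi>' where "\<phi>' t = n \<bullet> tangent Bl k t" for t
  have der1: "(\<phi> has_real_derivative \<phi>' t) (at t)" for t
    unfolding \<phi>_def \<phi>'_def has_real_derivative_iff_has_vector_derivative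
    by (rule bounded_linear.has_vector_derivative[OF bounded_linear_inner_right d1])
  have der2: "(\<phi>' has_real_derivative n \<bullet> D2 t) (at t)" for t
    unfolding \<phi>'_def has_real_derivative_iff_has_vector_derivative
    by (rule bounded_linear.has_vector_derivative[OF bounded_linear_inner_right d2])
  have cont: "continuous_on A \<phi>" for A
    using der1 DERIV_isCont by (intro continuous_at_imp_continuous_on) blast
  have zero: "\<phi>' l = 0" using onormal_tangent by (simp add: \<phi>'_def n_def)
  have "n \<bullet> D2 l < 0" using neg[of l] by (simp add: n_def inner_commute)
  then obtain e1 e2 where e1: "e1 > 0" "\<And>h. 0 < h \<Longrightarrow> h < e1 \<Longrightarrow> \<phi>' (l + h) < \<phi>' l"
      and e2: "e2 > 0" "\<And>h. 0 < h \<Longrightarrow> h < e2 \<Longrightarrow> \<phi>' (l - h) > \<phi>' l"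
    using DERIV_neg_dec_right[OF der2[of l]] DERIV_neg_dec_left[OF der2[of l]] by auto
  define e where "e = min (min e1 e2) P / 2"
  have e: "e > 0" "e < e1" "e < e2" "e < P" using e1(1) e2(1) P by (auto simp: e_def min_def)
  have drop: "\<phi> t < \<phi> l" if "t \<in> {l - e..<l + e}" "t \<noteq> l" for t
  proof (cases "t < l")
    case True
    show ?thesis
    proof (rule DERIV_pos_imp_increasing_open[OF True _ cont])
      show "\<exists>y. DERIV \<phi> x :> y \<and> 0 < y" if "t < x" "x < l" for x
        using der1[of x] e2(2)[of "l - x"] zero that \<open>t \<in> _\<close> e by (intro exI[of _ "\<phi>' x"]) auto
    qed
  next
    case False
    then have "l < t" using that by simp
    then show ?thesis
    proof (rule DERIV_neg_imp_decreasing_open[OF _ _ cont])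
      show "\<exists>y. DERIV \<phi> x :> y \<and> y < 0" if "l < x" "x < t" for x
        using der1[of x] e1(2)[of "x - l"] zero that \<open>t \<in> _\<close> e by (intro exI[of _ "\<phi>' x"]) auto
    qed
  qed
  have bc: "continuous_on A (bdry Bl k)" for A
    using d1 has_vector_derivative_continuous by (intro continuous_at_imp_continuous_on) blast
  \<comment> \<open>The rest of the boundary stays at a positive distance from \<open>q\<close>, by injectivity over one period.\<close>
  define C where "C = bdry Bl k ` {l + e..l - e + P}"
  have "q \<notin> C"
  proof
    assume "q \<in> C"
    then obtain t where t: "t \<in> {l + e..l - e + P}" "bdry Bl k l = bdry Bl k t" by (auto simp: C_def q_def)
    have "l = t" by (rule inj_onD[OF bdry_inj_window[OF k, of l] t(2)]) (use t(1) e P in \<open>auto simp: P_def\<close>)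
    then show False using t(1) e by simp
  qed
  moreover have "closed C"
    unfolding C_def by (intro compact_imp_closed compact_continuous_image bc compact_Icc)
  ultimately obtain r where r: "r > 0" "\<And>y. dist q y < r \<Longrightarrow> y \<notin> C"
    by (metis open_Compl ComplI ComplD open_contains_ball_eq subset_iff mem_ball)
  define s where "s = min 1 (r / (2 * norm (z - q)))"
  have s: "0 < s" "s \<le> 1" using r zq by (auto simp: s_def)
  have snorm: "s * norm (z - q) < r"
  proof -
    have "s * norm (z - q) \<le> r / (2 * norm (z - q)) * norm (z - q)"
      using zq by (intro mult_right_mono) (auto simp: s_def)
    also have "\<dots> = r / 2" using zq by simp
    finally show ?thesis using r by simp
  qed
  define y where "y = q + s *\<^sub>R (z - q)"
  have yK: "y \<in> obst Bl k"
  proof -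
    have "y = (1 - s) *\<^sub>R q + s *\<^sub>R z" by (simp add: y_def algebra_simps)
    then show ?thesis
      using convexD_alt[OF obst_convex[OF k] bdry_in_obst[OF k, of l] z, of s] s by (simp add: q_def)
  qed
  have yn: "n \<bullet> y = n \<bullet> q"
    using flat by (simp add: y_def inner_add_right n_def q_def inner_commute)
  have yint: "y \<notin> interior (obst Bl k)"
  proof
    assume "y \<in> interior (obst Bl k)"
    then obtain d where d: "d > 0" "ball y d \<subseteq> obst Bl k" by (meson mem_interior)
    have "y + (d / 2) *\<^sub>R n \<in> ball y d"
      using d onormal_unit[OF k, of l] by (simp add: dist_norm n_def)
    then have "(y + (d / 2) *\<^sub>R n - q) \<bullet> n \<le> 0"
      using obst_in_halfplane[OF k, of _ l] d(2) by (auto simp: q_def n_def)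
    moreover have "(y + (d / 2) *\<^sub>R n - q) \<bullet> n = d / 2"
      using yn n1 by (simp add: inner_diff_right inner_add_right inner_commute)
    ultimately show False using d by simp
  qed
  have "y \<in> frontier (obst Bl k)"
    using yint yK closure_subset by (auto simp: frontier_def)
  then obtain t0 where "y = bdry Bl k t0" using frontier_obst_bdry[OF k] by blast
  then obtain m :: int where t: "t0 + of_int m * P \<in> {l - e..<l - e + P}" "bdry Bl k (t0 + of_int m * P) = y"
    unfolding P_def using bdry_reduce[OF k, of t0 "l - e"] by metis
  define t where "t = t0 + of_int m * P"
  have "y \<notin> C" using r(2)[of y] snorm s by (simp add: y_def dist_norm)
  then have "t \<in> {l - e..<l + e}" using t by (force simp: C_def t_def)
  moreover have "\<not> \<phi> t < \<phi> l" using t(2) yn by (simp add: \<phi>_def t_def q_def)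
  ultimately have "t = l" using drop by blast
  then have "y = q" using t(2) by (simp add: t_def q_def)
  then show False using s zq by (simp add: y_def)
qed

lemma outgoing_avoids_obst:
  assumes k: "k < nobst Bl" and v: "v \<noteq> 0" "v \<bullet> onormal Bl k l \<ge> 0" and t: "t > 0"
  shows "bdry Bl k l + t *\<^sub>R v \<notin> obst Bl k"
proof
  assume *: "bdry Bl k l + t *\<^sub>R v \<in> obst Bl k"
  have "(t *\<^sub>R v) \<bullet> onormal Bl k l \<ge> 0" using v t by simp
  then have "bdry Bl k l + t *\<^sub>R v = bdry Bl k l"
    using obst_in_halfplane[OF k *, of l] supporting_line_meets_once[OF k *, of l] by simp
  then show False using v t by simp
qed

end

section \<open>Reversibility of the collision map\<close>

lemma zvec_add: "zvec (p + p') = zvec p + zvec p'"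
  by (simp add: zvec_def complex_eq_iff)

lemma zvec_uminus: "zvec (- p) = - zvec p"
  by (simp add: zvec_def complex_eq_iff)

lemma zvec_zero: "zvec 0 = 0"
  by (simp add: zvec_def complex_eq_iff)

lemma closed_zvec_image: "closed (zvec ` A)"
proof (rule discrete_imp_closed[of 1])
  show "\<forall>x\<in>zvec ` A. \<forall>y\<in>zvec ` A. dist y x < 1 \<longrightarrow> y = x"
  proof (clarsimp)
    fix a b c d assume *: "dist (zvec (c, d)) (zvec (a, b)) < 1"
    have "\<bar>of_int (c - a) :: real\<bar> < 1" "\<bar>of_int (d - b) :: real\<bar> < 1"
      using le_less_trans[OF abs_Re_le_cmod *[unfolded dist_norm]]
        le_less_trans[OF abs_Im_le_cmod *[unfolded dist_norm]] by (auto simp: zvec_def)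
    then have "c = a" "d = b" by linarith+
    then show "zvec (c, d) = zvec (a, b)" by simp
  qed
qed simp

definition obstacles :: "billiard \<Rightarrow> complex set" where
  "obstacles Bl = (\<Union>k<nobst Bl. \<Union>p. lifted_obst Bl k p)"

lemma lifted_obst_iff: "z \<in> lifted_obst Bl k p \<longleftrightarrow> z - zvec p \<in> obst Bl k"
  by (force simp: lifted_obst_def image_iff)

lemma obstacles_iff: "z \<in> obstacles Bl \<longleftrightarrow> (\<exists>k p. k < nobst Bl \<and> z \<in> lifted_obst Bl k p)"
  by (auto simp: obstacles_def)

lemma obstacles_shift: "z + zvec p \<in> obstacles Bl \<longleftrightarrow> z \<in> obstacles Bl"
proof -
  have imp: "z + zvec p \<in> obstacles Bl" if z: "z \<in> obstacles Bl" for z p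
  proof -
    obtain k p' where "k < nobst Bl" "z - zvec p' \<in> obst Bl k"
      using z unfolding obstacles_iff lifted_obst_iff by blast
    then show ?thesis
      unfolding obstacles_iff lifted_obst_iff
      by (intro exI[of _ k] exI[of _ "p' + p"]) (simp add: zvec_add)
  qed
  show ?thesis using imp[of z p] imp[of "z + zvec p" "- p"] by (auto simp: zvec_uminus)
qed

text \<open>
  Reversal of the velocity, in the coordinates of the collision space.
\<close>

definition flip :: "phase \<Rightarrow> phase" where
  "flip x = (fst x, - snd x)"

lemma flip_flip: "flip (flip x) = x"
  by (simp add: flip_def)

context
  fixes Bl :: billiard
  assumes sinai: "sinai_billiard Bl"
begin

lemma closed_lifted_union:
  assumes "k < nobst Bl"
  shows "closed (\<Union>p\<in>A. lifted_obst Bl k p)"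
proof -
  have "(\<Union>p\<in>A. lifted_obst Bl k p) = (\<Union>x\<in>obst Bl k. \<Union>y\<in>zvec ` A. {x + y})"
    by (auto simp: lifted_obst_def)
  then show ?thesis
    using compact_closed_sums[OF obst_compact[OF sinai assms] closed_zvec_image] by simp
qed

lemma closed_obstacles: "closed (obstacles Bl)"
  unfolding obstacles_def by (intro closed_UN ballI closed_lifted_union) auto

text \<open>
  Translating the points \<open>z + j v\<close> back to a fundamental domain, a subsequence converges to some
  \<open>w\<close>; the whole line through \<open>w\<close> is approximated by pieces of the forward ray, so the ray
  enters the interior of an obstacle if the line does.
\<close>

lemma forward_ray_hits:
  assumes "v \<noteq> 0"
  shows "\<exists>t>0. z + of_real t * v \<in> obstacles Bl"
proof (rule ccontr)
  assume no: "\<not> (\<exists>t>0. z + of_real t * v \<in> obstacles Bl)"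
  define u where "u j = z + of_nat j * v" for j :: nat
  define m where "m j = (\<lfloor>Re (u j)\<rfloor>, \<lfloor>Im (u j)\<rfloor>)" for j
  define f where "f j = u j - zvec (m j)" for j
  have "f j \<in> cbox 0 (Complex 1 1)" for j
    by (simp add: in_cbox_complex_iff f_def m_def zvec_def) linarith
  then obtain w r where r: "strict_mono r" and lim: "(f \<circ> r) \<longlonglongrightarrow> w"
    using compact_cbox[of 0 "Complex 1 1"] unfolding compact_def by metis
  obtain t k p where k: "k < nobst Bl" and int: "w + of_real t * v \<in> interior (lifted_obst Bl k p)"
    using finite_horizon[OF sinai assms] by blast
  have "(\<lambda>j. f (r j) + of_real t * v) \<longlonglongrightarrow> w + of_real t * v"
    using lim by (intro tendsto_intros) (simp add: o_def)
  then have ev: "\<forall>\<^sub>F j in sequentially. f (r j) + of_real t * v \<in> interior (lifted_obst Bl k p)"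
    using int by (rule topological_tendstoD[OF _ open_interior])
  obtain n0 :: nat where n0: "real n0 > - t" using reals_Archimedean2 by blast
  have "\<forall>\<^sub>F j in sequentially. j \<ge> n0" by (rule eventually_ge_at_top)
  with ev obtain j where j: "f (r j) + of_real t * v \<in> interior (lifted_obst Bl k p)" "j \<ge> n0"
    using eventually_happens'[OF sequentially_bot] eventually_conj by blast
  have "real j \<le> real (r j)" using seq_suble[OF r, of j] by simp
  then have pos: "real (r j) + t > 0" using n0 j(2) by linarith
  have "f (r j) + of_real t * v \<in> obstacles Bl"
    using j(1) k interior_subset unfolding obstacles_iff by blast
  then have "f (r j) + of_real t * v + zvec (m (r j)) \<in> obstacles Bl"
    by (simp add: obstacles_shift)
  also have "f (r j) + of_real t * v + zvec (m (r j)) = z + of_real (real (r j) + t) * v"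
    by (simp add: f_def u_def algebra_simps)
  finally show False using no pos by blast
qed

lemma coll_space_cases:
  assumes "x \<in> coll_space Bl"
  obtains k l where "k < nobst Bl" "fst x = bdry Bl k l" "\<bar>snd x\<bar> \<le> pi / 2"
    "velocity Bl x = cos (snd x) *\<^sub>R onormal Bl k l + sin (snd x) *\<^sub>R tangent Bl k l"
    "normal_at Bl (fst x) = onormal Bl k l" "tangent_at Bl (fst x) = tangent Bl k l"
proof -
  obtain k where k: "k < nobst Bl" "fst x \<in> frontier (obst Bl k)" "snd x \<in> {-pi/2..pi/2}"
    using assms by (auto simp: coll_space_def)
  then obtain l where l: "fst x = bdry Bl k l" using frontier_obst_bdry[OF sinai] by metis
  show ?thesis
    by (rule that[OF k(1) l])
      (use k(3) in \<open>auto simp: velocity_def l tangent_at_bdry[OF sinai k(1)] normal_at_bdry[OF sinai k(1)] scaleR_conv_of_real abs_le_iff\<close>)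
qed

lemma coll_space_iff:
  "(q, s) \<in> coll_space Bl \<longleftrightarrow> (\<exists>k<nobst Bl. \<exists>l. q = bdry Bl k l) \<and> \<bar>s\<bar> \<le> pi / 2"
proof -
  have "(\<exists>k<nobst Bl. q \<in> frontier (obst Bl k)) \<longleftrightarrow> (\<exists>k<nobst Bl. \<exists>l. q = bdry Bl k l)"
    using frontier_obst_bdry[OF sinai] bdry_in_frontier[OF sinai] by metis
  then show ?thesis by (auto simp: coll_space_def abs_le_iff)
qed

lemma velocity_inner:
  assumes "x \<in> coll_space Bl"
  shows "velocity Bl x \<bullet> normal_at Bl (fst x) = cos (snd x)"
    "velocity Bl x \<bullet> tangent_at Bl (fst x) = sin (snd x)" "norm (velocity Bl x) = 1"
proof -
  obtain k l where k: "k < nobst Bl" "velocity Bl x = cos (snd x) *\<^sub>R onormal Bl k l + sin (snd x) *\<^sub>R tangent Bl k l"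
    "normal_at Bl (fst x) = onormal Bl k l" "tangent_at Bl (fst x) = tangent Bl k l"
    using coll_space_cases[OF assms] by metis
  have 1: "tangent Bl k l \<bullet> tangent Bl k l = 1" "onormal Bl k l \<bullet> onormal Bl k l = 1"
    using tangent_unit[OF sinai k(1)] onormal_unit[OF sinai k(1)] by (simp_all add: dot_square_norm)
  note 2 = onormal_tangent[OF sinai, of k l] onormal_tangent[OF sinai, of k l, unfolded inner_commute[of "onormal Bl k l"]]
  show A: "velocity Bl x \<bullet> normal_at Bl (fst x) = cos (snd x)"
    "velocity Bl x \<bullet> tangent_at Bl (fst x) = sin (snd x)"
    using k 1 2 by (simp_all add: inner_add_left)
  have "velocity Bl x \<bullet> velocity Bl x = (cos (snd x))\<^sup>2 + (sin (snd x))\<^sup>2"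
    using k 1 2 by (simp add: inner_add_left inner_add_right power2_eq_square)
  then show "norm (velocity Bl x) = 1" by (simp add: norm_eq_sqrt_inner)
qed

lemma velocity_outgoing:
  assumes "x \<in> coll_space Bl"
  shows "velocity Bl x \<bullet> normal_at Bl (fst x) \<ge> 0"
proof -
  have "\<bar>snd x\<bar> \<le> pi / 2" using coll_space_cases[OF assms] by metis
  then show ?thesis
    using velocity_inner(1)[OF assms] cos_ge_zero[of "snd x"] by (auto simp: abs_le_iff)
qed

text \<open>
  All other lifts of obstacles form a closed set that misses the starting point, and strict convexity
  keeps even a tangential ray away from the obstacle that it starts on.
\<close>

lemma leaves_obstacles:
  assumes "x \<in> coll_space Bl"
  obtains e where "e > 0" "\<And>t. 0 < t \<Longrightarrow> t < e \<Longrightarrow> fst x + of_real t * velocity Bl x \<notin> obstacles Bl"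
proof -
  define v where "v = velocity Bl x"
  obtain k l where k: "k < nobst Bl" and q: "fst x = bdry Bl k l" and n: "normal_at Bl (fst x) = onormal Bl k l"
    using coll_space_cases[OF assms] by metis
  have v: "norm v = 1" "v \<noteq> 0" "v \<bullet> onormal Bl k l \<ge> 0"
    using velocity_inner(3)[OF assms] velocity_outgoing[OF assms] n by (auto simp: v_def)
  define A where "A j = (if j = k then - {0 :: int \<times> int} else UNIV)" for j
  define O' where "O' = (\<Union>j<nobst Bl. \<Union>p\<in>A j. lifted_obst Bl j p)"
  have "closed O'" unfolding O'_def by (intro closed_UN ballI closed_lifted_union) auto
  have q0: "fst x \<in> lifted_obst Bl k 0"
    using bdry_in_obst[OF sinai k, of l] by (simp add: lifted_obst_iff q zvec_zero)
  have "fst x \<notin> O'"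
  proof
    assume "fst x \<in> O'"
    then obtain j p where "j < nobst Bl" "p \<in> A j" "fst x \<in> lifted_obst Bl j p" by (auto simp: O'_def)
    then show False using obst_disjoint[OF sinai _ k _ q0, of j p] by (auto simp: A_def)
  qed
  then obtain e where e: "e > 0" "ball (fst x) e \<subseteq> - O'"
    using \<open>closed O'\<close> by (metis ComplI open_Compl open_contains_ball_eq)
  show ?thesis
  proof (rule that[OF e(1)])
    fix t assume t: "0 < t" "t < e"
    have "fst x + of_real t * v \<in> ball (fst x) e" using t v by (simp add: dist_norm norm_mult)
    then have "fst x + of_real t * v \<notin> O'" using e by blast
    moreover have "fst x + of_real t * v \<notin> lifted_obst Bl k 0"
      using outgoing_avoids_obst[OF sinai k v(2,3) t(1)]
      by (simp add: lifted_obst_iff q zvec_zero scaleR_conv_of_real)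
    ultimately have "fst x + of_real t * v \<notin> lifted_obst Bl j p" if "j < nobst Bl" for j p
      using that by (cases "p \<in> A j") (auto simp: O'_def A_def split: if_splits)
    then show "fst x + of_real t * velocity Bl x \<notin> obstacles Bl"
      unfolding v_def[symmetric] obstacles_iff by blast
  qed
qed

lemma travel_time_eqI:
  assumes "t > 0" "fst x + of_real t * velocity Bl x \<in> obstacles Bl"
    and "\<And>s. 0 < s \<Longrightarrow> s < t \<Longrightarrow> fst x + of_real s * velocity Bl x \<notin> obstacles Bl"
  shows "travel_time Bl x = t"
proof -
  have "{t. t > 0 \<and> (\<exists>k<nobst Bl. \<exists>p. fst x + of_real t * velocity Bl x \<in> lifted_obst Bl k p)}
      = {t. t > 0 \<and> fst x + of_real t * velocity Bl x \<in> obstacles Bl}"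
    by (auto simp: obstacles_def)
  moreover have "Inf \<dots> = t"
    using assms by (intro cInf_eq_minimum) (auto intro: leI)
  ultimately show ?thesis by (simp add: travel_time_def)
qed

lemma first_hit:
  assumes "x \<in> coll_space Bl"
  shows "travel_time Bl x > 0" "hit_point Bl x \<in> obstacles Bl"
    "\<And>s. 0 < s \<Longrightarrow> s < travel_time Bl x \<Longrightarrow> fst x + of_real s * velocity Bl x \<notin> obstacles Bl"
proof -
  define ray where "ray t = fst x + of_real t * velocity Bl x" for t
  obtain e where e: "e > 0" "\<And>t. 0 < t \<Longrightarrow> t < e \<Longrightarrow> ray t \<notin> obstacles Bl"
    using leaves_obstacles[OF assms] unfolding ray_def by metis
  have "velocity Bl x \<noteq> 0" using velocity_inner(3)[OF assms] by auto
  then obtain t0 where t0: "t0 > 0" "ray t0 \<in> obstacles Bl"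
    using forward_ray_hits unfolding ray_def by blast
  \<comment> \<open>Cutting off the initial free segment makes the set of hitting times closed.\<close>
  define H where "H = {e..} \<inter> ray -` obstacles Bl"
  have "continuous_on UNIV ray" unfolding ray_def by (intro continuous_intros)
  then have "closed H"
    unfolding H_def by (intro closed_Int closed_vimage closed_obstacles) auto
  moreover have "t0 \<in> H" using t0 e by (force simp: H_def)
  moreover have bdd: "bdd_below H" by (auto simp: H_def intro: bdd_belowI[of _ e])
  ultimately have Inf: "Inf H \<in> H" using closed_contains_Inf by blast
  have before: "ray s \<notin> obstacles Bl" if "0 < s" "s < Inf H" for s
    using e(2)[OF that(1)] cInf_lower[OF _ bdd, of s] that by (force simp: H_def)
  have pos: "Inf H > 0" "ray (Inf H) \<in> obstacles Bl" using Inf e by (auto simp: H_def)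
  then have "travel_time Bl x = Inf H"
    using travel_time_eqI before unfolding ray_def by blast
  then show "travel_time Bl x > 0" "hit_point Bl x \<in> obstacles Bl"
    "\<And>s. 0 < s \<Longrightarrow> s < travel_time Bl x \<Longrightarrow> fst x + of_real s * velocity Bl x \<notin> obstacles Bl"
    using pos before by (simp_all add: hit_point_def ray_def)
qed

lemma cell_shift_eqI:
  assumes "k < nobst Bl" "hit_point Bl x - zvec p \<in> obst Bl k"
  shows "cell_shift Bl x = p"
  unfolding cell_shift_def
proof (rule the_equality)
  show "\<exists>k<nobst Bl. hit_point Bl x \<in> lifted_obst Bl k p"
    using assms by (auto simp: lifted_obst_iff)
  show "p' = p" if "\<exists>k<nobst Bl. hit_point Bl x \<in> lifted_obst Bl k p'" for p'
    using obst_disjoint[OF sinai _ assms(1), of _ "hit_point Bl x" p' p] that assms(2)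
    by (auto simp: lifted_obst_iff)
qed

text \<open>
  The particle is outside the obstacle just before it hits it. So the hitting point is a boundary
  point, and the velocity there does not point outwards, since it would otherwise have come from inside.
\<close>

lemma incidence:
  assumes "x \<in> coll_space Bl"
  obtains k l where "k < nobst Bl" "hit_point Bl x = bdry Bl k l + zvec (cell_shift Bl x)"
    "velocity Bl x \<bullet> onormal Bl k l \<le> 0"
proof -
  define v where "v = velocity Bl x"
  define \<tau> where "\<tau> = travel_time Bl x"
  note fh = first_hit[OF assms, folded v_def \<tau>_def]
  have v: "norm v = 1" using velocity_inner(3)[OF assms] by (simp add: v_def)
  obtain k p where k: "k < nobst Bl" and hp: "hit_point Bl x - zvec p \<in> obst Bl k"
    using fh(2) by (auto simp: obstacles_def lifted_obst_iff)
  define y where "y = hit_point Bl x - zvec p"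
  have clear: "y - of_real s * v \<notin> obst Bl k" if "0 < s" "s < \<tau>" for s
  proof
    assume "y - of_real s * v \<in> obst Bl k"
    then have "y - of_real s * v + zvec p \<in> obstacles Bl"
      unfolding obstacles_iff lifted_obst_iff using k by (intro exI[of _ k] exI[of _ p]) simp
    also have "y - of_real s * v + zvec p = fst x + of_real (\<tau> - s) * v"
      by (simp add: y_def hit_point_def v_def \<tau>_def algebra_simps)
    finally show False using fh(3)[of "\<tau> - s"] that by simp
  qed
  have "y \<notin> interior (obst Bl k)"
  proof
    assume "y \<in> interior (obst Bl k)"
    then obtain d where d: "d > 0" "ball y d \<subseteq> obst Bl k" by (meson mem_interior)
    define s where "s = min d \<tau> / 2"
    have s: "0 < s" "s < \<tau>" "s < d" using d fh(1) by (auto simp: s_def min_def)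
    have "y - of_real s * v \<in> ball y d" using s v by (simp add: dist_norm norm_mult)
    then show False using clear[OF s(1,2)] d by blast
  qed
  then have "y \<in> frontier (obst Bl k)" using hp closure_subset by (auto simp: frontier_def y_def)
  then obtain l where l: "y = bdry Bl k l" using frontier_obst_bdry[OF sinai k] by blast
  have "\<not> v \<bullet> onormal Bl k l > 0"
  proof
    assume "v \<bullet> onormal Bl k l > 0"
    then obtain s where s: "s > 0" "bdry Bl k l + s *\<^sub>R (- v) \<in> obst Bl k"
      using entering_ray[OF sinai k, of "- v" l] by auto
    define s' where "s' = min s (\<tau> / 2)"
    have s': "0 < s'" "s' < \<tau>" "s' \<le> s" using s fh(1) by (auto simp: s'_def)
    have "(1 - s' / s) *\<^sub>R y + (s' / s) *\<^sub>R (y + s *\<^sub>R (- v)) \<in> obst Bl k"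
      using convexD_alt[OF obst_convex[OF sinai k] bdry_in_obst[OF sinai k, of l] s(2), of "s' / s"] s s' l
      by (simp add: pos_divide_le_eq)
    also have "(1 - s' / s) *\<^sub>R y + (s' / s) *\<^sub>R (y + s *\<^sub>R (- v)) = y - of_real s' * v"
      using s by (simp add: algebra_simps scaleR_conv_of_real)
    finally show False using clear s' by blast
  qed
  then show ?thesis
    using that[OF k] cell_shift_eqI[OF k hp] l by (simp add: v_def y_def algebra_simps)
qed

text \<open>
  Reversibility of the flow: the reflected velocity after a collision is, up to changing the sign
  of the angle, the opposite of the incoming one, so the flipped particle runs backwards along
  the same free segment.
\<close>

lemma coll_map_reversible:
  assumes "x \<in> coll_space Bl"
  shows "coll_map Bl x \<in> coll_space Bl" "coll_map Bl (flip (coll_map Bl x)) = flip x"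
proof -
  define v where "v = velocity Bl x"
  define \<tau> where "\<tau> = travel_time Bl x"
  define p where "p = cell_shift Bl x"
  note fh = first_hit[OF assms, folded v_def \<tau>_def]
  obtain k l where k: "k < nobst Bl" and hit: "hit_point Bl x = bdry Bl k l + zvec p"
    and inc: "v \<bullet> onormal Bl k l \<le> 0"
    using incidence[OF assms] unfolding p_def v_def by blast
  define q where "q = bdry Bl k l"
  have v1: "norm v = 1" using velocity_inner(3)[OF assms] by (simp add: v_def)
  have bound: "\<bar>v \<bullet> tangent Bl k l\<bar> \<le> 1"
    using Cauchy_Schwarz_ineq2[of v "tangent Bl k l"] v1 tangent_unit[OF sinai k] by simp
  define s where "s = arcsin (v \<bullet> tangent Bl k l)"
  have Tx: "coll_map Bl x = (q, s)"
    using hit by (simp add: coll_map_def Let_def p_def[symmetric] v_def[symmetric] q_def s_def tangent_at_bdry[OF sinai k])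
  have s: "sin s = v \<bullet> tangent Bl k l" "\<bar>s\<bar> \<le> pi / 2"
    using bound arcsin_bounded[of "v \<bullet> tangent Bl k l"] by (auto simp: s_def abs_le_iff)
  show "coll_map Bl x \<in> coll_space Bl"
    using k s(2) by (auto simp: Tx coll_space_iff q_def)
  define x' where "x' = flip (coll_map Bl x)"
  have x': "x' = (q, - s)" by (simp add: x'_def Tx flip_def)
  then have fx': "fst x' = q" by simp
  have expand: "v = (v \<bullet> tangent Bl k l) *\<^sub>R tangent Bl k l + (v \<bullet> onormal Bl k l) *\<^sub>R onormal Bl k l"
    unfolding onormal_def by (rule orthonormal_expansion[OF tangent_unit[OF sinai k]])
  have "v \<bullet> v = (v \<bullet> tangent Bl k l)\<^sup>2 + (v \<bullet> onormal Bl k l)\<^sup>2"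
    by (subst (2) expand) (simp add: inner_add_right power2_eq_square)
  then have "(v \<bullet> onormal Bl k l)\<^sup>2 = (cos s)\<^sup>2"
    using v1 s(1) sin_cos_squared_add[of s] by (simp add: dot_square_norm)
  moreover have "cos s \<ge> 0" using s(2) by (intro cos_ge_zero) (auto simp: abs_le_iff)
  ultimately have coss: "cos s = - (v \<bullet> onormal Bl k l)"
    using inc by (smt (verit) power2_eq_iff)
  have vel: "velocity Bl x' = - v"
    unfolding x' by (subst expand)
      (simp add: velocity_def q_def tangent_at_bdry[OF sinai k] normal_at_bdry[OF sinai k] coss s(1) scaleR_conv_of_real)
  have fx: "fst x = q + zvec p - of_real \<tau> * v"
    using hit by (simp add: hit_point_def q_def v_def \<tau>_def algebra_simps)
  obtain k0 l0 where k0: "k0 < nobst Bl" "fst x = bdry Bl k0 l0" "\<bar>snd x\<bar> \<le> pi / 2"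
    using coll_space_cases[OF assms] by metis
  have time: "travel_time Bl x' = \<tau>"
  proof (rule travel_time_eqI)
    show "\<tau> > 0" by (rule fh(1))
    have "fst x \<in> obstacles Bl"
      using k0(1) bdry_in_obst[OF sinai k0(1), of l0] k0(2)
      unfolding obstacles_iff lifted_obst_iff
      by (intro exI[of _ k0] exI[of _ "0 :: int \<times> int"]) (simp add: zvec_zero)
    then have "fst x + zvec (- p) \<in> obstacles Bl" by (simp add: obstacles_shift)
    then show "fst x' + of_real \<tau> * velocity Bl x' \<in> obstacles Bl"
      by (simp add: fx vel fx' zvec_uminus)
    show "fst x' + of_real t * velocity Bl x' \<notin> obstacles Bl" if "0 < t" "t < \<tau>" for t
    proof -
      have "fst x + of_real (\<tau> - t) * v \<notin> obstacles Bl" using fh(3)[of "\<tau> - t"] that by simp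
      then have "fst x + of_real (\<tau> - t) * v + zvec (- p) \<notin> obstacles Bl"
        by (simp add: obstacles_shift)
      then show ?thesis by (simp add: fx vel fx' zvec_uminus algebra_simps)
    qed
  qed
  have hit': "hit_point Bl x' = fst x - zvec p"
    by (simp add: hit_point_def time vel fx fx')
  have cell: "cell_shift Bl x' = - p"
    using bdry_in_obst[OF sinai k0(1), of l0] k0(2)
    by (intro cell_shift_eqI[OF k0(1)]) (simp add: hit' zvec_uminus)
  have "arcsin (- v \<bullet> tangent_at Bl (fst x)) = - snd x"
    using velocity_inner(2)[OF assms] k0(3) arcsin_sin[of "- snd x"] by (simp add: v_def abs_le_iff)
  then show "coll_map Bl (flip (coll_map Bl x)) = flip x"
    unfolding x'_def[symmetric]
    by (simp add: coll_map_def Let_def cell hit' zvec_uminus vel flip_def)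
qed

lemma flip_coll_space: "flip x \<in> coll_space Bl \<longleftrightarrow> x \<in> coll_space Bl"
  by (cases x) (simp add: flip_def coll_space_iff)

text \<open>
  By reversibility, the conjugate of the collision map by \<open>flip\<close> is its inverse.
\<close>

lemma coll_map_bij: "bij_betw (coll_map Bl) (coll_space Bl) (coll_space Bl)"
  unfolding bij_betw_def
proof (intro conjI inj_onI subset_antisym image_subsetI subsetI)
  fix x y assume "x \<in> coll_space Bl" "y \<in> coll_space Bl" "coll_map Bl x = coll_map Bl y"
  then show "x = y" using coll_map_reversible(2) flip_flip by metis
next
  show "coll_map Bl x \<in> coll_space Bl" if "x \<in> coll_space Bl" for x
    using coll_map_reversible(1)[OF that] .
next
  fix y assume "y \<in> coll_space Bl"
  then have "flip y \<in> coll_space Bl" by (simp add: flip_coll_space)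
  note * = coll_map_reversible[OF this]
  show "y \<in> coll_map Bl ` coll_space Bl"
    by (rule image_eqI[of _ _ "flip (coll_map Bl (flip y))"]) (use * in \<open>simp_all add: flip_flip flip_coll_space\<close>)
qed

end

section \<open>Integration along stable curves\<close>

text \<open>
  For these functions the integrals in the anisotropic norm are additive.
\<close>

definition integrable_on_stable :: "billiard \<Rightarrow> dz_params \<Rightarrow> (phase \<Rightarrow> complex) \<Rightarrow> bool" where
  "integrable_on_stable Bl D f \<longleftrightarrow>
     (\<forall>W\<in>stable_curves Bl D. set_integrable lborel (cv_dom W) (\<lambda>l. f (cv_graph Bl W l)))"

lemma set_integrable_times_continuous:
  fixes f g :: "real \<Rightarrow> complex"
  assumes f: "set_integrable lborel S f" and S: "compact S" and g: "continuous_on S g"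
  shows "set_integrable lborel S (\<lambda>l. f l * g l)"
proof -
  obtain B where B: "\<And>x. x \<in> S \<Longrightarrow> norm (g x) \<le> B"
    using compact_imp_bounded[OF compact_continuous_image[OF g S]] by (force simp: bounded_iff)
  have gi: "(\<lambda>x. indicator S x *\<^sub>R g x) \<in> borel_measurable lborel"
    using borel_integrable_compact[OF S g] by (rule borel_measurable_integrable)
  have fi: "(\<lambda>x. indicator S x *\<^sub>R f x) \<in> borel_measurable lborel"
    using f unfolding set_integrable_def by (rule borel_measurable_integrable)
  show ?thesis
    unfolding set_integrable_def
  proof (rule Bochner_Integration.integrable_bound)
    show "integrable lborel (\<lambda>x. B *\<^sub>R (indicator S x *\<^sub>R f x))"
      using f unfolding set_integrable_def by (rule integrable_scaleR_right)
    have "(\<lambda>x. indicator S x *\<^sub>R (f x * g x)) = (\<lambda>x. (indicator S x *\<^sub>R f x) * (indicator S x *\<^sub>R g x))"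
      by (auto simp: indicator_def)
    also have "\<dots> \<in> borel_measurable lborel"
      by (rule borel_measurable_times[OF fi gi])
    finally show "(\<lambda>x. indicator S x *\<^sub>R (f x * g x)) \<in> borel_measurable lborel" .
    show "AE x in lborel. norm (indicator S x *\<^sub>R (f x * g x)) \<le> norm (B *\<^sub>R (indicator S x *\<^sub>R f x))"
    proof (intro AE_I2)
      fix x
      show "norm (indicator S x *\<^sub>R (f x * g x)) \<le> norm (B *\<^sub>R (indicator S x *\<^sub>R f x))"
      proof (cases "x \<in> S")
        case True
        have "norm (f x) * norm (g x) \<le> norm (f x) * \<bar>B\<bar>"
          using B[OF True] by (intro mult_left_mono) auto
        then show ?thesis using True by (simp add: norm_mult mult.commute)
      qed simp
    qed
  qed
qed

context
  fixes Bl :: billiard and D :: dz_params and W :: curve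
  assumes W: "W \<in> stable_curves Bl D"
begin

lemma cv_dom_compact: "compact (cv_dom W)"
  by (simp add: cv_dom_def)

lemma cv_speed_continuous: "continuous_on (cv_dom W) (cv_speed W)"
proof -
  have "cv_slope W differentiable_on cv_dom W" using W by (simp add: stable_curves_def)
  then have "continuous_on (cv_dom W) (cv_slope W)" by (rule differentiable_imp_continuous_on)
  then show ?thesis unfolding cv_speed_def by (intro continuous_intros)
qed

lemma cv_angle_continuous: "continuous_on (cv_dom W) (cv_angle W)"
  using W by (auto simp: stable_curves_def intro: differentiable_imp_continuous_on)

text \<open>
  The lower bound serves to exclude a zero denominator in the Hoelder quotients, which would be
  read as \<open>0\<close>.
\<close>

lemma cv_arc_comparable:
  obtains C where "\<And>s t. s \<in> cv_dom W \<Longrightarrow> t \<in> cv_dom W \<Longrightarrow> \<bar>s - t\<bar> \<le> cv_arc W s t \<and> cv_arc W s t \<le> C * \<bar>s - t\<bar>"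
proof -
  obtain C where C: "\<And>x. x \<in> cv_dom W \<Longrightarrow> norm (cv_speed W x) \<le> C"
    using compact_imp_bounded[OF compact_continuous_image[OF cv_speed_continuous cv_dom_compact]]
    by (force simp: bounded_iff)
  show ?thesis
  proof (rule that[of C])
    fix s t assume st: "s \<in> cv_dom W" "t \<in> cv_dom W"
    define I where "I = {min s t..max s t}"
    have I: "I \<subseteq> cv_dom W" using st by (auto simp: I_def cv_dom_def)
    have int: "set_integrable lborel I (cv_speed W)"
      unfolding set_integrable_def
      by (rule borel_integrable_compact) (use continuous_on_subset[OF cv_speed_continuous I] in \<open>auto simp: I_def\<close>)
    have const: "set_integrable lborel I (\<lambda>_. c)" "(LINT l:I|lborel. c) = c * \<bar>s - t\<bar>" for c :: real
      by (auto simp: I_def set_integrable_def set_lebesgue_integral_def min_def max_def)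
    have "(LINT l:I|lborel. 1) \<le> (LINT l:I|lborel. cv_speed W l)"
      by (rule set_integral_mono[OF const(1) int]) (simp add: cv_speed_def)
    moreover have "(LINT l:I|lborel. cv_speed W l) \<le> (LINT l:I|lborel. C)"
      using C I by (intro set_integral_mono[OF int const(1)]) (auto simp: abs_le_iff)
    ultimately show "\<bar>s - t\<bar> \<le> cv_arc W s t \<and> cv_arc W s t \<le> C * \<bar>s - t\<bar>"
      unfolding cv_arc_def I_def[symmetric] const(2) by simp
  qed
qed

lemma cv_length_pos: "cv_length W > 0"
proof -
  have "cv_lo W < cv_hi W" using W by (simp add: stable_curves_def)
  moreover obtain C where "\<And>s t. s \<in> cv_dom W \<Longrightarrow> t \<in> cv_dom W \<Longrightarrow> \<bar>s - t\<bar> \<le> cv_arc W s t \<and> cv_arc W s t \<le> C * \<bar>s - t\<bar>"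
    by (rule cv_arc_comparable) blast
  from this[of "cv_lo W" "cv_hi W"] calculation show ?thesis
    unfolding cv_length_def by (auto simp: cv_dom_def)
qed

lemma holder_continuous:
  assumes r: "r > 0" and fin: "holder_norm r (cv_arc W) (cv_dom W) \<psi> < \<infinity>"
  shows "continuous_on (cv_dom W) \<psi>"
proof -
  obtain C where arc: "\<And>s t. s \<in> cv_dom W \<Longrightarrow> t \<in> cv_dom W \<Longrightarrow> \<bar>s - t\<bar> \<le> cv_arc W s t \<and> cv_arc W s t \<le> C * \<bar>s - t\<bar>"
    by (rule cv_arc_comparable) blast
  define N where "N = holder_norm r (cv_arc W) (cv_dom W) \<psi>"
  define H where "H = enn2real N"
  have N: "N = ennreal H" "H \<ge> 0" using fin by (simp_all add: H_def N_def top.not_eq_extremum)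
  have C: "C \<ge> 0"
  proof -
    have lohi: "cv_lo W < cv_hi W" using W by (simp add: stable_curves_def)
    then have "0 \<le> C * \<bar>cv_lo W - cv_hi W\<bar>"
      using arc[of "cv_lo W" "cv_hi W"] by (auto simp: cv_dom_def)
    then show ?thesis using lohi by (simp add: zero_le_mult_iff)
  qed
  have bound: "cmod (\<psi> s - \<psi> t) \<le> H * (C * \<bar>s - t\<bar>) powr r" if st: "s \<in> cv_dom W" "t \<in> cv_dom W" for s t
  proof (cases "s = t")
    case True
    then show ?thesis using N by simp
  next
    case False
    have pos: "cv_arc W s t > 0" using arc[OF st] False by auto
    have "ennreal (cmod (\<psi> s - \<psi> t) / cv_arc W s t powr r)
       \<le> (SUP (s, t)\<in>{(s, t). s \<in> cv_dom W \<and> t \<in> cv_dom W \<and> s \<noteq> t}. ennreal (cmod (\<psi> s - \<psi> t) / cv_arc W s t powr r))"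
      by (rule SUP_upper2[of "(s, t)"]) (use st False in auto)
    also have "\<dots> \<le> N" by (simp add: N_def holder_norm_def)
    finally have "cmod (\<psi> s - \<psi> t) / cv_arc W s t powr r \<le> H" using N by simp
    then have "cmod (\<psi> s - \<psi> t) \<le> H * cv_arc W s t powr r" using pos by (simp add: pos_divide_le_eq)
    also have "\<dots> \<le> H * (C * \<bar>s - t\<bar>) powr r"
      using arc[OF st] pos r N by (intro mult_left_mono powr_mono2) auto
    finally show ?thesis .
  qed
  show ?thesis
    unfolding continuous_on_def
  proof
    fix t assume t: "t \<in> cv_dom W"
    have "((\<lambda>s. H * (C * \<bar>s - t\<bar>) powr r) \<longlongrightarrow> H * (C * \<bar>t - t\<bar>) powr r) (at t within cv_dom W)"
      using r C by (intro tendsto_intros tendsto_powr') auto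
    then have "((\<lambda>s. H * (C * \<bar>s - t\<bar>) powr r) \<longlongrightarrow> 0) (at t within cv_dom W)" by simp
    then have "((\<lambda>s. \<psi> s - \<psi> t) \<longlongrightarrow> 0) (at t within cv_dom W)"
      by (rule Lim_null_comparison[rotated]) (auto simp: eventually_at_filter intro!: always_eventually bound t)
    then show "(\<psi> \<longlongrightarrow> \<psi> t) (at t within cv_dom W)" by (simp add: LIM_zero_iff)
  qed
qed

lemma curve_integral_diff:
  assumes "integrable_on_stable Bl D f" "integrable_on_stable Bl D g" "continuous_on (cv_dom W) \<psi>"
  shows "curve_integral Bl W (\<lambda>x. f x - g x) \<psi> = curve_integral Bl W f \<psi> - curve_integral Bl W g \<psi>"
proof -
  have *: "set_integrable lborel (cv_dom W) (\<lambda>l. h (cv_graph Bl W l) * \<psi> l * of_real (cv_speed W l))"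
    if "integrable_on_stable Bl D h" for h
    using that W unfolding integrable_on_stable_def mult.assoc
    by (intro set_integrable_times_continuous cv_dom_compact continuous_intros assms(3) cv_speed_continuous) auto
  show ?thesis
    unfolding curve_integral_def left_diff_distrib
    by (rule set_integral_diff(2)[OF *[OF assms(1)] *[OF assms(2)]])
qed

end

text \<open>
  Test functions of finite Hoelder norm are continuous, so integrability of \<open>f\<close> and \<open>g\<close> along the
  curves is enough to split each integral.
\<close>

lemma norm_B_diff:
  assumes D: "valid_params D" and f: "integrable_on_stable Bl D f" and g: "integrable_on_stable Bl D g"
  shows "norm_B Bl D (\<lambda>x. f x - g x) \<le> norm_B Bl D f + norm_B Bl D g"
proof -
  have par: "dz_q D > 0" "dz_p D > 0" "dz_alpha D > 0" using D by (auto simp: valid_params_def)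
  have s: "norm_s Bl D (\<lambda>x. f x - g x) \<le> norm_s Bl D f + norm_s Bl D g"
    unfolding norm_s_def[of _ _ "\<lambda>x. f x - g x"]
  proof (intro SUP_least)
    fix W \<psi>
    assume W: "W \<in> stable_curves Bl D"
      and \<psi>: "\<psi> \<in> {\<psi>. ennreal (cv_length W powr dz_alpha D) * holder_norm (dz_q D) (cv_arc W) (cv_dom W) \<psi> \<le> 1}"
    have "holder_norm (dz_q D) (cv_arc W) (cv_dom W) \<psi> < \<infinity>"
    proof (rule ccontr)
      assume "\<not> ?thesis"
      then have "holder_norm (dz_q D) (cv_arc W) (cv_dom W) \<psi> = \<infinity>" by (metis infinity_ennreal_def top.not_eq_extremum)
      then show False using \<psi> cv_length_pos[OF W] by (auto simp: ennreal_mult_top top_unique)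
    qed
    then have c: "continuous_on (cv_dom W) \<psi>" by (rule holder_continuous[OF W par(1)])
    have le: "ennreal (cmod (curve_integral Bl W h \<psi>)) \<le> norm_s Bl D h" for h
      unfolding norm_s_def by (rule SUP_upper2[OF W], rule SUP_upper2[OF \<psi>]) simp
    have "ennreal (cmod (curve_integral Bl W (\<lambda>x. f x - g x) \<psi>))
      \<le> ennreal (cmod (curve_integral Bl W f \<psi>) + cmod (curve_integral Bl W g \<psi>))"
      unfolding curve_integral_diff[OF W f g c] by (intro ennreal_leI norm_triangle_ineq4)
    also have "\<dots> \<le> norm_s Bl D f + norm_s Bl D g" using add_mono[OF le le] by simp
    finally show "ennreal (cmod (curve_integral Bl W (\<lambda>x. f x - g x) \<psi>)) \<le> norm_s Bl D f + norm_s Bl D g" .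
  qed
  have u: "norm_u Bl D (\<lambda>x. f x - g x) \<le> norm_u Bl D f + norm_u Bl D g"
    unfolding norm_u_def[of _ _ "\<lambda>x. f x - g x"]
  proof (intro SUP_least; clarify; intro SUP_least; clarify)
    fix \<epsilon> W1 W2 \<psi>1 \<psi>2
    assume e: "\<epsilon> \<in> {0<..dz_eps0 D}" and W: "W1 \<in> stable_curves Bl D" "W2 \<in> stable_curves Bl D"
      and dist: "curve_dist D W1 W2 \<le> ennreal \<epsilon>"
      and \<psi>: "holder_norm (dz_p D) (cv_arc W1) (cv_dom W1) \<psi>1 \<le> 1"
        "holder_norm (dz_p D) (cv_arc W2) (cv_dom W2) \<psi>2 \<le> 1"
        "holder_norm (dz_q D) (\<lambda>s t. \<bar>s - t\<bar>) (cv_dom W1 \<inter> cv_dom W2) (\<lambda>l. \<psi>1 l - \<psi>2 l) \<le> ennreal \<epsilon>"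
    have c: "continuous_on (cv_dom W1) \<psi>1" "continuous_on (cv_dom W2) \<psi>2"
      using \<psi> by (auto intro!: holder_continuous[OF W(1) par(2)] holder_continuous[OF W(2) par(2)] le_less_trans[OF \<psi>(1)] le_less_trans[OF \<psi>(2)])
    define \<Delta> where "\<Delta> h = curve_integral Bl W1 h \<psi>1 - curve_integral Bl W2 h \<psi>2" for h
    have le: "ennreal (\<epsilon> powr (- dz_beta D) * cmod (\<Delta> h)) \<le> norm_u Bl D h" for h
      unfolding norm_u_def \<Delta>_def
      by (rule SUP_upper2[OF e], rule SUP_upper2[of "(W1, W2)"], use W dist in simp,
          simp, rule SUP_upper2[of "(\<psi>1, \<psi>2)"], use \<psi> in simp, simp)
    have "\<Delta> (\<lambda>x. f x - g x) = \<Delta> f - \<Delta> g"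
      by (simp add: \<Delta>_def curve_integral_diff[OF W(1) f g c(1)] curve_integral_diff[OF W(2) f g c(2)])
    then have "\<epsilon> powr (- dz_beta D) * cmod (\<Delta> (\<lambda>x. f x - g x))
      \<le> \<epsilon> powr (- dz_beta D) * cmod (\<Delta> f) + \<epsilon> powr (- dz_beta D) * cmod (\<Delta> g)"
      by (metis distrib_left mult_left_mono norm_triangle_ineq4 powr_ge_zero)
    then have "ennreal (\<epsilon> powr (- dz_beta D) * cmod (\<Delta> (\<lambda>x. f x - g x)))
      \<le> ennreal (\<epsilon> powr (- dz_beta D) * cmod (\<Delta> f)) + ennreal (\<epsilon> powr (- dz_beta D) * cmod (\<Delta> g))"
      by (simp only: ennreal_plus[symmetric] mult_nonneg_nonneg powr_ge_zero norm_ge_zero ennreal_leI)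
    also have "\<dots> \<le> norm_u Bl D f + norm_u Bl D g" by (rule add_mono[OF le le])
    finally show "ennreal (\<epsilon> powr (- dz_beta D) * cmod (curve_integral Bl W1 (\<lambda>x. f x - g x) \<psi>1 - curve_integral Bl W2 (\<lambda>x. f x - g x) \<psi>2))
      \<le> norm_u Bl D f + norm_u Bl D g" by (simp add: \<Delta>_def)
  qed
  have "norm_B Bl D (\<lambda>x. f x - g x)
    \<le> norm_s Bl D f + norm_s Bl D g + ennreal (dz_b D) * (norm_u Bl D f + norm_u Bl D g)"
    unfolding norm_B_def by (intro add_mono s mult_left_mono u) auto
  also have "\<dots> = norm_B Bl D f + norm_B Bl D g"
    by (simp add: norm_B_def distrib_left add_ac)
  finally show ?thesis .
qed

lemma norm_B_unimodular:
  assumes "cmod c = 1"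
  shows "norm_B Bl D (\<lambda>x. c * f x) = norm_B Bl D f"
proof -
  have ci: "curve_integral Bl W (\<lambda>x. c * f x) \<psi> = c * curve_integral Bl W f \<psi>" for W \<psi>
    unfolding curve_integral_def by (simp add: mult.assoc)
  show ?thesis
    by (simp add: norm_B_def norm_s_def norm_u_def ci right_diff_distrib[symmetric] norm_mult assms)
qed

text \<open>
  The homogeneity strips stay away from the grazing angles.
\<close>

lemma stable_curve_in_coll_space:
  assumes sinai: "sinai_billiard Bl" and D: "valid_params D"
    and W: "W \<in> stable_curves Bl D" and l: "l \<in> cv_dom W"
  shows "cv_graph Bl W l \<in> coll_space Bl"
proof -
  have k: "cv_comp W < nobst Bl" using W by (simp add: stable_curves_def)
  have k0: "dz_k0 D \<ge> 1" using D by (simp add: valid_params_def)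
  obtain j where j: "j \<in> strip_indices D" "cv_angle W l \<in> strip D j"
    using W l by (auto simp: stable_curves_def)
  have "\<bar>cv_angle W l\<bar> \<le> pi / 2"
  proof (cases "j = 0")
    case True
    then have "\<bar>cv_angle W l\<bar> < pi / 2 - 1 / (real (dz_k0 D))\<^sup>2" using j by (simp add: strip_def)
    moreover have "1 / (real (dz_k0 D))\<^sup>2 \<ge> 0" by simp
    ultimately show ?thesis by linarith
  next
    case False
    then have "\<bar>j\<bar> \<ge> 1" using j k0 by (auto simp: strip_indices_def)
    then have "(1 :: real) \<le> (of_int \<bar>j\<bar>)\<^sup>2" by (metis of_int_1_le_iff one_le_power)
    then have "1 / (of_int \<bar>j\<bar>)\<^sup>2 \<le> (1 :: real)" by (simp only: divide_le_eq_1) simp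
    moreover have "1 / (of_int (\<bar>j\<bar> + 1))\<^sup>2 \<ge> (0 :: real)" by simp
    moreover have "pi / 2 - 1 / (of_int \<bar>j\<bar>)\<^sup>2 < of_int (sgn j) * cv_angle W l"
      "of_int (sgn j) * cv_angle W l < pi / 2 - 1 / (of_int (\<bar>j\<bar> + 1))\<^sup>2"
      using j False by (auto simp: strip_def)
    ultimately have "0 \<le> of_int (sgn j) * cv_angle W l" "of_int (sgn j) * cv_angle W l \<le> pi / 2"
      using pi_gt3 by linarith+
    moreover have "\<bar>of_int (sgn j) * cv_angle W l\<bar> = \<bar>cv_angle W l\<bar>"
      using False by (simp add: sgn_if abs_mult)
    ultimately show ?thesis by linarith
  qed
  moreover have "bdry Bl (cv_comp W) l \<in> frontier (obst Bl (cv_comp W))"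
    by (rule bdry_in_frontier[OF sinai k])
  ultimately show ?thesis using k by (auto simp: cv_graph_def coll_space_def abs_le_iff)
qed

text \<open>
  The curves lie in the collision space, so the norm does not see the values elsewhere.
\<close>

lemma norm_B_cong:
  assumes sinai: "sinai_billiard Bl" and D: "valid_params D"
    and eq: "\<And>x. x \<in> coll_space Bl \<Longrightarrow> f x = g x"
  shows "norm_B Bl D f = norm_B Bl D g"
proof -
  have ci: "curve_integral Bl W f \<psi> = curve_integral Bl W g \<psi>" if "W \<in> stable_curves Bl D" for W \<psi>
    unfolding curve_integral_def set_lebesgue_integral_def
    by (intro Bochner_Integration.integral_cong)
      (auto simp: indicator_def eq[OF stable_curve_in_coll_space[OF sinai D that]])
  show ?thesis
    unfolding norm_B_def norm_s_def norm_u_def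
    by (intro arg_cong2[where f = "(+)"] arg_cong2[where f = "(*)"] SUP_cong refl) (auto simp: ci cong: SUP_cong_simp)
qed

lemma C1_integrable:
  assumes sinai: "sinai_billiard Bl" and D: "valid_params D" and h: "h \<in> C1_coll Bl"
  shows "integrable_on_stable Bl D h"
  unfolding integrable_on_stable_def
proof
  fix W assume W: "W \<in> stable_curves Bl D"
  have k: "cv_comp W < nobst Bl" using W by (simp add: stable_curves_def)
  define S :: "(real \<times> real) set" where "S = UNIV \<times> {-pi/2..pi/2}"
  obtain a b :: "real \<times> real \<Rightarrow> complex" where
    "\<forall>y\<in>S. ((\<lambda>(l, t). h (bdry Bl (cv_comp W) l, t)) has_derivative
           (\<lambda>(u, v). of_real u * a y + of_real v * b y)) (at y within S)"
    using h k unfolding C1_coll_def S_def by blast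
  then have "continuous_on S (\<lambda>(l, t). h (bdry Bl (cv_comp W) l, t))"
    by (intro has_derivative_continuous_on) blast
  moreover have "(\<lambda>l. (l, cv_angle W l)) ` cv_dom W \<subseteq> S"
    using stable_curve_in_coll_space[OF sinai D W] by (auto simp: S_def cv_graph_def coll_space_def)
  moreover have "continuous_on (cv_dom W) (\<lambda>l. (l, cv_angle W l))"
    by (intro continuous_intros cv_angle_continuous[OF W])
  ultimately have "continuous_on (cv_dom W) ((\<lambda>(l, t). h (bdry Bl (cv_comp W) l, t)) \<circ> (\<lambda>l. (l, cv_angle W l)))"
    by (blast intro: continuous_on_compose continuous_on_subset)
  then have "continuous_on (cv_dom W) (\<lambda>l. h (cv_graph Bl W l))"
    by (simp add: o_def cv_graph_def)
  then show "set_integrable lborel (cv_dom W) (\<lambda>l. h (cv_graph Bl W l))"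
    unfolding set_integrable_def by (intro borel_integrable_compact) (simp_all add: cv_dom_def)
qed

lemma C1_coll_lincomb:
  assumes f: "f \<in> C1_coll Bl" and g: "g \<in> C1_coll Bl"
  shows "(\<lambda>x. f x + c * g x) \<in> C1_coll Bl"
  unfolding C1_coll_def
proof (intro CollectI allI impI)
  fix k assume k: "k < nobst Bl"
  define S :: "(real \<times> real) set" where "S = UNIV \<times> {-pi/2..pi/2}"
  obtain a b :: "real \<times> real \<Rightarrow> complex" where ab: "continuous_on S a" "continuous_on S b"
    "\<And>y. y \<in> S \<Longrightarrow> ((\<lambda>(l, t). f (bdry Bl k l, t)) has_derivative
           (\<lambda>(u, v). of_real u * a y + of_real v * b y)) (at y within S)"
    using f k unfolding C1_coll_def S_def by blast
  obtain a' b' :: "real \<times> real \<Rightarrow> complex" where ab': "continuous_on S a'" "continuous_on S b'"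
    "\<And>y. y \<in> S \<Longrightarrow> ((\<lambda>(l, t). g (bdry Bl k l, t)) has_derivative
           (\<lambda>(u, v). of_real u * a' y + of_real v * b' y)) (at y within S)"
    using g k unfolding C1_coll_def S_def by blast
  have "((\<lambda>(l, t). f (bdry Bl k l, t) + c * g (bdry Bl k l, t)) has_derivative
           (\<lambda>(u, v). of_real u * (a y + c * a' y) + of_real v * (b y + c * b' y))) (at y within S)"
    if "y \<in> S" for y
    using has_derivative_add[OF ab(3)[OF that] has_derivative_mult_right[OF ab'(3)[OF that], of c]]
    by (simp add: case_prod_unfold algebra_simps)
  moreover have "continuous_on S (\<lambda>y. a y + c * a' y)" "continuous_on S (\<lambda>y. b y + c * b' y)"
    using ab ab' by (auto intro!: continuous_intros)
  ultimately show "\<exists>a b. continuous_on (UNIV \<times> {-pi/2..pi/2}) a \<and> continuous_on (UNIV \<times> {-pi/2..pi/2}) b \<and>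
     (\<forall>y \<in> UNIV \<times> {-pi/2..pi/2}.
        ((\<lambda>(l, t). f (bdry Bl k l, t) + c * g (bdry Bl k l, t)) has_derivative
           (\<lambda>(u, v). of_real u * a y + of_real v * b y)) (at y within UNIV \<times> {-pi/2..pi/2}))"
    unfolding S_def[symmetric] by blast
qed

lemma C1_coll_zero: "(\<lambda>x. 0) \<in> C1_coll Bl"
  unfolding C1_coll_def
  by (intro CollectI allI impI exI[of _ "\<lambda>_. 0"]) (simp add: case_prod_unfold)

lemma C1_coll_scale: "g \<in> C1_coll Bl \<Longrightarrow> (\<lambda>x. c * g x) \<in> C1_coll Bl"
  using C1_coll_lincomb[OF C1_coll_zero, of g Bl c] by simp

text \<open>
  The completion norm separates the limits: two approximating sequences of the same integrable
  function are asymptotically equal in norm.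
\<close>

lemma defines_elt_unimodular:
  assumes sinai: "sinai_billiard Bl" and D: "valid_params D" and B: "is_space_B Bl D sc emb"
    and f: "defines_elt Bl D emb f u" and g: "defines_elt Bl D emb g v"
    and c: "cmod c = 1" and eq: "\<And>x. x \<in> coll_space Bl \<Longrightarrow> f x = c * g x"
  shows "u = sc c v"
proof -
  interpret vector_space sc using B by (simp add: is_space_B_def complex_banach_def)
  have norm_sc: "norm (sc a x) = cmod a * norm x" for a x
    using B by (simp add: is_space_B_def complex_banach_def)
  obtain h where h: "\<And>n. h n \<in> C1_coll Bl" "(\<lambda>n. norm_B Bl D (\<lambda>x. h n x - f x)) \<longlonglongrightarrow> 0"
      "(\<lambda>n. emb (h n)) \<longlonglongrightarrow> u" and fi: "integrable_on_stable Bl D f"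
    using f unfolding defines_elt_def integrable_on_stable_def by blast
  obtain k where k: "\<And>n. k n \<in> C1_coll Bl" "(\<lambda>n. norm_B Bl D (\<lambda>x. k n x - g x)) \<longlonglongrightarrow> 0"
      "(\<lambda>n. emb (k n)) \<longlonglongrightarrow> v" and gi: "integrable_on_stable Bl D g"
    using g unfolding defines_elt_def integrable_on_stable_def by blast
  have emb: "emb (\<lambda>x. h n x + (- c) * k n x) = emb (h n) + sc (- c) (emb (k n))" for n
  proof -
    have add: "\<forall>h\<in>C1_coll Bl. \<forall>h'\<in>C1_coll Bl. emb (\<lambda>x. h x + h' x) = emb h + emb h'"
      and mul: "\<forall>a. \<forall>h\<in>C1_coll Bl. emb (\<lambda>x. a * h x) = sc a (emb h)"
      using B unfolding is_space_B_def by blast+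
    then show ?thesis 
      by (simp only: add[rule_format, OF h(1) C1_coll_scale[OF k(1)]] mul[rule_format, OF k(1)])
  qed
  have int_diff: "integrable_on_stable Bl D (\<lambda>x. a x - b x)"
    if "integrable_on_stable Bl D a" "integrable_on_stable Bl D b" for a b
    using that unfolding integrable_on_stable_def by (auto intro: set_integral_diff(1))
  have int_scale: "integrable_on_stable Bl D (\<lambda>x. c * a x)" if "integrable_on_stable Bl D a" for a
    using that unfolding integrable_on_stable_def by auto
  have le: "ennreal (norm (emb (\<lambda>x. h n x + (- c) * k n x)))
      \<le> norm_B Bl D (\<lambda>x. h n x - f x) + norm_B Bl D (\<lambda>x. k n x - g x)" for n
  proof -
    have "(\<lambda>x. h n x + (- c) * k n x) \<in> C1_coll Bl" by (rule C1_coll_lincomb[OF h(1) k(1)])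
    then have "ennreal (norm (emb (\<lambda>x. h n x + (- c) * k n x))) = norm_B Bl D (\<lambda>x. h n x + (- c) * k n x)"
      using B unfolding is_space_B_def by blast
    also have "\<dots> = norm_B Bl D (\<lambda>x. (h n x - f x) - c * (k n x - g x))"
      by (rule norm_B_cong[OF sinai D]) (simp add: eq algebra_simps)
    also have "\<dots> \<le> norm_B Bl D (\<lambda>x. h n x - f x) + norm_B Bl D (\<lambda>x. c * (k n x - g x))"
      by (intro norm_B_diff[OF D] int_diff int_scale fi gi C1_integrable[OF sinai D] h(1) k(1))
    finally show ?thesis by (simp add: norm_B_unimodular[OF c])
  qed
  have lim: "(\<lambda>n. norm_B Bl D (\<lambda>x. h n x - f x) + norm_B Bl D (\<lambda>x. k n x - g x)) \<longlonglongrightarrow> 0"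
    using tendsto_add[OF h(2) k(2)] by simp
  have "(\<lambda>n. ennreal (norm (emb (\<lambda>x. h n x + (- c) * k n x)))) \<longlonglongrightarrow> 0"
  proof (rule tendsto_sandwich[OF _ _ tendsto_const lim])
    show "\<forall>\<^sub>F n in sequentially. ennreal (norm (emb (\<lambda>x. h n x + (- c) * k n x)))
      \<le> norm_B Bl D (\<lambda>x. h n x - f x) + norm_B Bl D (\<lambda>x. k n x - g x)"
      by (intro always_eventually allI le)
  qed simp
  then have "(\<lambda>n. norm (emb (\<lambda>x. h n x + (- c) * k n x))) \<longlonglongrightarrow> 0"
    by (simp only: ennreal_tendsto_0_iff norm_ge_zero)
  then have lim0: "(\<lambda>n. emb (h n) + sc (- c) (emb (k n))) \<longlonglongrightarrow> 0"
    unfolding emb by (rule tendsto_norm_zero_cancel)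
  have "(\<lambda>n. sc (- c) (emb (k n)) - sc (- c) v) \<longlonglongrightarrow> 0"
  proof (rule tendsto_norm_zero_cancel)
    have "(\<lambda>n. norm (emb (k n) - v)) \<longlonglongrightarrow> 0"
      using k(3) by (simp add: LIM_zero tendsto_norm_zero)
    then show "(\<lambda>n. norm (sc (- c) (emb (k n)) - sc (- c) v)) \<longlonglongrightarrow> 0"
      by (simp add: scale_right_diff_distrib[symmetric] norm_sc c del: scale_minus_left)
  qed
  then have "(\<lambda>n. sc (- c) (emb (k n))) \<longlonglongrightarrow> sc (- c) v" by (rule LIM_zero_cancel)
  then have "(\<lambda>n. emb (h n) + sc (- c) (emb (k n))) \<longlonglongrightarrow> u + sc (- c) v"
    by (intro tendsto_add h(3))
  then have "u + sc (- c) v = 0" using lim0 LIMSEQ_unique by blast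
  then show ?thesis by simp
qed

section \<open>Isolated simple eigenvalues\<close>

lemma (in vector_space) card_le_dim_finite:
  assumes "V \<subseteq> span S" "finite S" "T \<subseteq> V" "independent T"
  shows "card T \<le> dim V"
proof -
  obtain B where B: "B \<subseteq> V" "independent B" "V \<subseteq> span B" "card B = dim V"
    using basis_exists by blast
  have "finite B" using independent_span_bound[OF assms(2) B(2)] B(1) assms(1) by blast
  then have "card T \<le> card B"
    using independent_span_bound[OF _ assms(4)] B(3) assms(3) by blast
  then show ?thesis using B(4) by simp
qed

lemma (in vector_space) dim_one_multiples:
  assumes "dim V = 1" "x \<in> V" "x \<noteq> 0" "y \<in> V"
  obtains c where "y = scale c x"
proof -
  obtain B where B: "B \<subseteq> V" "independent B" "V \<subseteq> span B" "card B = 1"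
    using basis_exists assms(1) by metis
  then obtain b where "B = {b}" by (auto simp: card_1_singleton_iff)
  then have "V \<subseteq> range (\<lambda>k. scale k b)" using B(3) by (simp add: span_singleton)
  then obtain k m where "x = scale k b" "y = scale m b" using assms(2,4) by blast
  then have "y = scale (m / k) x" using assms(3) by auto
  then show ?thesis using that by blast
qed

lemma
  assumes sc: "vector_space sc" and X: "module.subspace sc X" and A: "bounded_op sc N X A"
    and T: "T = (\<lambda>y. A y - sc z y)" and x: "x \<in> X"
  shows shifted_pow_mem: "(T ^^ n) x \<in> X"
    and shifted_pow_add: "y \<in> X \<Longrightarrow> (T ^^ n) (x + y) = (T ^^ n) x + (T ^^ n) y"
    and shifted_pow_zero: "(T ^^ n) 0 = 0"
proof -
  interpret vector_space sc by (rule sc)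
  have T_mem: "T x \<in> X" if "x \<in> X" for x
    using A that X by (simp add: T bounded_op_def subspace_diff subspace_scale)
  have T_add: "T (x + y) = T x + T y" if "x \<in> X" "y \<in> X" for x y
    using A that by (simp add: T bounded_op_def scale_right_distrib algebra_simps)
  have mem: "(T ^^ n) x \<in> X" if "x \<in> X" for x n
    by (induction n) (auto simp: that T_mem)
  then show "(T ^^ n) x \<in> X" using x by blast
  show "(T ^^ n) (x + y) = (T ^^ n) x + (T ^^ n) y" if "y \<in> X"
    by (induction n) (auto simp: T_add mem x that)
  have "T 0 = 0" using T_add[of 0 0] X by (simp add: subspace_0)
  then show "(T ^^ n) 0 = 0" by (induction n) auto
qed

text \<open>
  The finite-dimensional summand of a spectral splitting at \<open>z\<close> is the generalized eigenspace,
  because \<open>A - z\<close> is injective on the other one.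
\<close>

lemma gen_eigenspace_splitting:
  assumes sc: "vector_space sc" and X: "module.subspace sc X" and A: "bounded_op sc N X A"
    and E: "module.subspace sc E" and R: "module.subspace sc R"
    and sum: "X = {e + r | e r. e \<in> E \<and> r \<in> R}"
    and inv: "\<forall>x\<in>R. A x \<in> R" and nil: "\<exists>n. \<forall>x\<in>E. ((\<lambda>y. A y - sc z y) ^^ n) x = 0"
    and res: "z \<notin> spectrum_on sc N R A"
  shows "gen_eigenspace sc X A z = E"
proof -
  interpret vector_space sc by (rule sc)
  define T where "T = (\<lambda>y. A y - sc z y)"
  note pow = shifted_pow_mem[OF sc X A T_def] shifted_pow_add[OF sc X A T_def]
    shifted_pow_zero[OF sc X A T_def]
  obtain m where m: "\<And>x. x \<in> E \<Longrightarrow> (T ^^ m) x = 0" using nil unfolding T_def by blast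
  have EX: "E \<subseteq> X" unfolding sum using subspace_0[OF R] by (metis (mono_tags, lifting) CollectI add.right_neutral subsetI)
  have RX: "R \<subseteq> X" unfolding sum using subspace_0[OF E] by (metis (mono_tags, lifting) CollectI add.left_neutral subsetI)
  obtain S where S: "bounded_op sc N R S" "\<And>x. x \<in> R \<Longrightarrow> S (T x) = x"
    using res unfolding spectrum_on_def T_def by blast
  have S0: "S 0 = 0"
  proof -
    have "S (sc 0 0) = sc 0 (S 0)" using S(1) subspace_0[OF R] unfolding bounded_op_def by blast
    then show ?thesis by simp
  qed
  have TR: "(T ^^ n) r \<in> R" if "r \<in> R" for n r
    using that by (induction n) (auto simp: T_def inv R subspace_diff subspace_scale)
  have inj: "r = 0" if "r \<in> R" "(T ^^ n) r = 0" for n r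
    using that(2)
  proof (induction n)
    case 0
    then show ?case by simp
  next
    case (Suc n)
    have "(T ^^ n) r = S (T ((T ^^ n) r))" using S(2)[OF TR[OF that(1)]] by simp
    then show ?case using Suc S0 by simp
  qed
  show ?thesis
  proof (intro subset_antisym subsetI)
    fix x assume "x \<in> E"
    then show "x \<in> gen_eigenspace sc X A z"
      using m EX unfolding gen_eigenspace_def T_def by blast
  next
    fix x assume "x \<in> gen_eigenspace sc X A z"
    then obtain n where x: "x \<in> X" "(T ^^ n) x = 0" unfolding gen_eigenspace_def T_def by blast
    then obtain e r where er: "e \<in> E" "r \<in> R" "x = e + r" using sum by blast
    have erX: "e \<in> X" "r \<in> X" using er EX RX by auto
    have "(T ^^ (m + n)) x = 0"
      using pow(3)[OF x(1), of m] x(2) by (simp add: funpow_add)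
    moreover have "(T ^^ (n + m)) e = 0"
      using m[OF er(1)] pow(3)[OF x(1), of n] by (simp add: funpow_add)
    moreover have "(T ^^ (m + n)) x = (T ^^ (m + n)) e + (T ^^ (m + n)) r"
      unfolding er(3) by (rule pow(2)[OF erX])
    ultimately have "(T ^^ (m + n)) r = 0" by (simp add: add.commute)
    then have "r = 0" by (rule inj[OF er(2)])
    then show "x \<in> E" using er by simp
  qed
qed

lemma discrete_spectrum_splitting:
  assumes "vector_space sc" "module.subspace sc X" "bounded_op sc N X A"
    and "z \<in> discrete_spectrum_on sc N X A"
  obtains R S where "module.subspace sc (gen_eigenspace sc X A z)" "module.subspace sc R"
    "X = {e + r | e r. e \<in> gen_eigenspace sc X A z \<and> r \<in> R}"
    "finite S" "gen_eigenspace sc X A z = module.span sc S"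
    "\<forall>x\<in>R. A x \<in> R" "z \<notin> spectrum_on sc N R A"
proof -
  obtain E R where ER: "module.subspace sc E" "module.subspace sc R"
     "X = {e + r | e r. e \<in> E \<and> r \<in> R}" "\<exists>S. finite S \<and> E = module.span sc S"
     "\<forall>x\<in>R. A x \<in> R" "\<exists>n. \<forall>x\<in>E. ((\<lambda>y. A y - sc z y) ^^ n) x = 0" "z \<notin> spectrum_on sc N R A"
    using assms(4) unfolding discrete_spectrum_on_def by blast
  have eq: "gen_eigenspace sc X A z = E"
    by (rule gen_eigenspace_splitting[OF assms(1-3) ER(1-3,5-7)])
  obtain S where "finite S" "E = module.span sc S" using ER(4) by blast
  then show ?thesis using that[of R S] ER unfolding eq by blast
qed

text \<open>
  The essential spectral radius is a supremum over the part of the spectrum that is not discrete. A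
  bound on the spectrum makes it an upper bound, so beyond it only the discrete part remains.
\<close>

lemma eigenvalue_discrete:
  assumes sc: "vector_space sc" and A: "bounded_op sc N X A" and X: "module.subspace sc X"
    and z: "z \<in> eigenvalues_on sc X A"
    and bdd: "spectrum_on sc N X A \<subseteq> cball 0 C"
    and ess: "ess_spectral_radius sc N X A \<le> \<rho>" "\<rho> < cmod z"
  shows "z \<in> discrete_spectrum_on sc N X A"
proof (rule ccontr)
  interpret vector_space sc by (rule sc)
  assume nd: "z \<notin> discrete_spectrum_on sc N X A"
  obtain x where x: "x \<in> X" "x \<noteq> 0" "A x = sc z x"
    using z by (auto simp: eigenvalues_on_def)
  have "z \<in> spectrum_on sc N X A"
  proof (rule ccontr)
    assume "z \<notin> spectrum_on sc N X A"
    then obtain R where R: "bounded_op sc N X R" "\<And>x. x \<in> X \<Longrightarrow> R (A x - sc z x) = x"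
      unfolding spectrum_on_def by blast
    have "R (sc 0 x) = sc 0 (R x)" using R(1) x(1) unfolding bounded_op_def by blast
    then have "R 0 = 0" by simp
    then show False using R(2)[OF x(1)] x(2,3) by simp
  qed
  then have mem: "cmod z \<in> insert 0 (cmod ` (spectrum_on sc N X A - discrete_spectrum_on sc N X A))"
    using nd by blast
  have "bdd_above (insert 0 (cmod ` (spectrum_on sc N X A - discrete_spectrum_on sc N X A)))"
    using bdd by (intro bdd_aboveI[of _ "max 0 C"]) (auto simp: subset_iff le_max_iff_disj)
  then have "cmod z \<le> ess_spectral_radius sc N X A"
    unfolding ess_spectral_radius_def using mem by (rule cSup_upper[rotated])
  then show False using ess by simp
qed

text \<open>
  At a simple isolated eigenvalue \<open>1\<close> with eigenvector \<open>e\<close>, the operator \<open>V\<close> below is the reduced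
  resolvent: it inverts \<open>A - 1\<close> on the complementary invariant subspace and vanishes at \<open>e\<close>, while
  \<open>f\<close> gives the coordinate along \<open>e\<close> of the spectral projector. Boundedness of the projector needs
  no separate argument, as \<open>S \<circ> (A - 1)\<close> is the projector onto the complement when \<open>S\<close> is the
  resolvent there.
\<close>

lemma simple_eigenvalue_reduced_resolvent:
  assumes sc: "vector_space sc" and X: "module.subspace sc X" and A: "bounded_op sc N X A"
    and disc: "1 \<in> discrete_spectrum_on sc N X A" and simple: "alg_mult sc X A 1 = 1"
    and ev: "1 \<in> eigenvalues_on sc X A"
    and N_scale: "\<And>c x. x \<in> X \<Longrightarrow> N (sc c x) = cmod c * N x"
    and N_diff: "\<And>x y. x \<in> X \<Longrightarrow> y \<in> X \<Longrightarrow> N (x - y) \<le> N x + N y"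
    and N_pos: "\<And>x. x \<in> X \<Longrightarrow> x \<noteq> 0 \<Longrightarrow> N x > 0"
  obtains e V f C where "e \<in> X" "e \<noteq> 0" "A e = e"
    "\<And>x. x \<in> X \<Longrightarrow> V x \<in> X"
    "\<And>x y. x \<in> X \<Longrightarrow> y \<in> X \<Longrightarrow> V (x + y) = V x + V y"
    "\<And>x. x \<in> X \<Longrightarrow> N (V x) \<le> C * N x"
    "\<And>x y. x \<in> X \<Longrightarrow> y \<in> X \<Longrightarrow> f (x + y) = f x + f y"
    "\<And>c x. x \<in> X \<Longrightarrow> f (sc c x) = c * f x"
    "\<And>x. x \<in> X \<Longrightarrow> cmod (f x) \<le> C * N x"
    "f e = 1" "\<And>x. x \<in> X \<Longrightarrow> f (V x) = 0"
    "\<And>x. x \<in> X \<Longrightarrow> A (V x) - V x = x - sc (f x) e"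
proof -
  interpret vector_space sc by (rule sc)
  define E where "E = gen_eigenspace sc X A 1"
  obtain R where ER: "subspace E" "subspace R" "X = {e + r | e r. e \<in> E \<and> r \<in> R}"
    "\<forall>x\<in>R. A x \<in> R" "1 \<notin> spectrum_on sc N R A"
    by (rule discrete_spectrum_splitting[OF sc X A disc, folded E_def]) (rule that)
  obtain e where e: "e \<in> X" "e \<noteq> 0" "A e = e"
    using ev by (auto simp: eigenvalues_on_def)
  have eE: "e \<in> E"
    unfolding E_def gen_eigenspace_def using e by (auto intro!: exI[of _ 1])
  have EX: "E \<subseteq> X" by (auto simp: E_def gen_eigenspace_def)
  have RX: "R \<subseteq> X" unfolding ER(3) using subspace_0[OF ER(1)] by (metis (mono_tags, lifting) CollectI add.left_neutral subsetI)
  have E_line: "\<exists>c. y = sc c e" if "y \<in> E" for y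
    using dim_one_multiples[OF _ eE e(2) that] simple unfolding alg_mult_def E_def by metis
  obtain S where S: "bounded_op sc N R S" and SA: "\<And>x. x \<in> R \<Longrightarrow> S (A x - x) = x"
    and AS: "\<And>x. x \<in> R \<Longrightarrow> A (S x) - S x = x"
    using ER(5) unfolding spectrum_on_def by auto
  have A_lin: "\<And>x y. x \<in> X \<Longrightarrow> y \<in> X \<Longrightarrow> A (x + y) = A x + A y"
    "\<And>x c. x \<in> X \<Longrightarrow> A (sc c x) = sc c (A x)" "\<And>x. x \<in> X \<Longrightarrow> A x \<in> X"
    using A by (simp_all add: bounded_op_def)
  have S_lin: "\<And>x y. x \<in> R \<Longrightarrow> y \<in> R \<Longrightarrow> S (x + y) = S x + S y"
    "\<And>x c. x \<in> R \<Longrightarrow> S (sc c x) = sc c (S x)" "\<And>x. x \<in> R \<Longrightarrow> S x \<in> R"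
    using S by (simp_all add: bounded_op_def)
  define T where "T x = A x - x" for x
  have T_add: "T (x + y) = T x + T y" if "x \<in> X" "y \<in> X" for x y
    using A_lin that by (simp add: T_def)
  have T_sc: "T (sc c x) = sc c (T x)" if "x \<in> X" for x c
    using A_lin that by (simp add: T_def scale_right_diff_distrib)
  have T_E: "T x = 0" if "x \<in> E" for x
    using E_line[OF that] A_lin(2)[OF e(1)] e by (auto simp: T_def)
  have T_R: "T x \<in> R" if "x \<in> R" for x
    using that ER by (simp add: T_def subspace_diff)
  have T_XR: "T x \<in> R" if x: "x \<in> X" for x
  proof -
    obtain a r where "a \<in> E" "r \<in> R" "x = a + r" using x ER(3) by blast
    moreover from this have "a \<in> X" "r \<in> X" using EX RX by auto
    ultimately show ?thesis using T_add[of a r] T_E T_R by simp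
  qed
  define p where "p x = S (T x)" for x
  have p_R: "p x \<in> R" if "x \<in> X" for x using S_lin T_XR[OF that] by (simp add: p_def)
  have p_E: "x - p x \<in> E" if x: "x \<in> X" for x
  proof -
    obtain a r where ar: "a \<in> E" "r \<in> R" "x = a + r" using x ER(3) by blast
    then have "a \<in> X" "r \<in> X" using EX RX by auto
    then have "T x = T r" using T_add[of a r] T_E ar by simp
    then have "p x = r" using SA[OF ar(2)] by (simp add: p_def T_def)
    then show ?thesis using ar by simp
  qed
  have p_add: "p (x + y) = p x + p y" if "x \<in> X" "y \<in> X" for x y
    using that S_lin T_XR T_add by (simp add: p_def)
  have p_sc: "p (sc c x) = sc c (p x)" if "x \<in> X" for x c
    using that S_lin T_XR T_sc by (simp add: p_def)
  have p_id: "p x = x" if "x \<in> R" for x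
    using SA[OF that] by (simp add: p_def T_def)
  have Tp: "T (p x) = T x" if "x \<in> X" for x
    using AS[OF T_XR[OF that]] by (simp add: p_def T_def)
  define f where "f x = (SOME c. x - p x = sc c e)" for x
  have f: "x - p x = sc (f x) e" if "x \<in> X" for x
    unfolding f_def by (rule someI_ex[OF E_line[OF p_E[OF that]]])
  have f_eqI: "f x = c" if "x \<in> X" "x - p x = sc c e" for x c
    using f[OF that(1)] that(2) e(2) by (simp add: scale_right_imp_eq)
  define V where "V x = S (p x)" for x
  have V_R: "V x \<in> R" if "x \<in> X" for x using that S_lin p_R by (simp add: V_def)
  have N_ge: "N x \<ge> 0" if "x \<in> X" for x
    using N_pos[OF that] N_scale[OF that, of 0] by (cases "x = 0") auto
  obtain CA where CA: "\<And>x. x \<in> X \<Longrightarrow> N (A x) \<le> CA * N x"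
    using A unfolding bounded_op_def by blast
  obtain CS where CS: "\<And>x. x \<in> R \<Longrightarrow> N (S x) \<le> CS * N x"
    using S unfolding bounded_op_def by blast
  have p_bound: "N (p x) \<le> \<bar>CS\<bar> * (\<bar>CA\<bar> + 1) * N x" if "x \<in> X" for x
  proof -
    have "N (T x) \<le> N (A x) + N x" unfolding T_def using N_diff A_lin that by blast
    also have "\<dots> \<le> \<bar>CA\<bar> * N x + N x"
      using CA[OF that] mult_right_mono[OF abs_ge_self N_ge[OF that], of CA] by linarith
    finally have "\<bar>CS\<bar> * N (T x) \<le> \<bar>CS\<bar> * ((\<bar>CA\<bar> + 1) * N x)"
      by (intro mult_left_mono) (auto simp: algebra_simps)
    moreover have "N (p x) \<le> \<bar>CS\<bar> * N (T x)"
      using CS[OF T_XR[OF that]] mult_right_mono[OF abs_ge_self N_ge[OF subsetD[OF RX T_XR[OF that]]], of CS]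
      unfolding p_def by linarith
    ultimately show ?thesis by simp
  qed
  define K where "K = \<bar>CS\<bar> * (\<bar>CA\<bar> + 1)"
  have K: "K \<ge> 0" by (simp add: K_def)
  define C where "C = \<bar>CS\<bar> * K + (1 + K) / N e"
  have Ne: "N e > 0" using N_pos e by blast
  have V_bound: "N (V x) \<le> C * N x" if "x \<in> X" for x
  proof -
    have "N (V x) \<le> \<bar>CS\<bar> * N (p x)"
      using CS[OF p_R[OF that]] mult_right_mono[OF abs_ge_self N_ge[OF subsetD[OF RX p_R[OF that]]], of CS]
      unfolding V_def by linarith
    also have "\<dots> \<le> \<bar>CS\<bar> * (K * N x)"
      using p_bound[OF that] by (intro mult_left_mono) (auto simp: K_def)
    also have "\<dots> \<le> C * N x"
      using K Ne N_ge[OF that] by (simp add: C_def algebra_simps)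
    finally show ?thesis .
  qed
  have f_bound: "cmod (f x) \<le> C * N x" if "x \<in> X" for x
  proof -
    have "cmod (f x) * N e = N (x - p x)" using f[OF that] N_scale[OF e(1)] by simp
    also have "\<dots> \<le> N x + K * N x"
      using N_diff[OF that, of "p x"] p_R[OF that] RX p_bound[OF that] by (auto simp: K_def)
    finally have "cmod (f x) \<le> (1 + K) / N e * N x" using Ne by (simp add: field_simps)
    also have "\<dots> \<le> C * N x"
      using K N_ge[OF that] by (intro mult_right_mono) (auto simp: C_def)
    finally show ?thesis .
  qed
  have plus_X: "x + y \<in> X" "sc c x \<in> X" if "x \<in> X" "y \<in> X" for x y c
    using X that by (auto simp: subspace_add subspace_scale)
  show ?thesis
  proof (rule that[of e V C f, OF e])
    show "V x \<in> X" if "x \<in> X" for x using V_R[OF that] RX by blast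
    show "V (x + y) = V x + V y" if "x \<in> X" "y \<in> X" for x y
      using that p_add p_R S_lin by (simp add: V_def)
    show "f (x + y) = f x + f y" if "x \<in> X" "y \<in> X" for x y
    proof (rule f_eqI)
      have "x + y - p (x + y) = (x - p x) + (y - p y)" using p_add[OF that] by simp
      then show "x + y - p (x + y) = sc (f x + f y) e"
        using f that by (simp add: scale_left_distrib)
    qed (use plus_X that in blast)
    show "f (sc c x) = c * f x" if "x \<in> X" for x c
    proof (rule f_eqI)
      have "sc c x - p (sc c x) = sc c (x - p x)"
        using p_sc[OF that] by (simp add: scale_right_diff_distrib)
      then show "sc c x - p (sc c x) = sc (c * f x) e" using f[OF that] by simp
    qed (use plus_X that in blast)
    show "f e = 1"
    proof (rule f_eqI[OF e(1)])
      have "S 0 = 0" using S_lin(2)[of 0 0] subspace_0[OF ER(2)] by simp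
      then show "e - p e = sc 1 e" using T_E[OF eE] by (simp add: p_def)
    qed
    show "f (V x) = 0" if "x \<in> X" for x
      by (rule f_eqI) (use V_R[OF that] RX p_id in auto)
    show "A (V x) - V x = x - sc (f x) e" if "x \<in> X" for x
      using AS[OF p_R[OF that]] f[OF that] by (simp add: V_def algebra_simps)
  qed (use V_bound f_bound in auto)
qed

section \<open>Perturbation of a simple eigenvalue\<close>

text \<open>
  An eigenvector of \<open>Q\<close> normalized by \<open>f = 1\<close> is \<open>e + r\<close> with \<open>r = V (\<mu> r - (Q - A) (e + r))\<close> and
  \<open>\<mu> = f ((Q - A) (e + r))\<close>: this is the eigenvector equation after inverting \<open>A - 1\<close> on the
  complement. The right-hand side is a contraction of the unit ball when \<open>Q\<close> is close to \<open>A\<close>.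
\<close>

lemma eigenvalue_perturbation:
  fixes sc :: "complex \<Rightarrow> 'b::banach \<Rightarrow> 'b" and A :: "'b \<Rightarrow>\<^sub>L 'b"
  assumes sc: "complex_banach sc" and e: "A e = e"
    and V_add: "\<And>x y. V (x + y) = V x + V y" and V_bound: "\<And>x. norm (V x) \<le> C * norm x"
    and f_add: "\<And>x y. f (x + y) = f x + f y" and f_scale: "\<And>c x. f (sc c x) = c * f x"
    and f_bound: "\<And>x. cmod (f x) \<le> C * norm x"
    and fe: "f e = 1" and fV: "\<And>x. f (V x) = 0"
    and AV: "\<And>x. A (V x) - V x = x - sc (f x) e"
    and \<epsilon>: "\<epsilon> > 0"
  obtains \<delta> where "\<delta> > 0"
    "\<And>Q :: 'b \<Rightarrow>\<^sub>L 'b. norm (Q - A) < \<delta> \<Longrightarrow> \<exists>z u. u \<noteq> 0 \<and> Q u = sc z u \<and> cmod (z - 1) < \<epsilon>"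
proof -
  interpret vector_space sc using sc by (simp add: complex_banach_def)
  have norm_sc: "norm (sc a x) = cmod a * norm x" for a x
    using sc by (simp add: complex_banach_def)
  have V_diff: "V (x - y) = V x - V y" for x y using V_add[of "x - y" y] by simp
  have f_diff: "f (x - y) = f x - f y" for x y using f_add[of "x - y" y] by simp
  \<comment> \<open>On the unit ball \<open>\<Phi>\<close> below takes values of norm at most \<open>4 K\<^sup>3 d\<close> and has Lipschitz constant at
    most \<open>4 K\<^sup>3 d\<close>, and \<open>\<bar>\<mu>\<bar> \<le> 2 K\<^sup>2 d\<close>, where \<open>d\<close> is the norm of \<open>Q - A\<close>; this dictates \<open>\<delta>\<close>.\<close>
  define K where "K = 1 + \<bar>C\<bar> + norm e"
  have K: "K \<ge> 1" "norm e \<le> K" "C \<le> K"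
    unfolding K_def using abs_ge_self[of C] norm_ge_zero[of e] by linarith+
  have VK: "norm (V x) \<le> K * norm x" for x
    using V_bound[of x] K(3) by (meson mult_right_mono norm_ge_zero order_trans)
  have fK: "cmod (f x) \<le> K * norm x" for x
    using f_bound[of x] K(3) by (meson mult_right_mono norm_ge_zero order_trans)
  have K23: "1 \<le> K^2" "K \<le> K^2" "K^2 \<le> K^3" "K \<le> K^3" using K(1)
    by (auto simp: one_le_power self_le_power power_increasing)
  define \<delta> where "\<delta> = min (1 / (8 * K^3)) (\<epsilon> / (2 * K^2))"
  have "\<delta> > 0" using K \<epsilon> by (simp add: \<delta>_def)
  moreover have "\<exists>z u. u \<noteq> 0 \<and> Q u = sc z u \<and> cmod (z - 1) < \<epsilon>" if Q: "norm (Q - A) < \<delta>"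
    for Q :: "'b \<Rightarrow>\<^sub>L 'b"
  proof -
    define G where "G = Q - A"
    define d where "d = norm G"
    have d: "d \<ge> 0" "8 * K^3 * d \<le> 1" "2 * K^2 * d < \<epsilon>"
    proof -
      show "d \<ge> 0" by (simp add: d_def)
      have "d < 1 / (8 * K^3)" "d < \<epsilon> / (2 * K^2)" using Q by (auto simp: d_def G_def \<delta>_def)
      then show "8 * K^3 * d \<le> 1" "2 * K^2 * d < \<epsilon>" using K by (auto simp: field_simps)
    qed
    have GK: "norm (G x) \<le> d * norm x" for x unfolding d_def by (rule norm_blinfun)
    define \<mu> where "\<mu> r = f (G (e + r))" for r
    define \<Phi> where "\<Phi> r = V (sc (\<mu> r) r - G (e + r))" for r
    have G1: "norm (G (e + r)) \<le> 2 * K * d" if "norm r \<le> 1" for r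
    proof -
      have "norm (e + r) \<le> 2 * K" using norm_triangle_ineq[of e r] K that by linarith
      then have "d * norm (e + r) \<le> d * (2 * K)" using d by (intro mult_left_mono)
      then show ?thesis using GK[of "e + r"] by (simp add: mult_ac)
    qed
    have \<mu>1: "cmod (\<mu> r) \<le> 2 * K^2 * d" if "norm r \<le> 1" for r
    proof -
      have "cmod (\<mu> r) \<le> K * (2 * K * d)"
        unfolding \<mu>_def using fK G1[OF that] K by (meson mult_left_mono order_trans zero_le_one)
      then show ?thesis by (simp add: power2_eq_square mult_ac)
    qed
    have "\<exists>!r. r \<in> cball 0 1 \<and> \<Phi> r = r"
    proof (rule Banach_fix[of _ "1/2"])
      show "\<Phi> ` cball 0 1 \<subseteq> cball 0 1"
      proof (clarsimp)
        fix r :: 'b assume r: "norm r \<le> 1"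
        have "norm (sc (\<mu> r) r - G (e + r)) \<le> cmod (\<mu> r) * norm r + norm (G (e + r))"
          using norm_triangle_ineq4[of "sc (\<mu> r) r" "G (e + r)"] by (simp add: norm_sc)
        also have "\<dots> \<le> 2 * K^2 * d * 1 + 2 * K * d"
          using \<mu>1[OF r] G1[OF r] r d by (intro add_mono mult_mono) auto
        also have "\<dots> \<le> 4 * K^2 * d"
          using mult_right_mono[OF K23(2) d(1)] by (simp add: mult.commute)
        finally have "norm (\<Phi> r) \<le> K * (4 * K^2 * d)"
          unfolding \<Phi>_def using VK K by (meson mult_left_mono order_trans zero_le_one)
        also have "\<dots> = 4 * K^3 * d" by (simp add: power2_eq_square power3_eq_cube)
        finally show "norm (\<Phi> r) \<le> 1" using d by simp
      qed
      show "dist (\<Phi> r) (\<Phi> s) \<le> 1/2 * dist r s" if "r \<in> cball 0 1" "s \<in> cball 0 1" for r s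
      proof -
        have rs: "norm r \<le> 1" "norm s \<le> 1" using that by auto
        have G_diff: "G (e + r) - G (e + s) = G (r - s)" by (simp add: blinfun.add_right blinfun.diff_right)
        have \<mu>_diff: "\<mu> r - \<mu> s = f (G (r - s))"
          unfolding \<mu>_def f_diff[symmetric] G_diff ..
        have "(sc (\<mu> r) r - G (e + r)) - (sc (\<mu> s) s - G (e + s))
            = sc (\<mu> r) (r - s) + sc (\<mu> r - \<mu> s) s - (G (e + r) - G (e + s))"
          by (simp add: scale_right_diff_distrib scale_left_diff_distrib)
        then have eq: "\<Phi> r - \<Phi> s = V (sc (\<mu> r) (r - s) + sc (f (G (r - s))) s - G (r - s))"
          unfolding \<Phi>_def V_diff[symmetric] G_diff \<mu>_diff by simp
        have "norm (sc (\<mu> r) (r - s) + sc (f (G (r - s))) s - G (r - s))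
            \<le> cmod (\<mu> r) * norm (r - s) + cmod (f (G (r - s))) * norm s + norm (G (r - s))"
          using norm_triangle_ineq4[of "sc (\<mu> r) (r - s) + sc (f (G (r - s))) s" "G (r - s)"]
            norm_triangle_ineq[of "sc (\<mu> r) (r - s)" "sc (f (G (r - s))) s"]
          by (simp add: norm_sc)
        also have "\<dots> \<le> (2 * K^2 * d) * norm (r - s) + (K * (d * norm (r - s))) * 1 + d * norm (r - s)"
        proof (intro add_mono mult_mono)
          show "cmod (f (G (r - s))) \<le> K * (d * norm (r - s))"
            using fK GK K by (meson mult_left_mono order_trans zero_le_one)
        qed (use \<mu>1 rs GK d K in auto)
        also have "\<dots> = (2 * K^2 + K + 1) * (d * norm (r - s))" by (simp add: algebra_simps)
        also have "\<dots> \<le> (4 * K^2) * (d * norm (r - s))"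
          using K23 d by (intro mult_right_mono) auto
        finally have "norm (\<Phi> r - \<Phi> s) \<le> K * ((4 * K^2) * (d * norm (r - s)))"
          unfolding eq using VK K by (meson mult_left_mono order_trans zero_le_one)
        also have "\<dots> = (4 * K^3 * d) * norm (r - s)" by (simp add: power2_eq_square power3_eq_cube)
        also have "\<dots> \<le> (1/2) * norm (r - s)"
          using d by (intro mult_right_mono) auto
        finally show ?thesis by (simp add: dist_norm)
      qed
    qed (simp_all add: complete_eq_closed)
    then obtain r where r: "norm r \<le> 1" "\<Phi> r = r" by auto
    define u where "u = e + r"
    have fr: "f r = 0" using fV r(2) unfolding \<Phi>_def by metis
    have "f 0 = 0" using f_add[of 0 0] by simp
    then have "u \<noteq> 0" using f_add[of e r] fe fr by (auto simp: u_def)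
    have "f (sc (\<mu> r) r - G u) = - \<mu> r"
      by (simp add: f_diff f_scale fr \<mu>_def u_def)
    then have "A r - r = (sc (\<mu> r) r - G u) - sc (- \<mu> r) e"
      using AV[of "sc (\<mu> r) r - G u"] r(2) by (simp add: \<Phi>_def u_def)
    moreover have "Q u = A u + G u" by (simp add: G_def blinfun.diff_left)
    moreover have "A u = e + A r" by (simp add: u_def blinfun.add_right e)
    ultimately have "Q u = sc (1 + \<mu> r) u"
      by (simp add: u_def scale_left_distrib scale_right_distrib algebra_simps)
    then show ?thesis
      using \<open>u \<noteq> 0\<close> \<mu>1[OF r(1)] d(3) by (intro exI[of _ "1 + \<mu> r"] exI[of _ u]) auto
  qed
  ultimately show ?thesis using that by blast
qed

section \<open>Analytic families are continuous\<close>

text \<open>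
  The terms of an expansion that converges at some \<open>(a, a)\<close> with \<open>a > 0\<close> are bounded there, so at
  smaller arguments the expansion is dominated by a geometric series.
\<close>

lemma real_analytic2_continuous_at_0:
  fixes f :: "real \<times> real \<Rightarrow> 'a::banach"
  assumes f: "real_analytic2 f" and \<epsilon>: "\<epsilon> > 0"
  obtains \<delta> where "\<delta> > 0" "\<And>s t. \<bar>s\<bar> < \<delta> \<Longrightarrow> \<bar>t\<bar> < \<delta> \<Longrightarrow> norm (f (s, t) - f (0, 0)) < \<epsilon>"
proof -
  obtain r A where r: "r > 0" and A: "\<And>s t. \<bar>s\<bar> < r \<Longrightarrow> \<bar>t\<bar> < r \<Longrightarrow>
     ((\<lambda>(i, j). (s ^ i * t ^ j) *\<^sub>R A (i, j)) has_sum f (s, t)) UNIV"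
    using f[unfolded real_analytic2_def, rule_format, of "(0, 0)"] by auto
  define a where "a = r / 2"
  have a: "a > 0" "\<bar>a\<bar> < r" using r by (auto simp: a_def)
  define g where "g = (\<lambda>(i, j). (a ^ i * a ^ j) *\<^sub>R A (i, j))"
  obtain C where C: "C > 0" "\<And>x. norm (g x) \<le> C"
  proof -
    have "(sum g \<longlongrightarrow> f (a, a)) (finite_subsets_at_top UNIV)"
      using A[OF a(2) a(2)] by (simp add: has_sum_def g_def)
    then have "\<forall>\<^sub>F F in finite_subsets_at_top UNIV. dist (sum g F) (f (a, a)) < 1"
      by (rule tendstoD) simp
    then obtain F0 where F0: "finite F0" "\<And>F. finite F \<Longrightarrow> F0 \<subseteq> F \<Longrightarrow> dist (sum g F) (f (a, a)) < 1"
      unfolding eventually_finite_subsets_at_top by auto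
    have "norm (g x) \<le> 2 + (\<Sum>x\<in>F0. norm (g x))" for x
    proof (cases "x \<in> F0")
      case True
      then have "norm (g x) \<le> (\<Sum>x\<in>F0. norm (g x))"
        using F0(1) by (intro member_le_sum) auto
      then show ?thesis by simp
    next
      case False
      have "dist (sum g (insert x F0)) (f (a, a)) < 1" "dist (sum g F0) (f (a, a)) < 1"
        using F0 by auto
      then have "dist (sum g (insert x F0)) (sum g F0) < 2"
        using dist_triangle2[of "sum g (insert x F0)" "sum g F0" "f (a, a)"] by linarith
      then have "norm (g x) < 2" using False F0(1) by (simp add: dist_norm)
      moreover have "(\<Sum>x\<in>F0. norm (g x)) \<ge> 0" by (rule sum_nonneg) simp
      ultimately show ?thesis by linarith
    qed
    moreover have "2 + (\<Sum>x\<in>F0. norm (g x)) > 0"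
      using sum_nonneg[of F0 "\<lambda>x. norm (g x)"] by simp
    ultimately show ?thesis using that by blast
  qed
  have bound: "norm (f (s, t) - A (0, 0)) \<le> 8 * C * \<eta>"
    if \<eta>: "0 < \<eta>" "\<eta> \<le> 1 / 2" and st: "\<bar>s\<bar> \<le> \<eta> * a" "\<bar>t\<bar> \<le> \<eta> * a" for s t \<eta>
  proof -
    define h where "h = (\<lambda>(i, j). (s ^ i * t ^ j) *\<^sub>R A (i, j))"
    have small: "\<bar>s\<bar> < r" "\<bar>t\<bar> < r"
    proof -
      have "\<eta> * a \<le> 1 / 2 * a" using \<eta> a by (intro mult_right_mono) auto
      then show "\<bar>s\<bar> < r" "\<bar>t\<bar> < r" using st a by linarith+
    qed
    \<comment> \<open>Any term but the constant one has a factor \<open>\<eta>\<close> to spare, which makes the whole tail small.\<close>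
    have coeff: "norm (h (i, j)) \<le> C * (2 * \<eta>) * ((1/2) ^ i * (1/2) ^ j)" if ij: "(i, j) \<noteq> (0, 0)" for i j
    proof -
      have "\<bar>s\<bar> ^ i \<le> (\<eta> * a) ^ i" "\<bar>t\<bar> ^ j \<le> (\<eta> * a) ^ j"
        using st by (auto intro: power_mono)
      then have "\<bar>s\<bar> ^ i * \<bar>t\<bar> ^ j \<le> (\<eta> * a) ^ i * (\<eta> * a) ^ j"
        using \<eta> a by (intro mult_mono) auto
      then have "norm (h (i, j)) \<le> (\<eta> * a) ^ i * (\<eta> * a) ^ j * norm (A (i, j))"
        by (simp add: h_def abs_mult power_abs mult_right_mono)
      also have "\<dots> = \<eta> ^ (i + j) * norm (g (i, j))"
        using a by (simp add: g_def power_mult_distrib power_add abs_mult power_abs mult_ac)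
      also have "\<dots> \<le> \<eta> ^ (i + j) * C"
        using C \<eta> by (intro mult_left_mono) auto
      also have "\<eta> ^ (i + j) \<le> 2 * \<eta> * (1/2) ^ (i + j)"
      proof -
        obtain n where n: "i + j = Suc n" using ij by (cases "i + j") auto
        have "\<eta> ^ n \<le> (1/2) ^ n" using \<eta> by (intro power_mono) auto
        then show ?thesis using \<eta> by (simp add: n)
      qed
      finally show ?thesis using C by (simp add: power_add mult_ac)
    qed
    have "((\<lambda>F. norm (sum h F - A (0, 0))) \<longlongrightarrow> norm (f (s, t) - A (0, 0))) (finite_subsets_at_top UNIV)"
      using A[OF small] by (intro tendsto_intros) (simp add: has_sum_def h_def)
    moreover have "\<forall>\<^sub>F F in finite_subsets_at_top UNIV. norm (sum h F - A (0, 0)) \<le> 8 * C * \<eta>"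
      unfolding eventually_finite_subsets_at_top
    proof (intro exI[of _ "{(0, 0)}"] conjI allI impI)
      fix F :: "(nat \<times> nat) set" assume "finite F \<and> {(0, 0)} \<subseteq> F \<and> F \<subseteq> UNIV"
      then have F: "finite F" "(0, 0) \<in> F" by auto
      define n where "n = Max (insert 0 (fst ` F \<union> snd ` F))"
      have Fn: "F - {(0, 0)} \<subseteq> {..n} \<times> {..n}"
      proof
        fix x assume x: "x \<in> F - {(0, 0)}"
        then have "fst x \<le> n" "snd x \<le> n" using F(1) unfolding n_def by (auto intro!: Max_ge)
        then show "x \<in> {..n} \<times> {..n}" by (cases x) auto
      qed
      have geo: "(\<Sum>i\<le>n. (1/2) ^ i) \<le> (2 :: real)" by (simp add: sum_gp0)
      have "sum h F - A (0, 0) = sum h (F - {(0, 0)})"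
        using F by (subst sum.remove[OF F]) (simp add: h_def)
      then have "norm (sum h F - A (0, 0)) \<le> (\<Sum>x\<in>F - {(0, 0)}. norm (h x))"
        by (simp add: norm_sum)
      also have "\<dots> \<le> (\<Sum>(i, j)\<in>F - {(0, 0)}. C * (2 * \<eta>) * ((1/2) ^ i * (1/2) ^ j))"
      proof (rule sum_mono)
        fix x assume "x \<in> F - {(0, 0)}"
        then show "norm (h x) \<le> (case x of (i, j) \<Rightarrow> C * (2 * \<eta>) * ((1/2) ^ i * (1/2) ^ j))"
          using coeff[of "fst x" "snd x"] by (cases x) simp
      qed
      also have "\<dots> \<le> (\<Sum>(i, j)\<in>{..n} \<times> {..n}. C * (2 * \<eta>) * ((1/2) ^ i * (1/2) ^ j))"
        using Fn C \<eta> by (intro sum_mono2) auto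
      also have "\<dots> = C * (2 * \<eta>) * ((\<Sum>i\<le>n. (1/2) ^ i) * (\<Sum>j\<le>n. (1/2) ^ j))"
        by (subst sum_product) (simp only: sum_distrib_left sum.cartesian_product case_prod_unfold)
      also have "\<dots> \<le> C * (2 * \<eta>) * (2 * 2)"
        using C \<eta> geo by (intro mult_left_mono mult_mono) (auto intro: sum_nonneg)
      finally show "norm (sum h F - A (0, 0)) \<le> 8 * C * \<eta>" by simp
    qed auto
    ultimately show ?thesis by (rule tendsto_upperbound) simp
  qed
  define \<eta> where "\<eta> = min (1 / 2) (\<epsilon> / (32 * C))"
  have \<eta>: "0 < \<eta>" "\<eta> \<le> 1 / 2" using \<epsilon> C by (auto simp: \<eta>_def)
  have "8 * C * \<eta> \<le> 8 * C * (\<epsilon> / (32 * C))"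
    using C by (intro mult_left_mono) (auto simp: \<eta>_def)
  then have small: "8 * C * \<eta> \<le> \<epsilon> / 4" using C by simp
  show ?thesis
  proof (rule that[of "\<eta> * a"])
    show "\<eta> * a > 0" using \<eta> a by simp
    fix s t assume st: "\<bar>s\<bar> < \<eta> * a" "\<bar>t\<bar> < \<eta> * a"
    have "norm (f (s, t) - A (0, 0)) \<le> \<epsilon> / 4" "norm (f (0, 0) - A (0, 0)) \<le> \<epsilon> / 4"
      using bound[OF \<eta>, of s t] bound[OF \<eta>, of 0 0] st small \<eta> a by auto
    then have "norm ((f (s, t) - A (0, 0)) - (f (0, 0) - A (0, 0))) \<le> \<epsilon> / 4 + \<epsilon> / 4"
      using norm_triangle_ineq4 order_trans add_mono by meson
    then show "norm (f (s, t) - f (0, 0)) < \<epsilon>" using \<epsilon> by simp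
  qed
qed

section \<open>Small characters of a finite quotient of the plane lattice\<close>

definition vdot :: "real \<times> real \<Rightarrow> int \<times> int \<Rightarrow> real" where
  "vdot w p = fst w * of_int (fst p) + snd w * of_int (snd p)"

definition lattice_coset :: "(int \<times> int) set \<Rightarrow> int \<times> int \<Rightarrow> coset" where
  "lattice_coset \<Lambda> p = {p'. p' - p \<in> \<Lambda>}"

text \<open>
  The dual lattice in the normalization in which \<open>p \<mapsto> cis (vdot w p)\<close> is the character of \<open>w\<close>.
\<close>

definition dual_vec :: "(int \<times> int) set \<Rightarrow> real \<times> real \<Rightarrow> bool" where
  "dual_vec \<Lambda> w \<longleftrightarrow> (\<forall>p\<in>\<Lambda>. cis (vdot w p) = 1)"

lemma vdot_add: "vdot w (p + q) = vdot w p + vdot w q"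
  by (simp add: vdot_def algebra_simps)

lemma vdot_diff: "vdot w (p - q) = vdot w p - vdot w q"
  by (simp add: vdot_def algebra_simps)

lemma cis_int_period: "cis (2 * pi * of_int n) = 1"
  by (simp add: complex_eq_iff)

text \<open>Hermite normal form of a basis of the lattice.\<close>

lemma rank2_lattice_hermite:
  assumes "rank2_lattice \<Lambda>"
  obtains a b d :: int where "a > 0" "d > 0" "\<Lambda> = {(m * a, m * b + n * d) | m n. True}"
proof -
  obtain a b c d where det: "a * d - b * c \<noteq> 0"
    and L: "\<Lambda> = {(m * a + n * c, m * b + n * d) | m n. True}"
    using assms unfolding rank2_lattice_def by blast
  define g where "g = gcd a c"
  have g: "g > 0" using det by (auto simp: g_def)
  obtain x y where xy: "x * a + y * c = g" using bezout_int unfolding g_def by blast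
  obtain a' c' where a': "a = g * a'" and c': "c = g * c'"
    unfolding g_def by (meson dvdE gcd_dvd1 gcd_dvd2)
  have "g * (x * a' + y * c') = g * 1" using xy a' c' by (simp add: algebra_simps)
  then have uni: "x * a' + y * c' = 1" using g by (metis mult_cancel_left less_irrefl)
  define b1 where "b1 = x * b + y * d"
  define e where "e = a' * d - c' * b"
  have "g * e = a * d - b * c" by (simp add: e_def a' c' algebra_simps)
  then have e: "e \<noteq> 0" using det by auto
  have sub1: "\<exists>m' n'. m * a + n * c = m' * g \<and> m * b + n * d = m' * b1 + n' * e" for m n
  proof (rule exI[of _ "m * a' + n * c'"], rule exI[of _ "n * x - m * y"], intro conjI)
    show "m * a + n * c = (m * a' + n * c') * g" by (simp add: a' c' algebra_simps)
    have "(m * a' + n * c') * b1 + (n * x - m * y) * e = (m * b + n * d) * (x * a' + y * c')"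
      by (simp add: b1_def e_def algebra_simps)
    then show "m * b + n * d = (m * a' + n * c') * b1 + (n * x - m * y) * e" by (simp add: uni)
  qed
  have sub2: "\<exists>m n. m * a + n * c = m' * g \<and> m * b + n * d = m' * b1 + n' * e" for m' n'
  proof (rule exI[of _ "m' * x - n' * c'"], rule exI[of _ "m' * y + n' * a'"], intro conjI)
    have "(m' * x - n' * c') * a + (m' * y + n' * a') * c = m' * (x * a + y * c) + n' * (a' * c - c' * a)"
      by (simp add: algebra_simps)
    also have "a' * c - c' * a = 0" by (simp add: a' c')
    finally show "(m' * x - n' * c') * a + (m' * y + n' * a') * c = m' * g" by (simp add: xy)
    show "(m' * x - n' * c') * b + (m' * y + n' * a') * d = m' * b1 + n' * e"
      by (simp add: b1_def e_def algebra_simps)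
  qed
  have L': "\<Lambda> = {(m * g, m * b1 + n * e) | m n. True}"
    unfolding L
  proof (intro subset_antisym subsetI)
    fix p assume "p \<in> {(m * a + n * c, m * b + n * d) | m n. True}"
    then obtain m n where p: "p = (m * a + n * c, m * b + n * d)" by blast
    obtain m' n' where "m * a + n * c = m' * g" "m * b + n * d = m' * b1 + n' * e" using sub1 by blast
    then have "p = (m' * g, m' * b1 + n' * e)" using p by simp
    then show "p \<in> {(m * g, m * b1 + n * e) | m n. True}" by blast
  next
    fix p assume "p \<in> {(m * g, m * b1 + n * e) | m n. True}"
    then obtain m n where p: "p = (m * g, m * b1 + n * e)" by blast
    obtain m' n' where "m' * a + n' * c = m * g" "m' * b + n' * d = m * b1 + n * e" using sub2 by blast
    then have "p = (m' * a + n' * c, m' * b + n' * d)" using p by simp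
    then show "p \<in> {(m * a + n * c, m * b + n * d) | m n. True}" by blast
  qed
  have "\<Lambda> = {(m * g, m * b1 + n * \<bar>e\<bar>) | m n. True}"
  proof (cases "e > 0")
    case False
    have 1: "n * e = (- n) * \<bar>e\<bar>" "n * \<bar>e\<bar> = (- n) * e" for n
      using False by simp_all
    show ?thesis
      unfolding L'
    proof (intro subset_antisym subsetI)
      fix p assume "p \<in> {(m * g, m * b1 + n * e) | m n. True}"
      then obtain m n where "p = (m * g, m * b1 + n * e)" by blast
      then have "p = (m * g, m * b1 + (- n) * \<bar>e\<bar>)" using 1(1) by simp
      then show "p \<in> {(m * g, m * b1 + n * \<bar>e\<bar>) | m n. True}" by blast
    next
      fix p assume "p \<in> {(m * g, m * b1 + n * \<bar>e\<bar>) | m n. True}"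
      then obtain m n where "p = (m * g, m * b1 + n * \<bar>e\<bar>)" by blast
      then have "p = (m * g, m * b1 + (- n) * e)" using 1(2) by simp
      then show "p \<in> {(m * g, m * b1 + n * e) | m n. True}" by blast
    qed
  qed (use L' in simp)
  then show ?thesis using that[of g "\<bar>e\<bar>" b1] g e by simp
qed

lemma rank2_lattice_subgroup:
  assumes "rank2_lattice \<Lambda>"
  shows "0 \<in> \<Lambda>" "p \<in> \<Lambda> \<Longrightarrow> q \<in> \<Lambda> \<Longrightarrow> p - q \<in> \<Lambda>" "p \<in> \<Lambda> \<Longrightarrow> q \<in> \<Lambda> \<Longrightarrow> p + q \<in> \<Lambda>"
proof -
  obtain a b c d where L: "\<Lambda> = {(m * a + n * c, m * b + n * d) | m n. True}"
    using assms unfolding rank2_lattice_def by blast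
  have "0 = (0 * a + 0 * c, 0 * b + 0 * d)" by (simp add: zero_prod_def)
  then show "0 \<in> \<Lambda>" unfolding L by blast
  show "p - q \<in> \<Lambda>" if pq: "p \<in> \<Lambda>" "q \<in> \<Lambda>"
  proof -
    obtain m n m' n' where "p = (m * a + n * c, m * b + n * d)" "q = (m' * a + n' * c, m' * b + n' * d)"
      using pq unfolding L by blast
    then have "p - q = ((m - m') * a + (n - n') * c, (m - m') * b + (n - n') * d)"
      by (simp add: algebra_simps)
    then show ?thesis unfolding L by blast
  qed
  show "p + q \<in> \<Lambda>" if pq: "p \<in> \<Lambda>" "q \<in> \<Lambda>"
  proof -
    obtain m n m' n' where "p = (m * a + n * c, m * b + n * d)" "q = (m' * a + n' * c, m' * b + n' * d)"
      using pq unfolding L by blast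
    then have "p + q = ((m + m') * a + (n + n') * c, (m + m') * b + (n + n') * d)"
      by (simp add: algebra_simps)
    then show ?thesis unfolding L by blast
  qed
qed

lemma quot_eq: "quot \<Lambda> = range (lattice_coset \<Lambda>)"
  by (auto simp: quot_def quotient_def lattice_coset_def)

lemma coset_eqI:
  assumes "rank2_lattice \<Lambda>" "p - q \<in> \<Lambda>"
  shows "lattice_coset \<Lambda> p = lattice_coset \<Lambda> q"
proof -
  note sg = rank2_lattice_subgroup[OF assms(1)]
  have "r - p \<in> \<Lambda> \<longleftrightarrow> r - q \<in> \<Lambda>" for r
    using sg(3)[OF assms(2), of "r - p"] sg(2)[OF _ assms(2), of "r - q"] by auto
  then show ?thesis by (auto simp: lattice_coset_def)
qed

lemma coset_translate: "(\<lambda>q. q + s) ` lattice_coset \<Lambda> p = lattice_coset \<Lambda> (p + s)"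
proof -
  have "q \<in> (\<lambda>q. q + s) ` A \<longleftrightarrow> q - s \<in> A" for q :: "int \<times> int" and A
    by (force simp: image_iff)
  then show ?thesis by (auto simp: lattice_coset_def algebra_simps)
qed

lemma finite_quot:
  assumes "rank2_lattice \<Lambda>" "a > 0" "d > 0" "\<Lambda> = {(m * a, m * b + n * d) | m n. True}"
  shows "finite (quot \<Lambda>)" "card (quot \<Lambda>) \<le> nat a * nat d"
proof -
  define S where "S = {0..<a} \<times> {0..<d}"
  have "quot \<Lambda> \<subseteq> lattice_coset \<Lambda> ` S"
    unfolding quot_eq
  proof (rule image_subsetI)
    fix p :: "int \<times> int"
    define k where "k = fst p div a"
    define y where "y = snd p - k * b"
    define q where "q = (fst p mod a, y mod d)"
    have "p - q = (k * a, k * b + (y div d) * d)"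
      by (simp add: q_def y_def k_def prod_eq_iff minus_mod_eq_div_mult minus_mod_eq_div_mult[symmetric] algebra_simps)
    then have "p - q \<in> \<Lambda>" unfolding assms(4) by blast
    then have "lattice_coset \<Lambda> p = lattice_coset \<Lambda> q" by (rule coset_eqI[OF assms(1)])
    moreover have "q \<in> S" using assms(2,3) by (simp add: q_def S_def)
    ultimately show "lattice_coset \<Lambda> p \<in> lattice_coset \<Lambda> ` S" by blast
  qed
  moreover have "finite S" "card S = nat a * nat d" by (simp_all add: S_def card_cartesian_product)
  ultimately show "finite (quot \<Lambda>)" "card (quot \<Lambda>) \<le> nat a * nat d"
    using finite_surj[of S] card_image_le[of S "lattice_coset \<Lambda>"] card_mono[of "lattice_coset \<Lambda> ` S" "quot \<Lambda>"]
    by auto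
qed

lemma quot_finite: "rank2_lattice \<Lambda> \<Longrightarrow> finite (quot \<Lambda>)"
  by (rule rank2_lattice_hermite) (auto intro: finite_quot(1))

text \<open>
  The vectors dual to a Hermite basis give \<open>a d\<close> characters modulo \<open>2 \<pi>\<close>, which is at least the
  order of the quotient.
\<close>

lemma many_dual_vectors:
  assumes "rank2_lattice \<Lambda>"
  obtains W where "finite W" "card (quot \<Lambda>) \<le> card W" "\<And>w. w \<in> W \<Longrightarrow> dual_vec \<Lambda> (2 * pi * fst w, 2 * pi * snd w)"
    "\<And>w w'. w \<in> W \<Longrightarrow> w' \<in> W \<Longrightarrow> fst w - fst w' \<in> \<int> \<Longrightarrow> snd w - snd w' \<in> \<int> \<Longrightarrow> w = w'"
proof -
  obtain a b d where ad: "a > 0" "d > 0" and L: "\<Lambda> = {(m * a, m * b + n * d) | m n. True}"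
    by (rule rank2_lattice_hermite[OF assms])
  define w :: "int \<times> int \<Rightarrow> real \<times> real" where
    "w = (\<lambda>(m, n). ((of_int m - of_int n * of_int b / of_int d) / of_int a, of_int n / of_int d))"
  define S where "S = {0..<a} \<times> {0..<d}"
  have aux: "m = m'" if frac: "(of_int m - of_int m') / of_int k \<in> (\<int> :: real set)" "m \<in> {0..<k}" "m' \<in> {0..<k}" "k > 0"
    for m m' k :: int
  proof -
    obtain j :: int where "(of_int m - of_int m') / of_int k = (of_int j :: real)" using frac by (auto elim: Ints_cases)
    then have "(of_int (m - m') :: real) = of_int (j * k)" using that(4) by (simp add: field_simps)
    then have jk: "m - m' = j * k" by linarith
    have "\<bar>m - m'\<bar> < k" using that by auto
    then have "\<bar>j\<bar> * k < 1 * k" using jk that(4) by (simp add: abs_mult)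
    then have "j = 0" using that(4) by (simp add: mult_less_cancel_right)
    then show ?thesis using jk by simp
  qed
  have inj: "x = x'" if x: "x \<in> S" "x' \<in> S" and Z: "fst (w x) - fst (w x') \<in> \<int>" "snd (w x) - snd (w x') \<in> \<int>" for x x'
  proof -
    obtain m n m' n' where mn: "x = (m, n)" "x' = (m', n')" by (cases x, cases x')
    have "n = n'" using aux[of n n' d] Z(2) x ad by (simp add: mn w_def S_def diff_divide_distrib)
    moreover from this have "m = m'" using aux[of m m' a] Z(1) x ad by (simp add: mn w_def S_def flip: diff_divide_distrib)
    ultimately show ?thesis by (simp add: mn)
  qed
  show ?thesis
  proof (rule that[of "w ` S"])
    show "finite (w ` S)" by (simp add: S_def)
    have "inj_on w S" by (rule inj_onI) (use inj in auto)
    then have "card (w ` S) = nat a * nat d" by (simp add: card_image S_def card_cartesian_product)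
    then show "card (quot \<Lambda>) \<le> card (w ` S)" using finite_quot(2)[OF assms ad L] by simp
    show "x = x'" if "x \<in> w ` S" "x' \<in> w ` S" "fst x - fst x' \<in> \<int>" "snd x - snd x' \<in> \<int>" for x x'
      using that inj by blast
    show "dual_vec \<Lambda> (2 * pi * fst x, 2 * pi * snd x)" if xS: "x \<in> w ` S" for x
      unfolding dual_vec_def
    proof
      fix p assume "p \<in> \<Lambda>"
      then obtain k l where p: "p = (k * a, k * b + l * d)" unfolding L by blast
      obtain m n where x: "x = w (m, n)" using xS by auto
      have "vdot (2 * pi * fst x, 2 * pi * snd x) p = 2 * pi * of_int (m * k + n * l)"
        using ad by (simp add: vdot_def x w_def p field_simps)
      then show "cis (vdot (2 * pi * fst x, 2 * pi * snd x) p) = 1" by (simp only: cis_int_period)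
    qed
  qed
qed

text \<open>
  A positive proportion of the characters is small: some box of a partition of the dual torus into
  \<open>N\<^sup>2\<close> boxes contains at least a proportion \<open>1 / N\<^sup>2\<close> of them, and their differences with one
  of them are small.
\<close>

lemma many_small_characters:
  assumes "\<delta> > 0"
  obtains c where "c > 0"
    "\<And>\<Lambda>. rank2_lattice \<Lambda> \<Longrightarrow> \<exists>V. finite V \<and> c * real (card (quot \<Lambda>)) \<le> real (card V) \<and>
       inj_on (\<lambda>v p. cis (- vdot v p)) V \<and>
       (\<forall>v\<in>V. \<bar>fst v\<bar> < \<delta> \<and> \<bar>snd v\<bar> < \<delta> \<and> dual_vec \<Lambda> v)"
proof -
  obtain N0 :: nat where N0: "real N0 > 2 * pi / \<delta>" using reals_Archimedean2 by blast
  \<comment> \<open>With \<open>N \<ge> 2\<close> the coordinates of all differences are below \<open>\<pi>\<close> in modulus, so that distinct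
    differences give distinct characters.\<close>
  define N where "N = max N0 2"
  have N: "N \<ge> 2" "2 * pi / \<delta> < real N" using N0 by (auto simp: N_def)
  then have N\<delta>: "2 * pi / real N < \<delta>" "2 * pi / real N \<le> pi"
    using assms by (auto simp: field_simps)
  have "\<exists>V. finite V \<and> 1 / (real N)^2 * real (card (quot \<Lambda>)) \<le> real (card V) \<and>
       inj_on (\<lambda>v p. cis (- vdot v p)) V \<and>
       (\<forall>v\<in>V. \<bar>fst v\<bar> < \<delta> \<and> \<bar>snd v\<bar> < \<delta> \<and> dual_vec \<Lambda> v)" if L: "rank2_lattice \<Lambda>" for \<Lambda>
  proof -
    obtain W where W: "finite W" "card (quot \<Lambda>) \<le> card W"
      "\<And>w. w \<in> W \<Longrightarrow> dual_vec \<Lambda> (2 * pi * fst w, 2 * pi * snd w)"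
      "\<And>w w'. w \<in> W \<Longrightarrow> w' \<in> W \<Longrightarrow> fst w - fst w' \<in> \<int> \<Longrightarrow> snd w - snd w' \<in> \<int> \<Longrightarrow> w = w'"
      by (rule many_dual_vectors[OF L]) (rule that)
    define cell where "cell w = (\<lfloor>real N * frac (fst w)\<rfloor>, \<lfloor>real N * frac (snd w)\<rfloor>)" for w :: "real \<times> real"
    define cells where "cells = {0..<int N} \<times> {0..<int N}"
    have frac_cell: "\<lfloor>real N * frac x\<rfloor> \<in> {0..<int N}" for x :: real
    proof -
      have "real N * frac x < real N * 1" using frac_lt_1[of x] N by (intro mult_strict_left_mono) auto
      moreover have "real N * frac x \<ge> 0" by (simp add: frac_ge_0)
      ultimately show ?thesis by (auto simp: floor_less_iff)
    qed
    then have "cell ` W \<subseteq> cells" by (auto simp: cell_def cells_def)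
    define fib where "fib x = {w \<in> W. cell w = x}" for x
    have "W = (\<Union>x\<in>cells. fib x)" using \<open>cell ` W \<subseteq> cells\<close> by (auto simp: fib_def)
    then have "card W \<le> (\<Sum>x\<in>cells. card (fib x))"
      by (metis card_UN_le cells_def finite_SigmaI finite_atLeastLessThan_int)
    moreover obtain x where x: "(\<Sum>x\<in>cells. card (fib x)) \<le> N * N * card (fib x)"
    proof -
      have ne: "finite cells" "cells \<noteq> {}" using N by (auto simp: cells_def)
      obtain x where "x \<in> cells" "\<And>y. y \<in> cells \<Longrightarrow> card (fib y) \<le> card (fib x)"
      proof -
        have "Max ((\<lambda>x. card (fib x)) ` cells) \<in> (\<lambda>x. card (fib x)) ` cells"
          using ne by (intro Max_in) auto
        then obtain x where "x \<in> cells" "Max ((\<lambda>x. card (fib x)) ` cells) = card (fib x)" by blast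
        moreover from this have "card (fib y) \<le> card (fib x)" if "y \<in> cells" for y
          using Max_ge[of "(\<lambda>x. card (fib x)) ` cells" "card (fib y)"] ne that by simp
        ultimately show ?thesis using that by blast
      qed
      then have "(\<Sum>x\<in>cells. card (fib x)) \<le> card cells * card (fib x)"
        using sum_bounded_above[of cells "\<lambda>x. card (fib x)" "card (fib x)"] by simp
      then show ?thesis using that by (simp add: cells_def card_cartesian_product)
    qed
    ultimately have card: "card (quot \<Lambda>) \<le> N * N * card (fib x)" using W(2) by linarith
    have "real (card (quot \<Lambda>)) \<le> (real N)^2 * real (card (fib x))"
      using of_nat_mono[OF card, where 'a = real] by (simp add: power2_eq_square)
    then have card': "1 / (real N)^2 * real (card (quot \<Lambda>)) \<le> real (card (fib x))"
      using N by (simp add: field_simps)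
    show ?thesis
    proof (cases "fib x = {}")
      case True
      then show ?thesis using card' by (intro exI[of _ "{}"]) auto
    next
      case False
      then obtain w0 where w0: "w0 \<in> fib x" by blast
      \<comment> \<open>Using fractional parts replaces \<open>w - w0\<close> by its small representative modulo integers.\<close>
      define v where "v w = (2 * pi * (frac (fst w) - frac (fst w0)), 2 * pi * (frac (snd w) - frac (snd w0)))"
        for w :: "real \<times> real"
      have close: "\<bar>2 * pi * (frac s - frac t)\<bar> < 2 * pi / real N"
        if "\<lfloor>real N * frac s\<rfloor> = \<lfloor>real N * frac t\<rfloor>" for s t :: real
      proof -
        have "\<bar>real N * frac s - real N * frac t\<bar> < 1" using that by linarith
        then have "real N * \<bar>frac s - frac t\<bar> < 1" using N by (simp add: abs_mult flip: right_diff_distrib)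
        then have "\<bar>frac s - frac t\<bar> < 1 / real N" using N by (simp add: field_simps)
        then have "2 * pi * \<bar>frac s - frac t\<bar> < 2 * pi * (1 / real N)" by (intro mult_strict_left_mono) auto
        then show ?thesis by (simp add: abs_mult)
      qed
      have small: "\<bar>fst (v w)\<bar> < 2 * pi / real N" "\<bar>snd (v w)\<bar> < 2 * pi / real N" if "w \<in> fib x" for w
        using that w0 close[of "fst w" "fst w0"] close[of "snd w" "snd w0"]
        by (auto simp: v_def fib_def cell_def)
      have dual: "dual_vec \<Lambda> (v w)" if "w \<in> fib x" for w
        unfolding dual_vec_def
      proof
        fix p assume p: "p \<in> \<Lambda>"
        have 1: "cis (vdot (2 * pi * fst w, 2 * pi * snd w) p) = 1" "cis (vdot (2 * pi * fst w0, 2 * pi * snd w0) p) = 1"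
          using W(3) that w0 p by (auto simp: fib_def dual_vec_def)
        define j where "j = \<lfloor>fst w0\<rfloor> - \<lfloor>fst w\<rfloor>"
        define k where "k = \<lfloor>snd w0\<rfloor> - \<lfloor>snd w\<rfloor>"
        have "vdot (v w) p = vdot (2 * pi * fst w, 2 * pi * snd w) p - vdot (2 * pi * fst w0, 2 * pi * snd w0) p
          + 2 * pi * of_int (j * fst p + k * snd p)"
          by (simp add: vdot_def v_def frac_def j_def k_def algebra_simps)
        then show "cis (vdot (v w) p) = 1"
          by (simp only: cis_mult[symmetric] cis_divide[symmetric] 1 cis_int_period) simp
      qed
      have char_inj: "u = u'" if u: "u \<in> v ` fib x" "u' \<in> v ` fib x"
        and eq: "(\<lambda>p. cis (- vdot u p)) = (\<lambda>p. cis (- vdot u' p))" for u u'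
      proof -
        have aux: "s = t" if "cis (- s) = cis (- t)" "\<bar>s\<bar> < pi" "\<bar>t\<bar> < pi" for s t
        proof -
          have "sin s = sin t \<and> cos s = cos t" using that(1) by (simp add: complex_eq_iff)
          then obtain n :: int where n: "s = t + 2 * pi * n" unfolding sin_cos_eq_iff by blast
          then have "\<bar>2 * pi * of_int n\<bar> < 2 * pi" using that by linarith
          then have "\<bar>of_int n :: real\<bar> < 1" by (simp add: abs_mult)
          then show ?thesis using n by simp
        qed
        have bd: "\<bar>fst y\<bar> < pi" "\<bar>snd y\<bar> < pi" if "y \<in> v ` fib x" for y
          using small that N\<delta>(2) by fastforce+
        have "fst u = fst u'"
          using fun_cong[OF eq, of "(1, 0)"] bd u by (intro aux) (auto simp: vdot_def)
        moreover have "snd u = snd u'"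
          using fun_cong[OF eq, of "(0, 1)"] bd u by (intro aux) (auto simp: vdot_def)
        ultimately show ?thesis by (simp add: prod_eq_iff)
      qed
      have "inj_on v (fib x)"
      proof (rule inj_onI)
        fix w w' assume w: "w \<in> fib x" "w' \<in> fib x" "v w = v w'"
        then have "frac (fst w) = frac (fst w')" "frac (snd w) = frac (snd w')" by (auto simp: v_def)
        then have "fst w - fst w' = of_int (\<lfloor>fst w\<rfloor> - \<lfloor>fst w'\<rfloor>)" "snd w - snd w' = of_int (\<lfloor>snd w\<rfloor> - \<lfloor>snd w'\<rfloor>)"
          by (simp_all add: frac_def)
        then have "fst w - fst w' \<in> \<int>" "snd w - snd w' \<in> \<int>" by (metis Ints_of_int)+
        then show "w = w'" using W(4) w by (auto simp: fib_def)
      qed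
      then have "card (v ` fib x) = card (fib x)" by (rule card_image)
      moreover have "finite (v ` fib x)" using W(1) by (simp add: fib_def)
      ultimately show ?thesis
        using card' small dual N\<delta>(1) char_inj
        by (intro exI[of _ "v ` fib x"]) (auto simp: inj_on_def dest!: less_trans[OF _ N\<delta>(1)])
    qed
  qed
  moreover have "1 / (real N)^2 > 0" using N by simp
  ultimately show ?thesis using that by blast
qed

text \<open>
  Dedekind's independence of characters, with coefficients in a vector space: replacing \<open>p\<close> by
  \<open>p + q\<close> and subtracting a multiple of the relation eliminates one character.
\<close>

lemma characters_independent:
  fixes \<kappa> :: "'i \<Rightarrow> 'g::monoid_add \<Rightarrow> complex" and sc :: "complex \<Rightarrow> 'b::ab_group_add \<Rightarrow> 'b"
  assumes sc: "vector_space sc" and fin: "finite V" and inj: "inj_on \<kappa> V"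
    and mult: "\<And>v p q. \<kappa> v (p + q) = \<kappa> v p * \<kappa> v q" and one: "\<And>v. \<kappa> v 0 = 1"
    and zero: "\<And>p. (\<Sum>v\<in>V. sc (\<kappa> v p) (u v)) = 0"
  shows "\<forall>v\<in>V. u v = 0"
  using fin inj zero
proof (induction V arbitrary: u rule: finite_induct)
  case empty
  then show ?case by simp
next
  case (insert a V)
  interpret vector_space sc by (rule sc)
  have rel: "(\<Sum>v\<in>V. sc (\<kappa> v p) (u v)) = - sc (\<kappa> a p) (u a)" for p
    using insert.prems(2)[of p] insert.hyps by (simp add: eq_neg_iff_add_eq_0 add.commute)
  have "\<forall>v\<in>V. sc (\<kappa> v q - \<kappa> a q) (u v) = 0" for q
  proof (rule insert.IH)
    show "inj_on \<kappa> V" using insert.prems(1) by simp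
    fix p
    have "(\<Sum>v\<in>V. sc (\<kappa> v p) (sc (\<kappa> v q - \<kappa> a q) (u v)))
        = (\<Sum>v\<in>V. sc (\<kappa> v (p + q)) (u v)) - sc (\<kappa> a q) (\<Sum>v\<in>V. sc (\<kappa> v p) (u v))"
      by (simp add: mult scale_sum_right algebra_simps flip: sum_subtractf)
    also have "\<dots> = 0" unfolding rel by (simp add: mult mult.commute)
    finally show "(\<Sum>v\<in>V. sc (\<kappa> v p) (sc (\<kappa> v q - \<kappa> a q) (u v))) = 0" .
  qed
  moreover have "\<exists>q. \<kappa> v q \<noteq> \<kappa> a q" if "v \<in> V" for v
    using insert.prems(1) insert.hyps(2) that by (metis ext inj_on_contraD insertCI)
  ultimately have V: "\<forall>v\<in>V. u v = 0" by (metis right_minus_eq scale_eq_0_iff)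
  then have "u a = 0" using rel[of 0] by (simp add: one)
  then show ?case using V by simp
qed

section \<open>Fourier decomposition of the transfer operator of a cover\<close>

lemma complex_banach_vector_space: "complex_banach sc \<Longrightarrow> vector_space sc"
  by (simp add: complex_banach_def)

lemma complex_banach_norm: "complex_banach sc \<Longrightarrow> norm (sc c x) = cmod c * norm x"
  by (simp add: complex_banach_def)

lemma scale_BL_vector_space:
  assumes "vector_space sc"
  shows "vector_space (scale_BL sc)"
proof -
  interpret vector_space sc by (rule assms)
  show ?thesis
    by standard (auto simp: scale_BL_def fun_eq_iff scale_right_distrib scale_left_distrib)
qed

lemma space_BL_subspace:
  assumes "vector_space sc"
  shows "module.subspace (scale_BL sc) (space_BL \<Lambda>)"
proof -
  interpret vector_space sc by (rule assms)
  interpret BL: vector_space "scale_BL sc" by (rule scale_BL_vector_space[OF assms])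
  show ?thesis
    unfolding BL.subspace_def by (auto simp: space_BL_def scale_BL_def)
qed

text \<open>
  On the cosets of a lattice to which \<open>v\<close> is dual the choice of the representative is immaterial. The
  minus sign makes the component of \<open>v\<close> correspond to the operator twisted by \<open>v\<close>.
\<close>

definition coset_char :: "real \<times> real \<Rightarrow> coset \<Rightarrow> complex" where
  "coset_char v g = cis (- vdot v (SOME p. p \<in> g))"

lemma coset_char_eq:
  assumes "rank2_lattice \<Lambda>" "dual_vec \<Lambda> v"
  shows "coset_char v (lattice_coset \<Lambda> p) = cis (- vdot v p)"
proof -
  have "p \<in> lattice_coset \<Lambda> p"
    using rank2_lattice_subgroup(1)[OF assms(1)] by (simp add: lattice_coset_def)
  then have "(SOME q. q \<in> lattice_coset \<Lambda> p) - p \<in> \<Lambda>"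
    using someI[of "\<lambda>q. q \<in> lattice_coset \<Lambda> p" p] by (simp add: lattice_coset_def)
  then have 1: "cis (vdot v ((SOME q. q \<in> lattice_coset \<Lambda> p) - p)) = 1"
    using assms(2) by (simp add: dual_vec_def)
  have "coset_char v (lattice_coset \<Lambda> p)
      = cis (- vdot v p) / cis (vdot v ((SOME q. q \<in> lattice_coset \<Lambda> p) - p))"
    by (simp add: coset_char_def cis_divide vdot_diff)
  then show ?thesis using 1 by simp
qed

lemma cmod_coset_char: "cmod (coset_char v g) = 1"
  by (simp add: coset_char_def)

definition char_tensor :: "(complex \<Rightarrow> 'b::banach \<Rightarrow> 'b) \<Rightarrow> (int \<times> int) set \<Rightarrow> real \<times> real \<Rightarrow> 'b \<Rightarrow> (coset \<Rightarrow> 'b)" where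
  "char_tensor sc \<Lambda> v u = (\<lambda>g. if g \<in> quot \<Lambda> then sc (coset_char v g) u else 0)"

lemma char_tensor_mem: "char_tensor sc \<Lambda> v u \<in> space_BL \<Lambda>"
  by (simp add: char_tensor_def space_BL_def)

lemma quot_nonempty: "quot \<Lambda> \<noteq> {}"
  by (simp add: quot_eq)

lemma norm_le_norm_BL:
  assumes "rank2_lattice \<Lambda>" "g \<in> quot \<Lambda>"
  shows "norm (x g) \<le> norm_BL \<Lambda> x"
  unfolding norm_BL_def using quot_finite[OF assms(1)] assms(2) by (intro Max_ge) auto

lemma norm_char_tensor:
  assumes "rank2_lattice \<Lambda>" "complex_banach sc"
  shows "norm_BL \<Lambda> (char_tensor sc \<Lambda> v u) = norm u"
proof -
  have "(\<lambda>g. norm (char_tensor sc \<Lambda> v u g)) ` quot \<Lambda> = {norm u}"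
    using quot_nonempty by (auto simp: char_tensor_def complex_banach_norm[OF assms(2)] cmod_coset_char)
  then show ?thesis by (simp add: norm_BL_def)
qed

text \<open>Backwards in time, the cover adds the displacement \<open>- F\<close> to the coset.\<close>

lemma cover_map_inverse:
  assumes sinai: "sinai_billiard Bl" and x: "x \<in> coll_space Bl"
  defines "y \<equiv> inv_into (coll_space Bl) (coll_map Bl) x"
  shows "inv_into (coll_space Bl \<times> quot \<Lambda>) (cover_map Bl) (x, lattice_coset \<Lambda> p)
    = (y, lattice_coset \<Lambda> (p - cell_shift Bl y))"
proof (rule inv_into_f_eq)
  note bij = coll_map_bij[OF sinai]
  have im: "x \<in> coll_map Bl ` coll_space Bl" using x bij by (simp add: bij_betw_def)
  show "inj_on (cover_map Bl) (coll_space Bl \<times> quot \<Lambda>)"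
  proof (rule inj_onI)
    fix s t assume st: "s \<in> coll_space Bl \<times> quot \<Lambda>" "t \<in> coll_space Bl \<times> quot \<Lambda>"
      and eq: "cover_map Bl s = cover_map Bl t"
    have cover: "cover_map Bl s = (coll_map Bl (fst s), (\<lambda>p. p + cell_shift Bl (fst s)) ` snd s)" for s
      by (simp add: cover_map_def case_prod_unfold)
    have same: "fst s = fst t"
      using inj_onD[OF bij_betw_imp_inj_on[OF bij], of "fst s" "fst t"] eq st by (auto simp: cover)
    have "inj (\<lambda>p. p + cell_shift Bl (fst s))" by (simp add: inj_def)
    moreover have "(\<lambda>p. p + cell_shift Bl (fst s)) ` snd s = (\<lambda>p. p + cell_shift Bl (fst s)) ` snd t"
      using eq unfolding cover same by (rule Pair_inject)
    ultimately have "snd s = snd t" by (simp only: inj_image_eq_iff)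
    with same show "s = t" by (rule prod_eqI)
  qed
  show "(y, lattice_coset \<Lambda> (p - cell_shift Bl y)) \<in> coll_space Bl \<times> quot \<Lambda>"
    using inv_into_into[OF im] by (auto simp: y_def quot_eq)
  show "cover_map Bl (y, lattice_coset \<Lambda> (p - cell_shift Bl y)) = (x, lattice_coset \<Lambda> p)"
    using f_inv_into_f[OF im] by (simp add: cover_map_def coset_translate y_def)
qed

lemma bounded_op_diff:
  assumes "bounded_op sc N X A" "x \<in> X" "y \<in> X" "x - y \<in> X"
  shows "A (x - y) = A x - A y"
proof -
  have "A ((x - y) + y) = A (x - y) + A y" using assms unfolding bounded_op_def by blast
  then show ?thesis by simp
qed

text \<open>
  On the isotypical component of a character, the transfer operator of the cover acts as the
  corresponding twisted operator. On \<open>C\<^sup>1\<close> functions both are given by composition with the inverse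
  of the same map; the general case follows by density.
\<close>

lemma transfer_op_char_tensor:
  assumes sinai: "sinai_billiard Bl" and D: "valid_params D" and B: "is_space_B Bl D sc emb"
    and \<Lambda>: "rank2_lattice \<Lambda>" and P: "is_transfer_op Bl D sc emb \<Lambda> P"
    and Q: "is_twisted_op Bl D sc emb v Q" and v: "dual_vec \<Lambda> v"
  shows "P (char_tensor sc \<Lambda> v u) = char_tensor sc \<Lambda> v (blinfun_apply Q u)"
proof -
  have cb: "complex_banach sc" using B by (simp add: is_space_B_def)
  interpret vector_space sc by (rule complex_banach_vector_space[OF cb])
  have bop: "bounded_op (scale_BL sc) (norm_BL \<Lambda>) (space_BL \<Lambda>) P"
    using P by (simp add: is_transfer_op_def)
  have smooth: "P (char_tensor sc \<Lambda> v (emb k)) g = sc (coset_char v g) (Q (emb k))"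
    if k: "k \<in> C1_coll Bl" and g: "g \<in> quot \<Lambda>" for k g
  proof -
    define h where "h = (\<lambda>(x, g). coset_char v g * k x)"
    have h: "h \<in> C1_cover Bl \<Lambda>"
      using C1_coll_scale[OF k] by (simp add: C1_cover_def h_def)
    have "\<forall>c. \<forall>h\<in>C1_coll Bl. emb (\<lambda>x. c * h x) = sc c (emb h)"
      using B by (simp add: is_space_B_def)
    then have emb_h: "emb_BL emb \<Lambda> h = char_tensor sc \<Lambda> v (emb k)"
      using k by (auto simp: emb_BL_def char_tensor_def h_def)
    have "defines_elt Bl D emb (\<lambda>x. h (inv_into (coll_space Bl \<times> quot \<Lambda>) (cover_map Bl) (x, g)))
          (P (emb_BL emb \<Lambda> h) g)"
      using P h g by (simp add: is_transfer_op_def)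
    moreover have "defines_elt Bl D emb
       ((\<lambda>x. cis (vdot v (cell_shift Bl x)) * k x) \<circ> inv_into (coll_space Bl) (coll_map Bl)) (Q (emb k))"
      using Q k by (simp add: is_twisted_op_def vdot_def)
    moreover have "h (inv_into (coll_space Bl \<times> quot \<Lambda>) (cover_map Bl) (x, g))
        = coset_char v g * ((\<lambda>x. cis (vdot v (cell_shift Bl x)) * k x) \<circ> inv_into (coll_space Bl) (coll_map Bl)) x"
      if x: "x \<in> coll_space Bl" for x
    proof -
      obtain p where p: "g = lattice_coset \<Lambda> p" using g by (auto simp: quot_eq)
      show ?thesis
        by (simp add: p cover_map_inverse[OF sinai x] h_def coset_char_eq[OF \<Lambda> v] vdot_diff cis_mult mult.assoc[symmetric])
    qed
    ultimately show ?thesis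
      unfolding emb_h by (rule defines_elt_unimodular[OF sinai D B _ _ cmod_coset_char])
  qed
  obtain y where y: "\<And>n. y n \<in> emb ` C1_coll Bl" "y \<longlonglongrightarrow> u"
    using B closure_sequential[of u "emb ` C1_coll Bl"] unfolding is_space_B_def by auto
  obtain C where C: "\<And>x. x \<in> space_BL \<Lambda> \<Longrightarrow> norm_BL \<Lambda> (P x) \<le> C * norm_BL \<Lambda> x"
    using bop unfolding bounded_op_def by blast
  show ?thesis
  proof
    fix g
    show "P (char_tensor sc \<Lambda> v u) g = char_tensor sc \<Lambda> v (blinfun_apply Q u) g"
    proof (cases "g \<in> quot \<Lambda>")
      case False
      have "P (char_tensor sc \<Lambda> v u) \<in> space_BL \<Lambda>"
        using bop char_tensor_mem unfolding bounded_op_def by blast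
      then show ?thesis using False by (simp add: space_BL_def char_tensor_def)
    next
      case True
      have tensor_diff: "char_tensor sc \<Lambda> v (a - b) = char_tensor sc \<Lambda> v a - char_tensor sc \<Lambda> v b" for a b
        by (auto simp: char_tensor_def scale_right_diff_distrib fun_eq_iff)
      have bound: "norm (P (char_tensor sc \<Lambda> v (y n)) g - P (char_tensor sc \<Lambda> v u) g) \<le> C * norm (y n - u)" for n
      proof -
        have "P (char_tensor sc \<Lambda> v (y n - u)) = P (char_tensor sc \<Lambda> v (y n)) - P (char_tensor sc \<Lambda> v u)"
          unfolding tensor_diff by (rule bounded_op_diff[OF bop]) (simp_all add: char_tensor_mem flip: tensor_diff)
        then have "norm (P (char_tensor sc \<Lambda> v (y n)) g - P (char_tensor sc \<Lambda> v u) g)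
            \<le> norm_BL \<Lambda> (P (char_tensor sc \<Lambda> v (y n - u)))"
          using norm_le_norm_BL[OF \<Lambda> True, of "P (char_tensor sc \<Lambda> v (y n - u))"] by simp
        also have "\<dots> \<le> C * norm (y n - u)"
          using C[OF char_tensor_mem, of sc v "y n - u"] by (simp add: norm_char_tensor[OF \<Lambda> cb])
        finally show ?thesis .
      qed
      have lim: "(\<lambda>n. C * norm (y n - u)) \<longlonglongrightarrow> 0"
        using y(2) by (intro tendsto_mult_right_zero) (simp add: LIM_zero tendsto_norm_zero)
      have "(\<lambda>n. P (char_tensor sc \<Lambda> v (y n)) g - P (char_tensor sc \<Lambda> v u) g) \<longlonglongrightarrow> 0"
        by (rule Lim_null_comparison[OF _ lim]) (intro always_eventually allI bound)
      then have "(\<lambda>n. P (char_tensor sc \<Lambda> v (y n)) g) \<longlonglongrightarrow> P (char_tensor sc \<Lambda> v u) g"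
        by (rule LIM_zero_cancel)
      moreover have "P (char_tensor sc \<Lambda> v (y n)) g = Q (sc (coset_char v g) (y n))" for n
        using y(1)[of n] smooth[OF _ True] Q by (auto simp: is_twisted_op_def)
      moreover have "(\<lambda>n. Q (sc (coset_char v g) (y n))) \<longlonglongrightarrow> Q (sc (coset_char v g) u)"
      proof (rule bounded_linear.tendsto[OF blinfun.bounded_linear_right],
          rule LIM_zero_cancel, rule tendsto_norm_zero_cancel)
        have "(\<lambda>n. norm (y n - u)) \<longlonglongrightarrow> 0" using y(2) by (simp add: LIM_zero tendsto_norm_zero)
        then show "(\<lambda>n. norm (sc (coset_char v g) (y n) - sc (coset_char v g) u)) \<longlonglongrightarrow> 0"
          by (simp add: complex_banach_norm[OF cb] cmod_coset_char flip: scale_right_diff_distrib)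
      qed
      ultimately have "P (char_tensor sc \<Lambda> v u) g = Q (sc (coset_char v g) u)"
        using LIMSEQ_unique by simp
      then show ?thesis using True Q by (simp add: char_tensor_def is_twisted_op_def)
    qed
  qed
qed

section \<open>Eigenvalues of the twisted operators near 1\<close>

lemma rank2_lattice_UNIV: "rank2_lattice UNIV"
  unfolding rank2_lattice_def
  by (rule exI[of _ 1], rule exI[of _ 0], rule exI[of _ 0], rule exI[of _ 1]) auto

lemma quot_UNIV: "quot UNIV = {UNIV}"
  by (auto simp: quot_eq lattice_coset_def)

text \<open>
  The cover by the full lattice is the billiard itself, so the untwisted operator inherits its
  spectral properties from the transfer operator of that cover.
\<close>

lemma twisted_eigenvalues_near_1:
  fixes sc :: "complex \<Rightarrow> 'b::banach \<Rightarrow> 'b"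
  assumes sinai: "sinai_billiard Bl" and D: "valid_params D" and B: "is_space_B Bl D sc emb"
    and dz: "demers_zhang Bl D sc emb P Q \<rho>" and \<epsilon>: "\<epsilon> > 0"
  obtains \<delta> where "\<delta> > 0"
    "\<And>v. \<bar>fst v\<bar> < \<delta> \<Longrightarrow> \<bar>snd v\<bar> < \<delta> \<Longrightarrow> \<exists>z u. u \<noteq> 0 \<and> Q v u = sc z u \<and> cmod (z - 1) < \<epsilon>"
proof -
  have cb: "complex_banach sc" using B by (simp add: is_space_B_def)
  interpret vector_space sc by (rule complex_banach_vector_space[OF cb])
  define X :: "(coset \<Rightarrow> 'b) set" where "X = space_BL UNIV"
  define N :: "(coset \<Rightarrow> 'b) \<Rightarrow> real" where "N = norm_BL UNIV"
  define \<iota> :: "'b \<Rightarrow> coset \<Rightarrow> 'b" where "\<iota> = char_tensor sc UNIV 0"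
  have \<iota>: "\<iota> u = (\<lambda>g. if g = UNIV then u else 0)" for u
    by (simp add: \<iota>_def char_tensor_def quot_UNIV coset_char_def vdot_def fun_eq_iff)
  have N: "N x = norm (x UNIV)" for x by (simp add: N_def norm_BL_def quot_UNIV)
  have \<iota>X: "\<iota> u \<in> X" for u by (simp add: X_def \<iota>_def char_tensor_mem)
  have X\<iota>: "\<iota> (x UNIV) = x" if "x \<in> X" for x
    using that by (auto simp: X_def space_BL_def \<iota> quot_UNIV)
  note dzU = dz[unfolded demers_zhang_def, THEN conjunct2, THEN conjunct1, rule_format, OF rank2_lattice_UNIV]
  have dual0: "dual_vec UNIV 0" by (simp add: dual_vec_def vdot_def)
  have P\<iota>: "P UNIV (\<iota> u) = \<iota> (Q 0 u)" for u
    unfolding \<iota>_def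
    by (rule transfer_op_char_tensor[OF sinai D B rank2_lattice_UNIV _ _ dual0])
      (use dzU dz in \<open>unfold demers_zhang_def, blast+\<close>)
  have A: "bounded_op (scale_BL sc) N X (P UNIV)"
    using dzU by (simp add: is_transfer_op_def N_def X_def)
  have vs: "vector_space (scale_BL sc)" by (rule scale_BL_vector_space[OF complex_banach_vector_space[OF cb]])
  have sub: "module.subspace (scale_BL sc) X"
    unfolding X_def by (rule space_BL_subspace[OF complex_banach_vector_space[OF cb]])
  have ev: "1 \<in> eigenvalues_on (scale_BL sc) X (P UNIV)" using dzU by (auto simp: X_def)
  have disc: "1 \<in> discrete_spectrum_on (scale_BL sc) N X (P UNIV)"
    by (rule eigenvalue_discrete[OF vs A sub ev, where C = 1 and \<rho> = \<rho>])
      (use dzU dz in \<open>auto simp: N_def X_def demers_zhang_def\<close>)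
  have simple: "alg_mult (scale_BL sc) X (P UNIV) 1 = 1" using dzU by (simp add: X_def)
  obtain e V f C where e: "e \<in> X" "e \<noteq> 0" "P UNIV e = e"
    and V: "\<And>x. x \<in> X \<Longrightarrow> V x \<in> X"
    "\<And>x y. x \<in> X \<Longrightarrow> y \<in> X \<Longrightarrow> V (x + y) = V x + V y"
    "\<And>x. x \<in> X \<Longrightarrow> N (V x) \<le> C * N x"
    and f: "\<And>x y. x \<in> X \<Longrightarrow> y \<in> X \<Longrightarrow> f (x + y) = f x + f y"
    "\<And>c x. x \<in> X \<Longrightarrow> f (scale_BL sc c x) = c * f x"
    "\<And>x. x \<in> X \<Longrightarrow> cmod (f x) \<le> C * N x" "f e = 1"
    and fV: "\<And>x. x \<in> X \<Longrightarrow> f (V x) = 0"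
    and AV: "\<And>x. x \<in> X \<Longrightarrow> P UNIV (V x) - V x = x - scale_BL sc (f x) e"
  proof (rule simple_eigenvalue_reduced_resolvent[OF vs sub A disc simple ev])
    show "N (scale_BL sc c x) = cmod c * N x" for c x
      by (simp add: N scale_BL_def complex_banach_norm[OF cb])
    show "N (x - y) \<le> N x + N y" for x y by (simp add: N norm_triangle_ineq4)
    show "N x > 0" if "x \<in> X" "x \<noteq> 0" for x
    proof -
      have "\<iota> 0 = 0" by (auto simp: \<iota> fun_eq_iff)
      then have "x UNIV \<noteq> 0" using X\<iota>[OF that(1)] that(2) by metis
      then show ?thesis by (simp add: N)
    qed
  qed (rule that)
  have \<iota>_add: "\<iota> (x + y) = \<iota> x + \<iota> y" for x y by (auto simp: \<iota> fun_eq_iff)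
  have \<iota>_sc: "\<iota> (sc c x) = scale_BL sc c (\<iota> x)" for c x by (auto simp: \<iota> fun_eq_iff scale_BL_def)
  have \<iota>U: "\<iota> u UNIV = u" for u by (simp add: \<iota>)
  define V' where "V' u = V (\<iota> u) UNIV" for u
  have \<iota>V: "\<iota> (V' u) = V (\<iota> u)" for u unfolding V'_def by (rule X\<iota>[OF V(1)[OF \<iota>X]])
  have PU: "P UNIV x UNIV = Q 0 (x UNIV)" if "x \<in> X" for x
    using P\<iota>[of "x UNIV"] X\<iota>[OF that] by (simp add: \<iota>U)
  obtain \<eta> where \<eta>: "\<eta> > 0"
    "\<And>R :: 'b \<Rightarrow>\<^sub>L 'b. norm (R - Q 0) < \<eta> \<Longrightarrow> \<exists>z u. u \<noteq> 0 \<and> R u = sc z u \<and> cmod (z - 1) < \<epsilon>"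
  proof (rule eigenvalue_perturbation[OF cb, where A = "Q 0" and e = "e UNIV" and V = V' and f = "\<lambda>u. f (\<iota> u)" and C = C])
    show "Q 0 (e UNIV) = e UNIV" using PU[OF e(1)] e(3) by simp
    show "V' (x + y) = V' x + V' y" for x y by (simp add: V'_def \<iota>_add V(2) \<iota>X)
    show "norm (V' x) \<le> C * norm x" for x using V(3)[OF \<iota>X, of x] by (simp add: N V'_def \<iota>U)
    show "f (\<iota> (x + y)) = f (\<iota> x) + f (\<iota> y)" for x y by (simp add: \<iota>_add f(1) \<iota>X)
    show "f (\<iota> (sc c x)) = c * f (\<iota> x)" for c x by (simp add: \<iota>_sc f(2) \<iota>X)
    show "cmod (f (\<iota> x)) \<le> C * norm x" for x using f(3)[OF \<iota>X, of x] by (simp add: N \<iota>U)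
    show "f (\<iota> (e UNIV)) = 1" by (simp add: X\<iota>[OF e(1)] f(4))
    show "f (\<iota> (V' x)) = 0" for x by (simp add: \<iota>V fV \<iota>X)
    show "Q 0 (V' x) - V' x = x - sc (f (\<iota> x)) (e UNIV)" for x
      using fun_cong[OF AV[OF \<iota>X, of x], of UNIV] PU[OF V(1)[OF \<iota>X, of x]]
      by (simp add: V'_def \<iota>U scale_BL_def)
    show "\<epsilon> > 0" by (rule \<epsilon>)
  qed (rule that)
  have "real_analytic2 Q" using dz by (simp add: demers_zhang_def)
  then obtain \<delta> where \<delta>: "\<delta> > 0" "\<And>s t. \<bar>s\<bar> < \<delta> \<Longrightarrow> \<bar>t\<bar> < \<delta> \<Longrightarrow> norm (Q (s, t) - Q (0, 0)) < \<eta>"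
    using real_analytic2_continuous_at_0 \<eta>(1) by metis
  show ?thesis
    by (rule that[OF \<delta>(1)]) (metis \<eta>(2) \<delta>(2) prod.collapse zero_prod_def)
qed

section \<open>Counting resonances\<close>

text \<open>
  Eigenvectors for the same eigenvalue attached to distinct characters are independent.
\<close>

lemma char_tensor_independent:
  fixes sc :: "complex \<Rightarrow> 'b::banach \<Rightarrow> 'b"
  assumes cb: "complex_banach sc" and \<Lambda>: "rank2_lattice \<Lambda>" and fin: "finite V"
    and inj: "inj_on (\<lambda>v p. cis (- vdot v p)) V" and dual: "\<And>v. v \<in> V \<Longrightarrow> dual_vec \<Lambda> v"
    and u: "\<And>v. v \<in> V \<Longrightarrow> u v \<noteq> 0"
  shows "inj_on (\<lambda>v. char_tensor sc \<Lambda> v (u v)) V"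
    "\<not> module.dependent (scale_BL sc) ((\<lambda>v. char_tensor sc \<Lambda> v (u v)) ` V)"
proof -
  interpret vector_space sc by (rule complex_banach_vector_space[OF cb])
  interpret BL: vector_space "scale_BL sc" by (rule scale_BL_vector_space[OF complex_banach_vector_space[OF cb]])
  define x where "x v = char_tensor sc \<Lambda> v (u v)" for v
  have sum_at: "(\<Sum>v\<in>A. scale_BL sc (c v) (x v)) g = (\<Sum>v\<in>A. sc (c v) (x v g))" if "finite A" for A c g
    using that by (induction A rule: finite_induct) (auto simp: scale_BL_def)
  have coeff: "\<forall>v\<in>A. c v = 0" if A: "A \<subseteq> V" and zero: "(\<Sum>v\<in>A. scale_BL sc (c v) (x v)) = 0" for A c
  proof -
    have finA: "finite A" using A fin by (rule finite_subset)
    have "(\<Sum>v\<in>A. sc (cis (- vdot v p)) (sc (c v) (u v))) = 0" for p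
    proof -
      have "(\<Sum>v\<in>A. sc (c v) (x v (lattice_coset \<Lambda> p))) = 0"
        using fun_cong[OF zero, of "lattice_coset \<Lambda> p"] unfolding sum_at[OF finA] by simp
      moreover have "sc (c v) (x v (lattice_coset \<Lambda> p)) = sc (cis (- vdot v p)) (sc (c v) (u v))"
        if "v \<in> A" for v
        using coset_char_eq[OF \<Lambda> dual[OF subsetD[OF A that]], of p]
        by (auto simp: x_def char_tensor_def quot_eq mult.commute)
      ultimately show ?thesis by simp
    qed
    then have "\<forall>v\<in>A. sc (c v) (u v) = 0"
    proof (intro characters_independent[OF complex_banach_vector_space[OF cb] finA inj_on_subset[OF inj A]])
      show "cis (- vdot v (p + q)) = cis (- vdot v p) * cis (- vdot v q)" for v p q
        by (simp add: vdot_add cis_mult)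
      show "cis (- vdot v 0) = 1" for v by (simp add: vdot_def)
    qed
    then show ?thesis using u A by auto
  qed
  have x_inj: "inj_on x V"
  proof (rule inj_onI, rule ccontr)
    fix v w assume vw: "v \<in> V" "w \<in> V" "x v = x w" "v \<noteq> w"
    define c :: "real \<times> real \<Rightarrow> complex" where "c a = (if a = v then 1 else - 1)" for a
    have "(\<Sum>a\<in>{v, w}. scale_BL sc (c a) (x a)) = 0" using vw by (simp add: c_def)
    then have "c v = 0" using coeff[of "{v, w}" c] vw by blast
    then show False by (simp add: c_def)
  qed
  then show "inj_on (\<lambda>v. char_tensor sc \<Lambda> v (u v)) V" by (simp add: x_def[abs_def])
  have "BL.independent (x ` V)"
  proof (rule BL.independent_if_scalars_zero)
    show "finite (x ` V)" using fin by simp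
    fix c y assume zero: "(\<Sum>y\<in>x ` V. scale_BL sc (c y) y) = 0" and y: "y \<in> x ` V"
    have "(\<Sum>v\<in>V. scale_BL sc (c (x v)) (x v)) = 0"
      using zero by (simp add: sum.reindex[OF x_inj] o_def)
    then show "c y = 0" using coeff[of V "\<lambda>v. c (x v)"] y by blast
  qed
  then show "\<not> module.dependent (scale_BL sc) ((\<lambda>v. char_tensor sc \<Lambda> v (u v)) ` V)"
    by (simp add: x_def[abs_def])
qed

theorem proposition2p1:
  fixes Bl :: billiard
    and D :: dz_params
    and sc :: "complex \<Rightarrow> 'b::banach \<Rightarrow> 'b"
    and emb :: "(phase \<Rightarrow> complex) \<Rightarrow> 'b"
    and P :: "(int \<times> int) set \<Rightarrow> (coset \<Rightarrow> 'b) \<Rightarrow> (coset \<Rightarrow> 'b)"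
    and Q :: "real \<times> real \<Rightarrow> 'b \<Rightarrow>\<^sub>L 'b"
    and \<rho> :: real
    and U :: "complex set"
  assumes "sinai_billiard Bl"
    and "valid_params D"
    and "is_space_B Bl D sc emb"
    and "demers_zhang Bl D sc emb P Q \<rho>"
    and "1 \<in> interior U"
  shows "(\<exists>c>0. \<forall>\<Lambda>. rank2_lattice \<Lambda> \<longrightarrow>
            (\<exists>S. finite S \<and>
                 S \<subseteq> ruelle_resonances \<rho> (scale_BL sc) (space_BL \<Lambda>) (P \<Lambda>) \<inter> U \<and>
                 c * real (card (quot \<Lambda>))
                   \<le> (\<Sum>z\<in>S. real (alg_mult (scale_BL sc) (space_BL \<Lambda>) (P \<Lambda>) z))))
       \<and> (\<exists>N. \<forall>\<Lambda>. rank2_lattice \<Lambda> \<and> card (quot \<Lambda>) \<ge> N \<longrightarrow>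
            (\<exists>z \<in> ruelle_resonances \<rho> (scale_BL sc) (space_BL \<Lambda>) (P \<Lambda>) \<inter> U. z \<noteq> 1))"
proof -
  have cb: "complex_banach sc" using assms(3) by (simp add: is_space_B_def)
  note vs = complex_banach_vector_space[OF cb]
  interpret vector_space sc by (rule vs)
  interpret BL: vector_space "scale_BL sc" by (rule scale_BL_vector_space[OF vs])
  have \<rho>: "\<rho> < 1" using assms(4) by (simp add: demers_zhang_def)
  note dz = assms(4)[unfolded demers_zhang_def, THEN conjunct2, THEN conjunct1, rule_format]
  obtain r where r: "r > 0" "ball 1 r \<subseteq> U" using assms(5) by (meson mem_interior)
  \<comment> \<open>An eigenvalue at distance less than \<open>\<epsilon>\<close> from \<open>1\<close> lies in \<open>U\<close> and outside the disk of radius \<open>\<rho>\<close>.\<close>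
  define \<epsilon> where "\<epsilon> = min r (1 - \<rho>)"
  have \<epsilon>: "\<epsilon> > 0" using r \<rho> by (simp add: \<epsilon>_def)
  obtain \<delta> where \<delta>: "\<delta> > 0"
    "\<And>v. \<bar>fst v\<bar> < \<delta> \<Longrightarrow> \<bar>snd v\<bar> < \<delta> \<Longrightarrow> \<exists>z u. u \<noteq> 0 \<and> Q v u = sc z u \<and> cmod (z - 1) < \<epsilon>"
    by (rule twisted_eigenvalues_near_1[OF assms(1-4) \<epsilon>]) (rule that)
  obtain c where c: "c > 0" "\<And>\<Lambda>. rank2_lattice \<Lambda> \<Longrightarrow> \<exists>V. finite V \<and> c * real (card (quot \<Lambda>)) \<le> real (card V) \<and>
       inj_on (\<lambda>v p. cis (- vdot v p)) V \<and>
       (\<forall>v\<in>V. \<bar>fst v\<bar> < \<delta> \<and> \<bar>snd v\<bar> < \<delta> \<and> dual_vec \<Lambda> v)"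
    by (rule many_small_characters[OF \<delta>(1)]) (rule that)
  have near_1: "z \<in> U" "cmod z > \<rho>" if "cmod (z - 1) < \<epsilon>" for z
  proof -
    have "z \<in> ball 1 r" using that by (simp add: \<epsilon>_def dist_norm norm_minus_commute)
    then show "z \<in> U" using r by blast
    have "cmod 1 - cmod (1 - z) \<le> cmod z" using norm_triangle_ineq2[of 1 "1 - z"] by simp
    then show "cmod z > \<rho>" using that by (simp add: \<epsilon>_def norm_minus_commute)
  qed
  have many: "\<exists>S. finite S \<and>
                 S \<subseteq> ruelle_resonances \<rho> (scale_BL sc) (space_BL \<Lambda>) (P \<Lambda>) \<inter> U \<and>
                 c * real (card (quot \<Lambda>))
                   \<le> (\<Sum>z\<in>S. real (alg_mult (scale_BL sc) (space_BL \<Lambda>) (P \<Lambda>) z))"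
    if \<Lambda>: "rank2_lattice \<Lambda>" for \<Lambda>
  proof -
    obtain V where V: "finite V" "c * real (card (quot \<Lambda>)) \<le> real (card V)"
       "inj_on (\<lambda>v p. cis (- vdot v p)) V"
       "\<And>v. v \<in> V \<Longrightarrow> \<bar>fst v\<bar> < \<delta>" "\<And>v. v \<in> V \<Longrightarrow> \<bar>snd v\<bar> < \<delta>" "\<And>v. v \<in> V \<Longrightarrow> dual_vec \<Lambda> v"
      using c(2)[OF \<Lambda>] by blast
    have "\<forall>v\<in>V. \<exists>z u. u \<noteq> 0 \<and> Q v u = sc z u \<and> cmod (z - 1) < \<epsilon>" using \<delta>(2) V(4,5) by blast
    then obtain \<mu> u where \<mu>: "\<And>v. v \<in> V \<Longrightarrow> u v \<noteq> 0" "\<And>v. v \<in> V \<Longrightarrow> Q v (u v) = sc (\<mu> v) (u v)"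
        "\<And>v. v \<in> V \<Longrightarrow> cmod (\<mu> v - 1) < \<epsilon>"
      by metis
    define x where "x v = char_tensor sc \<Lambda> v (u v)" for v
    have A: "bounded_op (scale_BL sc) (norm_BL \<Lambda>) (space_BL \<Lambda>) (P \<Lambda>)"
      using dz[OF \<Lambda>] by (simp add: is_transfer_op_def)
    have x_space: "x v \<in> space_BL \<Lambda>" for v by (simp add: x_def char_tensor_mem)
    have x_eigen: "P \<Lambda> (x v) = scale_BL sc (\<mu> v) (x v)" if v: "v \<in> V" for v
    proof -
      have "is_twisted_op Bl D sc emb v (Q v)"
        using assms(4) unfolding demers_zhang_def by blast
      then have "P \<Lambda> (x v) = char_tensor sc \<Lambda> v (Q v (u v))"
        unfolding x_def using dz[OF \<Lambda>] transfer_op_char_tensor[OF assms(1-3) \<Lambda> _ _ V(6)[OF v]] by blast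
      also have "\<dots> = scale_BL sc (\<mu> v) (x v)"
        by (auto simp: \<mu>(2)[OF v] x_def char_tensor_def scale_BL_def mult.commute)
      finally show ?thesis .
    qed
    have x_nz: "x v \<noteq> 0" if v: "v \<in> V" for v
    proof
      assume "x v = 0"
      then have "x v (lattice_coset \<Lambda> 0) = 0" by simp
      then show False
        using \<mu>(1)[OF v] by (simp add: x_def char_tensor_def quot_eq coset_char_eq[OF \<Lambda> V(6)[OF v]])
    qed
    have res: "\<mu> v \<in> eigenvalues_on (scale_BL sc) (space_BL \<Lambda>) (P \<Lambda>)" if "v \<in> V" for v
      using x_space x_eigen[OF that] x_nz[OF that] unfolding eigenvalues_on_def by blast
    define fib where "fib z = {v \<in> V. \<mu> v = z}" for z
    have mult: "card (fib z) \<le> alg_mult (scale_BL sc) (space_BL \<Lambda>) (P \<Lambda>) z" if z: "z \<in> \<mu> ` V" for z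
    proof -
      have "z \<in> discrete_spectrum_on (scale_BL sc) (norm_BL \<Lambda>) (space_BL \<Lambda>) (P \<Lambda>)"
        by (rule eigenvalue_discrete[OF BL.vector_space_axioms A space_BL_subspace[OF vs], where C = 1 and \<rho> = \<rho>])
          (use res z dz[OF \<Lambda>] near_1(2)[OF \<mu>(3)] in auto)
      then obtain S where S: "finite S"
        "gen_eigenspace (scale_BL sc) (space_BL \<Lambda>) (P \<Lambda>) z = BL.span S"
        by (rule discrete_spectrum_splitting[OF BL.vector_space_axioms space_BL_subspace[OF vs] A]) (rule that)
      have sub: "fib z \<subseteq> V" by (auto simp: fib_def)
      have ind: "inj_on x (fib z)" "BL.independent (x ` fib z)"
        using char_tensor_independent[OF cb \<Lambda> finite_subset[OF sub V(1)] inj_on_subset[OF V(3) sub], of u]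
          V(6) \<mu>(1) sub unfolding x_def by blast+
      have "x ` fib z \<subseteq> gen_eigenspace (scale_BL sc) (space_BL \<Lambda>) (P \<Lambda>) z"
        using x_space x_eigen by (auto simp: gen_eigenspace_def fib_def intro!: exI[of _ 1])
      then have "card (x ` fib z) \<le> BL.dim (gen_eigenspace (scale_BL sc) (space_BL \<Lambda>) (P \<Lambda>) z)"
        by (rule BL.card_le_dim_finite[OF equalityD1[OF S(2)] S(1) _ ind(2)])
      then show ?thesis by (simp add: alg_mult_def card_image[OF ind(1)])
    qed
    have "V = (\<Union>z\<in>\<mu> ` V. fib z)" by (auto simp: fib_def)
    then have "card V \<le> (\<Sum>z\<in>\<mu> ` V. card (fib z))" using card_UN_le[of "\<mu> ` V" fib] V(1) by simp
    also have "\<dots> \<le> (\<Sum>z\<in>\<mu> ` V. alg_mult (scale_BL sc) (space_BL \<Lambda>) (P \<Lambda>) z)"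
      by (rule sum_mono[OF mult])
    finally have "real (card V) \<le> (\<Sum>z\<in>\<mu> ` V. real (alg_mult (scale_BL sc) (space_BL \<Lambda>) (P \<Lambda>) z))"
      unfolding of_nat_sum[symmetric] by (rule of_nat_mono)
    moreover have "\<mu> v \<in> ruelle_resonances \<rho> (scale_BL sc) (space_BL \<Lambda>) (P \<Lambda>) \<inter> U" if "v \<in> V" for v
      using res[OF that] near_1[OF \<mu>(3)[OF that]] by (simp add: ruelle_resonances_def)
    ultimately show ?thesis
      using V(1,2) by (intro exI[of _ "\<mu> ` V"]) auto
  qed
  have "\<exists>z \<in> ruelle_resonances \<rho> (scale_BL sc) (space_BL \<Lambda>) (P \<Lambda>) \<inter> U. z \<noteq> 1"
    if \<Lambda>: "rank2_lattice \<Lambda>" and large: "card (quot \<Lambda>) \<ge> nat \<lceil>2 / c\<rceil>" for \<Lambda>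
  proof (rule ccontr)
    assume no: "\<not> ?thesis"
    obtain S where S: "finite S" "S \<subseteq> ruelle_resonances \<rho> (scale_BL sc) (space_BL \<Lambda>) (P \<Lambda>) \<inter> U"
       "c * real (card (quot \<Lambda>)) \<le> (\<Sum>z\<in>S. real (alg_mult (scale_BL sc) (space_BL \<Lambda>) (P \<Lambda>) z))"
      using many[OF \<Lambda>] by blast
    have "S \<subseteq> {1}" using S(2) no by blast
    then have "(\<Sum>z\<in>S. real (alg_mult (scale_BL sc) (space_BL \<Lambda>) (P \<Lambda>) z))
        \<le> (\<Sum>z\<in>{1}. real (alg_mult (scale_BL sc) (space_BL \<Lambda>) (P \<Lambda>) z))"
      by (intro sum_mono2) auto
    also have "\<dots> = 1" using dz[OF \<Lambda>] by simp
    finally have "c * real (card (quot \<Lambda>)) \<le> 1" using S(3) by simp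
    moreover have "2 / c \<le> real (card (quot \<Lambda>))" using large by linarith
    then have "2 \<le> c * real (card (quot \<Lambda>))" using c(1) by (simp add: field_simps)
    ultimately show False by simp
  qed
  then show ?thesis using c(1) many by blast
qed

end
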